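(* Let $\eta:=\frac1{1-\alpha}$. Given $c\in\mathcal C$, let $X^x$ denote, for each $x>0$, the unique strong solution of $dX_t=(X_t^\alpha-\mu X_t-c_tX_t)dt-\sigma X_t\,dW_t$, $X_0=x$. Then for all $x>0$ and $t\ge0$, $$\mathbb E[X^x_t]\le 2^{\eta-1}(x+t^\eta)\qquad\text{and}\qquad \mathbb E[(X^x_t)^2]\le 2^{2\eta-1}e^{\sigma^2t}\Big(x^2+\frac{t^{2\eta-1}}{\sigma^2}\Big).$$ Moreover, for any $\varepsilon>0$ there exists $C_\varepsilon>0$ such that $$\mathbb E\big[|X^x_t-X^y_t|\big]\le C_\varepsilon|x-y|+\varepsilon(x+y+t^\eta)\qquad\text{for all }x,y>0\text{ and }t\ge0.$$
   Context: Let $\Omega=\{\omega\in C([0,\infty);\mathbb R):\omega_0=0\}$, $W$ the canonical process, $\mathbb P$ the Wiener measure, and $\mathbb F=\{\mathcal F_t\}_{t\ge0}$ the $\mathbb P$-augmentation of the natural filtration of $W$. Constants: $\alpha\in(0,1)$, $\sigma>0$, $\mu>0$. $\mathcal C$ is the set of progressively measurable $c:\Omega\times[0,\infty)\to[0,\infty)$ with $\int_0^t c_s\,ds<\infty$ for all $t>0$ a.s. For $c\in\mathcal C$ and $x>0$ the equation has a unique strong solution (continuous, adapted), which is strictly positive a.s. In the last estimate $X^x$ and $X^y$ are driven by the same $c$ and the same $W$. *)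

theory Defs
  imports "HOL-Probability.Probability"
begin

section \<open>Wiener space\<close>

text \<open>Paths are functions on the whole real line that are \<^const>\<open>undefined\<close> at negative times, so
  that each element of \<open>C([0,\<infinity>); \<real>)\<close> starting at \<open>0\<close> is represented exactly once.\<close>

definition wiener_paths :: "(real \<Rightarrow> real) set" where
  "wiener_paths = {\<omega> \<in> extensional {0..}. continuous_on {0..} \<omega> \<and> \<omega> 0 = 0}"

text \<open>The canonical process evaluates the path.\<close>

definition W :: "real \<Rightarrow> (real \<Rightarrow> real) \<Rightarrow> real" where
  "W t \<omega> = \<omega> t"

text \<open>The \<open>\<sigma>\<close>-algebra on path space is the one generated by the coordinates (the trace of the
  product \<open>\<sigma>\<close>-algebra).\<close>

definition path_space :: "(real \<Rightarrow> real) measure" where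
  "path_space = restrict_space (\<Pi>\<^sub>M t\<in>{0..}. borel) wiener_paths"

text \<open>Wiener measure is the unique measure on path space satisfying this predicate.\<close>

definition wiener_measure :: "(real \<Rightarrow> real) measure \<Rightarrow> bool" where
  "wiener_measure P \<longleftrightarrow>
     prob_space P \<and> space P = space path_space \<and> sets P = sets path_space \<and>
     (\<forall>s t. 0 \<le> s \<and> s < t \<longrightarrow>
        distributed P lborel (\<lambda>\<omega>. W t \<omega> - W s \<omega>) (normal_density 0 (sqrt (t - s)))) \<and>
     (\<forall>n (\<tau> :: nat \<Rightarrow> real). 0 \<le> \<tau> 0 \<and> (\<forall>i<n. \<tau> i \<le> \<tau> (Suc i)) \<longrightarrow>
        prob_space.indep_vars P (\<lambda>_. borel) (\<lambda>i \<omega>. W (\<tau> (Suc i)) \<omega> - W (\<tau> i) \<omega>) {..<n})"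

text \<open>Augmentation adjoins all null sets of the completion, so that the filtration lives on
  \<^term>\<open>completion P\<close> rather than on \<open>P\<close>.\<close>

definition augmented_filtration :: "(real \<Rightarrow> real) measure \<Rightarrow> real \<Rightarrow> (real \<Rightarrow> real) measure" where
  "augmented_filtration P t =
     sigma (space P)
       ({W s -` B \<inter> space P | s B. 0 \<le> s \<and> s \<le> t \<and> B \<in> sets borel} \<union> null_sets (completion P))"

section \<open>Processes and the stochastic integral\<close>

text \<open>Processes are functions of time and scenario; only their values at times \<open>t \<ge> 0\<close> matter.\<close>

definition adapted :: "(real \<Rightarrow> 'a measure) \<Rightarrow> (real \<Rightarrow> 'a \<Rightarrow> real) \<Rightarrow> bool" where
  "adapted F X \<longleftrightarrow> (\<forall>t\<ge>0. X t \<in> borel_measurable (F t))"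

definition progressively_measurable :: "(real \<Rightarrow> 'a measure) \<Rightarrow> (real \<Rightarrow> 'a \<Rightarrow> real) \<Rightarrow> bool" where
  "progressively_measurable F X \<longleftrightarrow>
     (\<forall>t\<ge>0. (\<lambda>(s, \<omega>). X s \<omega>) \<in> borel_measurable (restrict_space borel {0..t} \<Otimes>\<^sub>M F t))"

definition continuous_process :: "'a measure \<Rightarrow> (real \<Rightarrow> 'a \<Rightarrow> real) \<Rightarrow> bool" where
  "continuous_process M X \<longleftrightarrow> (AE \<omega> in M. continuous_on {0..} (\<lambda>t. X t \<omega>))"

text \<open>Simple integrands \<open>\<Sum>\<^bsub>i<n\<^esub> \<xi>\<^sub>i 1\<^bsub>(\<tau>\<^sub>i, \<tau>\<^sub>i\<^sub>+\<^sub>1]\<^esub>\<close> with bounded \<open>F(\<tau>\<^sub>i)\<close>-measurable coefficients.\<close>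

definition simple_integrand ::
  "'a measure \<Rightarrow> (real \<Rightarrow> 'a measure) \<Rightarrow> nat \<Rightarrow> (nat \<Rightarrow> real) \<Rightarrow> (nat \<Rightarrow> 'a \<Rightarrow> real) \<Rightarrow> bool" where
  "simple_integrand M F n \<tau> \<xi> \<longleftrightarrow>
     0 \<le> \<tau> 0 \<and> (\<forall>i<n. \<tau> i \<le> \<tau> (Suc i)) \<and>
     (\<forall>i<n. \<xi> i \<in> borel_measurable (F (\<tau> i)) \<and> (\<exists>K. \<forall>\<omega>\<in>space M. \<bar>\<xi> i \<omega>\<bar> \<le> K))"

definition simple_process :: "nat \<Rightarrow> (nat \<Rightarrow> real) \<Rightarrow> (nat \<Rightarrow> 'a \<Rightarrow> real) \<Rightarrow> real \<Rightarrow> 'a \<Rightarrow> real" where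
  "simple_process n \<tau> \<xi> t \<omega> = (\<Sum>i<n. \<xi> i \<omega> * indicator {\<tau> i<..\<tau> (Suc i)} t)"

definition simple_integral ::
  "(real \<Rightarrow> 'a \<Rightarrow> real) \<Rightarrow> nat \<Rightarrow> (nat \<Rightarrow> real) \<Rightarrow> (nat \<Rightarrow> 'a \<Rightarrow> real) \<Rightarrow> real \<Rightarrow> 'a \<Rightarrow> real" where
  "simple_integral B n \<tau> \<xi> t \<omega> =
     (\<Sum>i<n. \<xi> i \<omega> * (B (min t (\<tau> (Suc i))) \<omega> - B (min t (\<tau> i)) \<omega>))"

text \<open>\<open>I\<close> is (a version of) the Ito integral process \<open>\<integral>\<^sub>0\<^sup>t H dB\<close>: the integrand is progressively measurable
  with a.s. locally square-integrable paths, and \<open>I\<close> is the limit, uniformly on compact time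
  intervals in probability, of the integrals of simple integrands \<open>H\<^sup>k\<close> for which
  \<open>\<integral>\<^sub>0\<^sup>T (H\<^sup>k - H)\<^sup>2 ds \<rightarrow> 0\<close> in probability. Such an \<open>I\<close> is unique up to indistinguishability.\<close>

definition is_ito_integral ::
  "'a measure \<Rightarrow> (real \<Rightarrow> 'a measure) \<Rightarrow> (real \<Rightarrow> 'a \<Rightarrow> real) \<Rightarrow> (real \<Rightarrow> 'a \<Rightarrow> real) \<Rightarrow>
    (real \<Rightarrow> 'a \<Rightarrow> real) \<Rightarrow> bool" where
  "is_ito_integral M F B H I \<longleftrightarrow>
     progressively_measurable F H \<and>
     (AE \<omega> in M. \<forall>T\<ge>0. (\<integral>\<^sup>+s\<in>{0..T}. ennreal ((H s \<omega>)\<^sup>2) \<partial>lborel) < \<infinity>) \<and>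
     adapted F I \<and> continuous_process M I \<and>
     (\<exists>n \<tau> \<xi>. (\<forall>k. simple_integrand M F (n k) (\<tau> k) (\<xi> k)) \<and>
       (\<forall>T\<ge>0. \<forall>\<epsilon>>0.
         (\<lambda>k. measure M {\<omega> \<in> space M. ennreal \<epsilon> <
            (\<integral>\<^sup>+s\<in>{0..T}. ennreal ((simple_process (n k) (\<tau> k) (\<xi> k) s \<omega> - H s \<omega>)\<^sup>2) \<partial>lborel)})
           \<longlonglongrightarrow> 0 \<and>
         (\<lambda>k. measure M {\<omega> \<in> space M. \<exists>t\<in>{0..T}.
            \<epsilon> < \<bar>simple_integral B (n k) (\<tau> k) (\<xi> k) t \<omega> - I t \<omega>\<bar>})
           \<longlonglongrightarrow> 0))"

section \<open>The controlled equation\<close>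

definition consumption_processes :: "(real \<Rightarrow> real) measure \<Rightarrow> (real \<Rightarrow> (real \<Rightarrow> real) \<Rightarrow> real) set" where
  "consumption_processes P =
     {c. progressively_measurable (augmented_filtration P) c \<and>
         (\<forall>t\<ge>0. \<forall>\<omega>\<in>space P. 0 \<le> c t \<omega>) \<and>
         (AE \<omega> in completion P. \<forall>t>0. (\<integral>\<^sup>+s\<in>{0..t}. ennreal (c s \<omega>) \<partial>lborel) < \<infinity>)}"

text \<open>Strong solutions of \<open>dX = (X\<^sup>\<alpha> - \<mu> X - c X) dt - \<sigma> X dW\<close>, \<open>X\<^sub>0 = x\<close>, adapted to the augmented
  filtration of \<open>W\<close>. A solution is required to be nonnegative, which is what makes the drift term
  \<open>X\<^sup>\<alpha>\<close> meaningful; for nonnegative arguments \<^const>\<open>powr\<close> is the real power, with \<open>0\<^sup>\<alpha> = 0\<close>.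
  The initial condition is the integral equation at \<open>t = 0\<close>.\<close>

definition strong_solution ::
  "(real \<Rightarrow> real) measure \<Rightarrow> real \<Rightarrow> real \<Rightarrow> real \<Rightarrow> (real \<Rightarrow> (real \<Rightarrow> real) \<Rightarrow> real) \<Rightarrow> real \<Rightarrow>
    (real \<Rightarrow> (real \<Rightarrow> real) \<Rightarrow> real) \<Rightarrow> bool" where
  "strong_solution P \<alpha> \<sigma> \<mu> c x X \<longleftrightarrow>
     adapted (augmented_filtration P) X \<and>
     continuous_process (completion P) X \<and>
     (AE \<omega> in completion P. \<forall>t\<ge>0. 0 \<le> X t \<omega>) \<and>
     (\<exists>I. is_ito_integral (completion P) (augmented_filtration P) W (\<lambda>t \<omega>. \<sigma> * X t \<omega>) I \<and>
       (AE \<omega> in completion P. \<forall>t\<ge>0.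
          set_integrable lborel {0..t} (\<lambda>s. X s \<omega> powr \<alpha> - \<mu> * X s \<omega> - c s \<omega> * X s \<omega>) \<and>
          X t \<omega> = x + (LINT s:{0..t}|lborel. X s \<omega> powr \<alpha> - \<mu> * X s \<omega> - c s \<omega> * X s \<omega>) - I t \<omega>))"

end

theory Submission
  imports Defs
begin

text \<open>With \<open>E\<^sub>t = exp (\<sigma> W\<^sub>t + \<sigma>\<^sup>2 t / 2)\<close> the product \<open>X E\<close> has no martingale part: it satisfies, path by path, the
  linear equation \<open>d(X E) = E (X\<^sup>\<alpha> - \<mu> X - c X) dt\<close>. This instance of the Ito product rule is obtained by hand. The
  increments of \<open>X E\<close> along partitions refining those of the simple integrands are written as sums of
  \<open>F(s)\<close>-measurable coefficients times functions of the Gaussian increments \<open>W\<^sub>t - W\<^sub>s\<close>, and a Lenglart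
  inequality shows that the centred parts vanish in probability.

  Multiplying by \<open>G\<^sub>t = exp (\<integral>\<^sub>0\<^sup>t (\<mu> + c\<^sub>s) ds)\<close> leaves a Bernoulli equation for \<open>X E G\<close>, whence
  \<open>X\<^sub>t E\<^sub>t G\<^sub>t = (x\<^bsup>1-\<alpha>\<^esup> + (1 - \<alpha>) \<integral>\<^sub>0\<^sup>t (E\<^sub>s G\<^sub>s)\<^bsup>1-\<alpha>\<^esup> ds)\<^bsup>\<eta>\<^esup>\<close>. Since \<open>G\<close> is nondecreasing and at least \<open>1\<close>, the power mean inequality gives
  \<open>X\<^sub>t \<le> 2\<^bsup>\<eta>-1\<^esup> (x / E\<^sub>t + t\<^bsup>\<eta>-1\<^esup> \<integral>\<^sub>0\<^sup>t E\<^sub>s / E\<^sub>t ds)\<close>, and the moments follow from \<open>\<E>[E\<^sub>s / E\<^sub>t] = 1\<close> and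
  \<open>\<E>[(E\<^sub>s / E\<^sub>t)\<^sup>2] = exp (\<sigma>\<^sup>2 (t - s))\<close>. The difference of two solutions is controlled in the same way after
  splitting \<open>(u + A)\<^bsup>\<eta>\<^esup> - (v + A)\<^bsup>\<eta>\<^esup>\<close> by a weighted Young inequality.\<close>

section \<open>The augmented filtration\<close>

text \<open>The integral is given only as a limit of simple integrals, so the cancellation that
  makes \<open>E\<close> work has to be visible in a single Gaussian step. \<open>1 / E\<close> is
  the exponential martingale of \<open>-\<sigma> W\<close>; its correction term is the one for which
  \<open>rho - 1 - \<sigma> * rho * z\<close> has mean of order h^2, not h, over a step of length h,
  so that the accumulated means vanish with the mesh. The coefficients of the increments have no
  moments a priori; hence the work in probability and the stopping at a variance level. As
  \<open>c\<close> is merely integrable in time, \<open>G\<close> is only absolutely continuous: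
  products with it are compared through increments until the integrand has become continuous, and
  only then is calculus applied. The explicit formula sees \<open>c\<close> through \<open>G\<close>
  alone, so monotonicity of \<open>G\<close> and \<open>G \<ge> 1\<close> make every constant
  independent of the control. Two solutions share the integral term of the formula and differ only
  in the power of the initial value. Of the constants, \<open>2 powr (2 * \<eta> - 1)\<close> is
  twice the square of \<open>2 powr (\<eta> - 1)\<close>, and \<open>1 / \<sigma>\<^sup>2\<close>
  comes from integrating \<open>exp (\<sigma>\<^sup>2 * (t - s))\<close> over s.\<close>

locale wiener =
  fixes P :: "(real \<Rightarrow> real) measure"
  assumes wiener: "wiener_measure P"
begin

abbreviation M :: "(real \<Rightarrow> real) measure" where "M \<equiv> completion P"
abbreviation F :: "real \<Rightarrow> (real \<Rightarrow> real) measure" where "F \<equiv> augmented_filtration P"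

sublocale P: prob_space P
  using wiener by (simp add: wiener_measure_def)

sublocale M: prob_space M
  by (rule prob_spaceI) (simp add: P.emeasure_space_1)

lemma space_P: "space P = wiener_paths"
  using wiener by (auto simp: wiener_measure_def path_space_def space_restrict_space space_PiM
      wiener_paths_def PiE_def extensional_def)

lemma path_continuous: "\<omega> \<in> space P \<Longrightarrow> continuous_on {0..} (\<lambda>t. W t \<omega>)"
  by (simp add: space_P wiener_paths_def W_def)

lemma path_zero: "\<omega> \<in> space P \<Longrightarrow> W 0 \<omega> = 0"
  by (simp add: space_P wiener_paths_def W_def)

lemma W_measurable_P: "0 \<le> t \<Longrightarrow> W t \<in> borel_measurable P"
proof -
  assume "0 \<le> t"
  then have "W t \<in> borel_measurable (\<Pi>\<^sub>M t\<in>{0..}. borel)"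
    unfolding W_def using \<open>0 \<le> t\<close> by (intro measurable_component_singleton) simp
  then have "W t \<in> borel_measurable path_space"
    unfolding path_space_def by (rule measurable_restrict_space1)
  then show ?thesis
    using wiener measurable_cong_sets[of P path_space borel borel]
    unfolding wiener_measure_def by blast
qed

lemma W_measurable[measurable]: "0 \<le> t \<Longrightarrow> W t \<in> borel_measurable M"
  by (intro measurable_completion W_measurable_P)

abbreviation gen :: "real \<Rightarrow> (real \<Rightarrow> real) set set" where
  "gen t \<equiv> {W s -` B \<inter> space P | s B. 0 \<le> s \<and> s \<le> t \<and> B \<in> sets borel} \<union> null_sets M"

lemma gen_subset: "gen t \<subseteq> sets M"
  using measurable_sets[OF W_measurable] by auto

lemma gen_subset_Pow: "gen t \<subseteq> Pow (space P)"
proof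
  fix A assume "A \<in> gen t"
  then have "A \<in> sets M" using gen_subset by blast
  from sets.sets_into_space[OF this] show "A \<in> Pow (space P)" by simp
qed

lemma space_F [simp]: "space (F t) = space P"
  by (simp add: augmented_filtration_def space_measure_of[OF gen_subset_Pow])

lemma sets_F: "sets (F t) = sigma_sets (space P) (gen t)"
  by (simp add: augmented_filtration_def sets_measure_of[OF gen_subset_Pow])

lemma sets_F_subset: "sets (F t) \<subseteq> sets M"
  unfolding sets_F using sets.sigma_sets_subset[OF gen_subset, of t] by simp

lemma sets_F_mono: "s \<le> t \<Longrightarrow> sets (F s) \<subseteq> sets (F t)"
proof -
  assume st: "s \<le> t"
  have "gen s \<subseteq> gen t"
  proof
    fix A assume "A \<in> gen s"
    then consider "A \<in> null_sets M" | r B where "A = W r -` B \<inter> space P" "0 \<le> r" "r \<le> s" "B \<in> sets borel"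
      by blast
    then show "A \<in> gen t"
    proof cases
      case 2
      then have "r \<le> t" using st by simp
      with 2 show ?thesis by blast
    qed simp
  qed
  then show ?thesis
    unfolding sets_F by (rule sigma_sets_mono')
qed

lemma F_measurable_mono: "f \<in> borel_measurable (F s) \<Longrightarrow> s \<le> t \<Longrightarrow> f \<in> borel_measurable (F t)"
  using sets_F_mono[of s t] by (auto simp: measurable_def)

lemma F_measurable_M: "f \<in> borel_measurable (F s) \<Longrightarrow> f \<in> borel_measurable M"
  using sets_F_subset[of s] by (auto simp: measurable_def)

lemma W_measurable_F:
  assumes "0 \<le> s" "s \<le> t"
  shows "W s \<in> borel_measurable (F t)"
proof (rule measurableI)
  fix B :: "real set" assume "B \<in> sets borel"
  then show "W s -` B \<inter> space (F t) \<in> sets (F t)"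
    unfolding sets_F space_F using assms by (intro sigma_sets.Basic) blast
qed simp

text \<open>Finite-dimensional cylinders together with the null sets form a \<open>\<pi>\<close>-system generating
  the augmented filtration.\<close>

definition cylinders :: "real \<Rightarrow> (real \<Rightarrow> real) set set" where
  "cylinders t = {{\<omega> \<in> space P. \<forall>r\<in>J. W r \<omega> \<in> B r} | J B.
     finite J \<and> J \<subseteq> {0..t} \<and> (\<forall>r. B r \<in> sets borel)}"

section \<open>Independence of future increments from the augmented past\<close>

lemma cylinders_Int:
  assumes "A \<in> cylinders t" "A' \<in> cylinders t"
  shows "A \<inter> A' \<in> cylinders t"
proof -
  obtain J B where A: "A = {\<omega> \<in> space P. \<forall>r\<in>J. W r \<omega> \<in> B r}" "finite J" "J \<subseteq> {0..t}" "\<And>r. B r \<in> sets borel"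
    using assms unfolding cylinders_def by blast
  obtain J' B' where A': "A' = {\<omega> \<in> space P. \<forall>r\<in>J'. W r \<omega> \<in> B' r}" "finite J'" "J' \<subseteq> {0..t}" "\<And>r. B' r \<in> sets borel"
    using assms unfolding cylinders_def by blast
  let ?B = "\<lambda>r. (if r \<in> J then B r else UNIV) \<inter> (if r \<in> J' then B' r else UNIV)"
  have "A \<inter> A' = {\<omega> \<in> space P. \<forall>r\<in>J \<union> J'. W r \<omega> \<in> ?B r}"
    unfolding A A' by auto
  then show ?thesis
    unfolding cylinders_def using A(2-) A'(2-)
    by (intro CollectI exI[of _ "J \<union> J'"] exI[of _ ?B]) auto
qed

text \<open>\<open>wiener_measure\<close> speaks of increments along finite increasing time
  sequences. Sorting the times of the cylinder and appending t turns the cylinder into an event of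
  the first m increments, and the step from s to t becomes the last increment; grouping independent
  variables then separates the two.\<close>

lemma cylinder_indep:
  assumes "C \<in> cylinders s" "0 \<le> s" "s < t" "D \<in> sets borel"
  shows "measure P (C \<inter> ((\<lambda>\<omega>. W t \<omega> - W s \<omega>) -` D \<inter> space P)) =
    measure P C * measure P ((\<lambda>\<omega>. W t \<omega> - W s \<omega>) -` D \<inter> space P)"
proof -
  obtain J B where C: "C = {\<omega> \<in> space P. \<forall>r\<in>J. W r \<omega> \<in> B r}" "finite J" "J \<subseteq> {0..s}" "\<And>r. B r \<in> sets borel"
    using assms unfolding cylinders_def by blast
  \<comment> \<open>0 is included so that partial sums of increments are values of the path, and s
    so that the last step runs exactly from s to t.\<close>
  define l where "l = sorted_list_of_set (J \<union> {0, s})"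
  have l: "sorted l" "distinct l" "set l = J \<union> {0, s}"
    using C(2) by (simp_all add: l_def del: sorted_list_of_set_insert_remove)
  define m where "m = length l - 1"
  have len: "length l = Suc m"
    using l(3) by (cases l) (auto simp: m_def)
  define \<tau> where "\<tau> i = (if i \<le> m then l ! i else t)" for i
  have nth: "\<exists>i\<le>m. \<tau> i = r" if "r \<in> J \<union> {0,s}" for r
  proof -
    have "r \<in> set l" using that l(3) by simp
    then obtain i where "i < length l" "l ! i = r" by (auto simp: in_set_conv_nth)
    then show ?thesis using len by (intro exI[of _ i]) (auto simp: \<tau>_def)
  qed
  have rng: "0 \<le> l ! i" "l ! i \<le> s" if "i \<le> m" for i
  proof -
    have "l ! i \<in> J \<union> {0, s}" using that l(3) len nth_mem[of i l] by auto
    then show "0 \<le> l ! i" "l ! i \<le> s" using C(3) assms by auto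
  qed
  have \<tau>0: "\<tau> 0 = 0"
  proof -
    obtain i where i: "i \<le> m" "\<tau> i = 0" using nth[of 0] by auto
    then have "l ! 0 \<le> l ! i" using l(1) len by (intro sorted_nth_mono) auto
    then show ?thesis using i rng[of 0] by (auto simp: \<tau>_def)
  qed
  have \<tau>m: "\<tau> m = s"
  proof -
    obtain i where i: "i \<le> m" "\<tau> i = s" using nth[of s] by auto
    then have "l ! i \<le> l ! m" using l(1) len by (intro sorted_nth_mono) auto
    then show ?thesis using i rng[of m] by (auto simp: \<tau>_def)
  qed
  have mono: "\<tau> i \<le> \<tau> (Suc i)" if "i < Suc m" for i
  proof (cases "Suc i \<le> m")
    case True then show ?thesis using l(1) len by (auto simp: \<tau>_def intro!: sorted_nth_mono)
  next
    case False then show ?thesis using rng[of i] that assms by (auto simp: \<tau>_def)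
  qed
  let ?X = "\<lambda>i \<omega>. W (\<tau> (Suc i)) \<omega> - W (\<tau> i) \<omega>"
  have ind: "P.indep_vars (\<lambda>_. borel) ?X {..<Suc m}"
  proof -
    have "0 \<le> \<tau> 0 \<and> (\<forall>i<Suc m. \<tau> i \<le> \<tau> (Suc i))" using \<tau>0 mono by simp
    then show ?thesis using wiener unfolding wiener_measure_def by blast
  qed
  have ind2: "P.indep_var (PiM {..<m} (\<lambda>_. borel)) (\<lambda>\<omega>. restrict (\<lambda>i. ?X i \<omega>) {..<m})
     (PiM {m} (\<lambda>_. borel)) (\<lambda>\<omega>. restrict (\<lambda>i. ?X i \<omega>) {m})"
    by (rule P.indep_var_restrict[OF ind]) auto
  \<comment> \<open>The cylinder expressed through increments: the sum of the first i of them is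
    \<open>W (\<tau> i)\<close>.\<close>
  define S where "S = {x \<in> space (PiM {..<m} (\<lambda>_. borel :: real measure)).
      \<forall>i\<le>m. \<tau> i \<in> J \<longrightarrow> (\<Sum>k<i. x k) \<in> B (\<tau> i)}"
  have S: "S \<in> sets (PiM {..<m} (\<lambda>_. borel :: real measure))"
  proof -
    have "{x \<in> space (PiM {..<m} (\<lambda>_. borel :: real measure)). \<tau> i \<in> J \<longrightarrow> (\<Sum>k<i. x k) \<in> B (\<tau> i)}
        \<in> sets (PiM {..<m} (\<lambda>_. borel :: real measure))" if "i \<le> m" for i
    proof (cases "\<tau> i \<in> J")
      case True
      have "(\<lambda>x. \<Sum>k<i. x k) \<in> borel_measurable (PiM {..<m} (\<lambda>_. borel :: real measure))"
        using that by (intro borel_measurable_sum measurable_component_singleton) auto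
      from measurable_sets[OF this C(4)[of "\<tau> i"]] show ?thesis
        using True by (simp add: vimage_def Int_def conj_commute)
    qed auto
    then have "(\<Inter>i\<in>{..m}. {x \<in> space (PiM {..<m} (\<lambda>_. borel :: real measure)). \<tau> i \<in> J \<longrightarrow> (\<Sum>k<i. x k) \<in> B (\<tau> i)})
       \<in> sets (PiM {..<m} (\<lambda>_. borel :: real measure))"
      by (intro sets.finite_INT) auto
    also have "(\<Inter>i\<in>{..m}. {x \<in> space (PiM {..<m} (\<lambda>_. borel :: real measure)). \<tau> i \<in> J \<longrightarrow> (\<Sum>k<i. x k) \<in> B (\<tau> i)}) = S"
      unfolding S_def by auto
    finally show ?thesis .
  qed
  define D' where "D' = {x \<in> space (PiM {m} (\<lambda>_. borel :: real measure)). x m \<in> D}"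
  have D': "D' \<in> sets (PiM {m} (\<lambda>_. borel :: real measure))"
    using assms(4) unfolding D'_def by measurable
  have tele: "(\<Sum>k<i. ?X k \<omega>) = W (\<tau> i) \<omega>" if "\<omega> \<in> space P" for i \<omega>
    using sum_lessThan_telescope[of "\<lambda>k. W (\<tau> k) \<omega>" i] path_zero[OF that] \<tau>0 by simp
  have "restrict (\<lambda>i. ?X i \<omega>) {..<m} \<in> S \<longleftrightarrow> (\<forall>r\<in>J. W r \<omega> \<in> B r)" if "\<omega> \<in> space P" for \<omega>
  proof -
    have "(\<Sum>k<i. restrict (\<lambda>i. ?X i \<omega>) {..<m} k) = W (\<tau> i) \<omega>" if "i \<le> m" for i
    proof -
      have "(\<Sum>k<i. restrict (\<lambda>i. ?X i \<omega>) {..<m} k) = (\<Sum>k<i. ?X k \<omega>)"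
        using that by (intro sum.cong) auto
      then show ?thesis using tele \<open>\<omega> \<in> space P\<close> by simp
    qed
    then have "restrict (\<lambda>i. ?X i \<omega>) {..<m} \<in> S \<longleftrightarrow> (\<forall>i\<le>m. \<tau> i \<in> J \<longrightarrow> W (\<tau> i) \<omega> \<in> B (\<tau> i))"
      unfolding S_def by (simp add: space_PiM)
    also have "\<dots> \<longleftrightarrow> (\<forall>r\<in>J. W r \<omega> \<in> B r)"
      using nth by (metis UnCI)
    finally show ?thesis .
  qed
  then have e1: "(\<lambda>\<omega>. restrict (\<lambda>i. ?X i \<omega>) {..<m}) -` S \<inter> space P = C"
    unfolding C by auto
  have "restrict (\<lambda>i. ?X i \<omega>) {m} \<in> D' \<longleftrightarrow> W t \<omega> - W s \<omega> \<in> D" for \<omega>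
    unfolding D'_def space_PiM using \<tau>m by (auto simp: \<tau>_def)
  then have e2: "(\<lambda>\<omega>. restrict (\<lambda>i. ?X i \<omega>) {m}) -` D' \<inter> space P = (\<lambda>\<omega>. W t \<omega> - W s \<omega>) -` D \<inter> space P"
    by auto
  have e3: "(\<lambda>\<omega>. (restrict (\<lambda>i. ?X i \<omega>) {..<m}, restrict (\<lambda>i. ?X i \<omega>) {m})) -` (S \<times> D') \<inter> space P
     = C \<inter> ((\<lambda>\<omega>. W t \<omega> - W s \<omega>) -` D \<inter> space P)"
    using e1 e2 by blast
  show ?thesis
    using P.indep_varD[OF ind2 S D'] unfolding e1 e2 e3 .
qed

lemma cylinders_events: "cylinders t \<subseteq> sets P"
proof
  fix A assume "A \<in> cylinders t"
  then obtain J B where A: "A = {\<omega> \<in> space P. \<forall>r\<in>J. W r \<omega> \<in> B r}" "finite J" "J \<subseteq> {0..t}" "\<And>r. B r \<in> sets borel"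
    unfolding cylinders_def by blast
  have ev: "W r -` B r \<inter> space P \<in> sets P" if "r \<in> J" for r
    using measurable_sets[OF W_measurable_P A(4)] that A(3) by auto
  have "space P \<inter> (\<Inter>r\<in>J. W r -` B r \<inter> space P) \<in> sets P"
  proof (cases "J = {}")
    case False
    then have "(\<Inter>r\<in>J. W r -` B r \<inter> space P) \<in> sets P"
      using ev A(2) by (intro sets.finite_INT)
    then show ?thesis by (rule sets.Int[OF sets.top])
  qed simp
  also have "space P \<inter> (\<Inter>r\<in>J. W r -` B r \<inter> space P) = A"
    unfolding A by auto
  finally show "A \<in> sets P" .
qed

text \<open>The cylinders together with the null sets are closed under intersection and independent
  of the increment, so independence passes to the sigma-algebra they generate, which contains
  \<open>F s\<close>. For a null set both sides of the product formula vanish.\<close>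

lemma indep_increment:
  assumes "0 \<le> s" "s < t" and u: "u \<in> borel_measurable (F s)"
  shows "M.indep_var borel u borel (\<lambda>\<omega>. W t \<omega> - W s \<omega>)"
proof -
  let ?D = "\<lambda>\<omega>. W t \<omega> - W s \<omega>"
  let ?G = "{?D -` B \<inter> space M | B. B \<in> sets borel}"
  let ?A = "cylinders s \<union> null_sets M"
  have DP: "?D \<in> borel_measurable P"
    using assms by (auto intro!: borel_measurable_diff W_measurable_P)
  have A_ev: "?A \<subseteq> M.events"
    using cylinders_events[of s] by auto
  have G_ev: "?G \<subseteq> M.events"
    using measurable_sets[OF DP] by auto
  have "M.indep_set ?A ?G"
  proof (rule M.indep_setI[OF A_ev G_ev])
    fix a b assume a: "a \<in> ?A" and "b \<in> ?G"
    then obtain B where b: "b = ?D -` B \<inter> space P" "B \<in> sets borel" by auto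
    have bP: "b \<in> sets P" using measurable_sets[OF DP b(2)] b(1) by simp
    show "M.prob (a \<inter> b) = M.prob a * M.prob b"
    proof (cases "a \<in> null_sets M")
      case True
      then have "a \<inter> b \<in> null_sets M"
        using bP by (intro null_set_Int2) auto
      then show ?thesis using True by (simp add: measure_eq_0_null_sets)
    next
      case False
      then have "a \<in> cylinders s" using a by auto
      then show ?thesis
        using cylinder_indep[OF _ assms(1,2) b(2)] cylinders_events[of s] bP
        unfolding b(1)[symmetric] by (auto simp: sets.Int)
    qed
  qed
  moreover have "Int_stable ?A"
  proof (rule Int_stableI)
    fix a b assume ab: "a \<in> ?A" "b \<in> ?A"
    show "a \<inter> b \<in> ?A"
    proof (cases "a \<in> null_sets M \<or> b \<in> null_sets M")
      case True
      moreover have "a \<in> sets M" "b \<in> sets M" using ab A_ev by auto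
      ultimately have "a \<inter> b \<in> null_sets M" by (metis null_set_Int1 null_set_Int2)
      then show ?thesis by blast
    next
      case False
      then show ?thesis using ab cylinders_Int[of a s b] by blast
    qed
  qed
  moreover have "Int_stable ?G"
  proof (rule Int_stableI)
    fix a b assume "a \<in> ?G" "b \<in> ?G"
    then obtain B C where "a = ?D -` B \<inter> space M" "b = ?D -` C \<inter> space M" "B \<in> sets borel" "C \<in> sets borel"
      by blast
    then have "a \<inter> b = ?D -` (B \<inter> C) \<inter> space M" "B \<inter> C \<in> sets borel" by auto
    then show "a \<inter> b \<in> ?G" by blast
  qed
  ultimately have ind: "M.indep_set (sigma_sets (space M) ?A) (sigma_sets (space M) ?G)"
    by (rule M.indep_set_sigma_sets)
  have "gen s \<subseteq> ?A"
  proof -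
    have "W r -` B \<inter> space P \<in> cylinders s" if "0 \<le> r" "r \<le> s" "B \<in> sets borel" for r B
      unfolding cylinders_def using that by (intro CollectI exI[of _ "{r}"] exI[of _ "\<lambda>_. B"]) auto
    then show ?thesis by auto
  qed
  then have sub: "sets (F s) \<subseteq> sigma_sets (space M) ?A"
    unfolding sets_F space_completion by (rule sigma_sets_mono')
  have sub2: "sigma_sets (space M) {u -` B \<inter> space M | B. B \<in> sets borel} \<subseteq> sigma_sets (space M) ?A"
  proof (rule sigma_sets_mono, safe)
    fix B :: "real set" assume "B \<in> sets borel"
    then have "u -` B \<inter> space (F s) \<in> sets (F s)" by (rule measurable_sets[OF u])
    then show "u -` B \<inter> space M \<in> sigma_sets (space M) ?A"
      using sub by auto
  qed
  have "M.indep_set (sigma_sets (space M) {u -` B \<inter> space M | B. B \<in> sets borel}) (sigma_sets (space M) ?G)"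
    using ind sub2 unfolding M.indep_sets2_eq by blast
  then show ?thesis
    unfolding M.indep_var_eq using F_measurable_M[OF u] measurable_completion[OF DP] by auto
qed

end

section \<open>Gaussian increments and a discrete Lenglart inequality\<close>

text \<open>Completing the square: weighting a centred normal density by \<open>exp (a * z)\<close>
  moves its mean to \<open>a * d\<^sup>2\<close> and multiplies the mass by a constant.\<close>

lemma exp_mult_normal_density:
  assumes "0 < d"
  shows "normal_density 0 d z * exp (a * z) = exp (a\<^sup>2 * d\<^sup>2 / 2) * normal_density (a * d\<^sup>2) d z"
proof -
  have "- z\<^sup>2 / (2 * d\<^sup>2) + a * z = a\<^sup>2 * d\<^sup>2 / 2 + - (z - a * d\<^sup>2)\<^sup>2 / (2 * d\<^sup>2)"
    using assms by (simp add: field_simps power2_eq_square)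
  then have "exp (- z\<^sup>2 / (2 * d\<^sup>2)) * exp (a * z) = exp (a\<^sup>2 * d\<^sup>2 / 2) * exp (- (z - a * d\<^sup>2)\<^sup>2 / (2 * d\<^sup>2))"
    unfolding exp_add[symmetric] by simp
  then show ?thesis
    by (simp add: normal_density_def)
qed

lemma normal_moments:
  assumes "0 < d"
  shows "has_bochner_integral lborel (\<lambda>z. normal_density m d z) 1"
    and "has_bochner_integral lborel (\<lambda>z. normal_density m d z * z) m"
    and "has_bochner_integral lborel (\<lambda>z. normal_density m d z * z\<^sup>2) (d\<^sup>2 + m\<^sup>2)"
proof -
  show 0: "has_bochner_integral lborel (\<lambda>z. normal_density m d z) 1"
    using normal_moment_even[OF assms, of m 0] by simp
  show 1: "has_bochner_integral lborel (\<lambda>z. normal_density m d z * z) m"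
    by (rule normal_moment_nz_1[OF assms])
  have 2: "has_bochner_integral lborel (\<lambda>z. normal_density m d z * (z - m)\<^sup>2) (d\<^sup>2)"
    using normal_moment_even[OF assms, of m 1] by simp
  \<comment> \<open>The second moment is read off from
    \<open>z\<^sup>2 = (z - m)\<^sup>2 + 2 * m * z - m\<^sup>2\<close>.\<close>
  have "has_bochner_integral lborel
     (\<lambda>z. normal_density m d z * (z - m)\<^sup>2 + (2 * m) * (normal_density m d z * z) - m\<^sup>2 * normal_density m d z)
     (d\<^sup>2 + (2 * m) * m - m\<^sup>2 * 1)"
    by (intro has_bochner_integral_add has_bochner_integral_diff has_bochner_integral_mult_right 0 1 2)
  also have "(\<lambda>z. normal_density m d z * (z - m)\<^sup>2 + (2 * m) * (normal_density m d z * z) - m\<^sup>2 * normal_density m d z)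
      = (\<lambda>z. normal_density m d z * z\<^sup>2)"
    by (intro ext) (simp add: power2_eq_square algebra_simps)
  also have "d\<^sup>2 + (2 * m) * m - m\<^sup>2 * 1 = d\<^sup>2 + m\<^sup>2"
    by (simp add: power2_eq_square)
  finally show "has_bochner_integral lborel (\<lambda>z. normal_density m d z * z\<^sup>2) (d\<^sup>2 + m\<^sup>2)" .
qed

text \<open>Together the bounds say that \<open>exp x * (1 - x)\<close> differs from 1 only to
  second order. With x = \<sigma>^2 h this expression is the mean of
  \<open>rho - \<sigma> * rho * z\<close> over one step of length h.\<close>

lemma exp_times_one_minus_le:
  fixes x :: real
  assumes "0 \<le> x"
  shows "exp x * (1 - x) \<le> 1" "1 - x\<^sup>2 * exp x \<le> exp x * (1 - x)"
proof -
  have *: "1 - x \<le> exp (- x)" using exp_ge_add_one_self[of "-x"] by simp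
  then have "exp x * (1 - x) \<le> exp x * exp (-x)" by (intro mult_left_mono) auto
  then show "exp x * (1 - x) \<le> 1" by (simp add: exp_minus)
  \<comment> \<open>Since \<open>(1 + x) * (1 - x + x\<^sup>2) = 1 + x^3\<close>, the quadratic
    factor dominates the reciprocal of \<open>exp x\<close>.\<close>
  have "exp (- x) \<le> 1 - x + x\<^sup>2"
  proof -
    have "exp x * (1 - x + x\<^sup>2) \<ge> (1 + x) * (1 - x + x\<^sup>2)"
      using exp_ge_add_one_self[of x] by (intro mult_right_mono) (auto simp: power2_eq_square, sos)
    moreover have "(1 + x) * (1 - x + x\<^sup>2) \<ge> 1"
      using assms by (simp add: power2_eq_square algebra_simps)
    ultimately show ?thesis by (simp add: exp_minus field_simps)
  qed
  then have "exp x * exp (- x) \<le> exp x * (1 - x + x\<^sup>2)" by (intro mult_left_mono) auto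
  then show "1 - x\<^sup>2 * exp x \<le> exp x * (1 - x)" by (simp add: exp_minus algebra_simps)
qed

lemma (in prob_space) abs_expectation_le_sqrt:
  fixes X :: "'a \<Rightarrow> real"
  assumes "X \<in> borel_measurable M" "integrable M (\<lambda>x. (X x)\<^sup>2)"
  shows "expectation (\<lambda>x. \<bar>X x\<bar>) \<le> sqrt (expectation (\<lambda>x. (X x)\<^sup>2))"
proof -
  have i: "integrable M (\<lambda>x. \<bar>X x\<bar>)"
    using square_integrable_imp_integrable[OF assms] by simp
  have "0 \<le> expectation (\<lambda>x. \<bar>X x\<bar>\<^sup>2) - (expectation (\<lambda>x. \<bar>X x\<bar>))\<^sup>2"
    using variance_eq[of "\<lambda>x. \<bar>X x\<bar>"] variance_positive[of "\<lambda>x. \<bar>X x\<bar>"] i assms(2) by simp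
  then show ?thesis
    by (intro real_le_rsqrt) simp
qed

context wiener
begin

abbreviation incr :: "real \<Rightarrow> real \<Rightarrow> (real \<Rightarrow> real) \<Rightarrow> real" where
  "incr s t \<omega> \<equiv> W t \<omega> - W s \<omega>"

lemma incr_distributed:
  assumes "0 \<le> s" "s < t"
  shows "distributed M lborel (incr s t) (normal_density 0 (sqrt (t - s)))"
proof -
  have "distributed P lborel (incr s t) (normal_density 0 (sqrt (t - s)))"
    using wiener assms unfolding wiener_measure_def by blast
  then show ?thesis
    unfolding distributed_def by (auto simp: distr_completion intro: measurable_completion)
qed

text \<open>By the change of density above, an exponential weight is traded for a shift of the mean.
  Exponential moments thereby reduce to polynomial moments of a shifted normal variable.\<close>

lemma incr_exp_moment:
  assumes "0 \<le> s" "s < t" and f: "f \<in> borel_measurable borel"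
    and h: "has_bochner_integral lborel (\<lambda>z. normal_density (a * (t - s)) (sqrt (t - s)) z * f z) r"
  shows "has_bochner_integral M (\<lambda>\<omega>. exp (a * incr s t \<omega>) * f (incr s t \<omega>)) (exp (a\<^sup>2 * (t - s) / 2) * r)"
proof -
  have d: "0 < sqrt (t - s)" "(sqrt (t - s))\<^sup>2 = t - s" using assms by auto
  have eq: "normal_density 0 (sqrt (t - s)) z * (exp (a * z) * f z) =
     exp (a\<^sup>2 * (t - s) / 2) * (normal_density (a * (t - s)) (sqrt (t - s)) z * f z)" for z
    using exp_mult_normal_density[OF d(1), of z a] unfolding d(2) by (simp add: mult_ac)
  have m: "(\<lambda>z. exp (a * z) * f z) \<in> borel_measurable lborel"
    using f by simp
  have hb: "has_bochner_integral lborel (\<lambda>z. normal_density 0 (sqrt (t - s)) z * (exp (a * z) * f z))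
      (exp (a\<^sup>2 * (t - s) / 2) * r)"
    unfolding eq by (intro has_bochner_integral_mult_right h)
  have "integrable M (\<lambda>\<omega>. exp (a * incr s t \<omega>) * f (incr s t \<omega>))"
    using distributed_integrable[OF incr_distributed[OF assms(1,2)] m] hb
    by (auto simp: has_bochner_integral_iff)
  moreover have "M.expectation (\<lambda>\<omega>. exp (a * incr s t \<omega>) * f (incr s t \<omega>)) = exp (a\<^sup>2 * (t - s) / 2) * r"
    using distributed_integral[OF incr_distributed[OF assms(1,2)] m] hb
    by (auto simp: has_bochner_integral_iff)
  ultimately show ?thesis by (simp add: has_bochner_integral_iff)
qed

lemma incr_exp_moments:
  assumes "0 \<le> s" "s < t"
  shows "has_bochner_integral M (\<lambda>\<omega>. exp (a * incr s t \<omega>)) (exp (a\<^sup>2 * (t - s) / 2))"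
    and "has_bochner_integral M (\<lambda>\<omega>. exp (a * incr s t \<omega>) * incr s t \<omega>) (exp (a\<^sup>2 * (t - s) / 2) * (a * (t - s)))"
    and "has_bochner_integral M (\<lambda>\<omega>. exp (a * incr s t \<omega>) * (incr s t \<omega>)\<^sup>2)
      (exp (a\<^sup>2 * (t - s) / 2) * ((t - s) + a\<^sup>2 * (t - s)\<^sup>2))"
proof -
  have d: "0 < sqrt (t - s)" "(sqrt (t - s))\<^sup>2 = t - s" using assms by auto
  note nm = normal_moments[OF d(1), of "a * (t - s)", unfolded d(2)]
  show "has_bochner_integral M (\<lambda>\<omega>. exp (a * incr s t \<omega>)) (exp (a\<^sup>2 * (t - s) / 2))"
    using incr_exp_moment[OF assms, of "\<lambda>_. 1" a 1] nm(1) by simp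
  show "has_bochner_integral M (\<lambda>\<omega>. exp (a * incr s t \<omega>) * incr s t \<omega>) (exp (a\<^sup>2 * (t - s) / 2) * (a * (t - s)))"
    by (rule incr_exp_moment[OF assms _ nm(2)]) simp
  show "has_bochner_integral M (\<lambda>\<omega>. exp (a * incr s t \<omega>) * (incr s t \<omega>)\<^sup>2)
      (exp (a\<^sup>2 * (t - s) / 2) * ((t - s) + a\<^sup>2 * (t - s)\<^sup>2))"
    using incr_exp_moment[OF assms _ nm(3)] by (simp add: power_mult_distrib)
qed

lemma centered_second_moment:
  fixes X :: "(real \<Rightarrow> real) \<Rightarrow> real"
  assumes "has_bochner_integral M X m" "has_bochner_integral M (\<lambda>\<omega>. (X \<omega>)\<^sup>2) r"
  shows "has_bochner_integral M (\<lambda>\<omega>. X \<omega> - m) 0"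
    and "has_bochner_integral M (\<lambda>\<omega>. (X \<omega> - m)\<^sup>2) (r - m\<^sup>2)"
proof -
  have c: "has_bochner_integral M (\<lambda>\<omega>. k) k" for k :: real
    using M.prob_space by (simp add: has_bochner_integral_iff P.prob_space)
  show "has_bochner_integral M (\<lambda>\<omega>. X \<omega> - m) 0"
    using has_bochner_integral_diff[OF assms(1) c[of m]] by simp
  have "has_bochner_integral M (\<lambda>\<omega>. (X \<omega>)\<^sup>2 - (2 * m) * X \<omega> + m\<^sup>2) (r - (2 * m) * m + m\<^sup>2)"
    by (intro has_bochner_integral_add has_bochner_integral_diff has_bochner_integral_mult_right assms c)
  then show "has_bochner_integral M (\<lambda>\<omega>. (X \<omega> - m)\<^sup>2) (r - m\<^sup>2)"
    by (simp add: power2_eq_square algebra_simps)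
qed

text \<open>The ratio of the values of \<open>E\<close> at the two ends of a step of length h over
  which the path moves by z.\<close>

definition rho :: "real \<Rightarrow> real \<Rightarrow> real \<Rightarrow> real" where
  "rho \<sigma> h z = exp (\<sigma> * z + \<sigma>\<^sup>2 * h / 2)"

text \<open>Large enough for all four bounds of \<open>rho_moments\<close>:
  \<open>6 * \<sigma>^4\<close> serves the first pair, \<open>\<sigma>\<close> and
  \<open>1 + 4 * \<sigma>\<^sup>2 * T\<close> the second, and the exponential dominates
  \<open>exp (3 * k)\<close> for \<open>k = \<sigma>\<^sup>2 * h\<close>.\<close>

definition mom_const :: "real \<Rightarrow> real \<Rightarrow> real" where
  "mom_const \<sigma> T = (6 * \<sigma>^4 + \<sigma> + 1 + 4 * \<sigma>\<^sup>2 * T) * exp (3 * \<sigma>\<^sup>2 * T)"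

text \<open>With \<open>k = \<sigma>\<^sup>2 * h\<close> the mean of \<open>rho\<close> is
  \<open>exp k\<close> and that of \<open>\<sigma> * rho * z\<close> is \<open>k * exp k\<close>, so
  in the first variable the terms linear in h cancel. Its mean and second moment are of order h^2,
  those of the second variable only of order h; sums of the latter over a partition have to be made
  small by their coefficients.\<close>

lemma rho_moments:
  assumes "0 < \<sigma>" "0 \<le> s" "s < t" "t - s \<le> T"
  shows "\<exists>m r. has_bochner_integral M (\<lambda>\<omega>. rho \<sigma> (t - s) (incr s t \<omega>) - 1 - \<sigma> * rho \<sigma> (t - s) (incr s t \<omega>) * incr s t \<omega>) m \<and>
     has_bochner_integral M (\<lambda>\<omega>. (rho \<sigma> (t - s) (incr s t \<omega>) - 1 - \<sigma> * rho \<sigma> (t - s) (incr s t \<omega>) * incr s t \<omega>)\<^sup>2) r \<and>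
     \<bar>m\<bar> \<le> mom_const \<sigma> T * (t - s)\<^sup>2 \<and> r \<le> mom_const \<sigma> T * (t - s)\<^sup>2" (is ?th1)
    and "\<exists>m r. has_bochner_integral M (\<lambda>\<omega>. rho \<sigma> (t - s) (incr s t \<omega>) * incr s t \<omega>) m \<and>
     has_bochner_integral M (\<lambda>\<omega>. (rho \<sigma> (t - s) (incr s t \<omega>) * incr s t \<omega>)\<^sup>2) r \<and>
     \<bar>m\<bar> \<le> mom_const \<sigma> T * (t - s) \<and> r \<le> mom_const \<sigma> T * (t - s)" (is ?th2)
proof -
  define h where "h = t - s"
  have h: "0 < h" "h \<le> T" using assms by (auto simp: h_def)
  define k where "k = \<sigma>\<^sup>2 * h"
  have k: "0 \<le> k" "k \<le> \<sigma>\<^sup>2 * T" using h by (auto simp: k_def intro: mult_left_mono)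
  have ek: "exp k \<le> exp (3 * \<sigma>\<^sup>2 * T)" "exp (3 * k) \<le> exp (3 * \<sigma>\<^sup>2 * T)" using k by auto
  note mom = incr_exp_moments[OF assms(2,3), folded h_def]
  have rho_eq: "rho \<sigma> h z = exp (k / 2) * exp (\<sigma> * z)" for z
    by (simp add: rho_def k_def exp_add mult_ac)
  have rho2: "(rho \<sigma> h z)\<^sup>2 = exp k * exp ((2 * \<sigma>) * z)" for z
    by (simp add: rho_eq power_mult_distrib exp_double[symmetric] mult_ac)
  have c1: "has_bochner_integral M (\<lambda>\<omega>. 1 :: real) 1"
    by (simp add: has_bochner_integral_iff P.prob_space)
  have e2: "exp (k / 2) * exp (k / 2) = exp k" by (simp add: exp_add[symmetric])
  have r1: "has_bochner_integral M (\<lambda>\<omega>. rho \<sigma> h (incr s t \<omega>)) (exp k)"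
    using has_bochner_integral_mult_right[OF mom(1)[of \<sigma>], of "exp (k / 2)"] unfolding rho_eq[symmetric]
    by (simp add: k_def[symmetric] e2)
  have r2: "has_bochner_integral M (\<lambda>\<omega>. rho \<sigma> h (incr s t \<omega>) * incr s t \<omega>) (exp k * (\<sigma> * h))"
    using has_bochner_integral_mult_right[OF mom(2)[of \<sigma>], of "exp (k / 2)"]
    by (simp add: rho_eq k_def[symmetric] e2 mult.assoc[symmetric])
  have e3: "exp k * exp ((2 * \<sigma>)\<^sup>2 * h / 2) = exp (3 * k)"
    by (simp add: exp_add[symmetric] k_def)
  have q0: "has_bochner_integral M (\<lambda>\<omega>. (rho \<sigma> h (incr s t \<omega>))\<^sup>2) (exp (3 * k))"
    using has_bochner_integral_mult_right[OF mom(1)[of "2 * \<sigma>"], of "exp k"]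
    unfolding rho2 e3 by simp
  have q1: "has_bochner_integral M (\<lambda>\<omega>. (rho \<sigma> h (incr s t \<omega>))\<^sup>2 * incr s t \<omega>) (exp (3 * k) * (2 * \<sigma> * h))"
    using has_bochner_integral_mult_right[OF mom(2)[of "2 * \<sigma>"], of "exp k"]
    unfolding rho2 mult.assoc[symmetric] e3 by (simp add: mult.assoc)
  have q2: "has_bochner_integral M (\<lambda>\<omega>. (rho \<sigma> h (incr s t \<omega>))\<^sup>2 * (incr s t \<omega>)\<^sup>2) (exp (3 * k) * (h + (2 * \<sigma>)\<^sup>2 * h\<^sup>2))"
    using has_bochner_integral_mult_right[OF mom(3)[of "2 * \<sigma>"], of "exp k"]
    unfolding rho2 mult.assoc[symmetric] e3 by (simp add: mult.assoc)
  have A: "has_bochner_integral M (\<lambda>\<omega>. rho \<sigma> h (incr s t \<omega>) - 1 - \<sigma> * (rho \<sigma> h (incr s t \<omega>) * incr s t \<omega>))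
      (exp k - 1 - \<sigma> * (exp k * (\<sigma> * h)))"
    by (intro has_bochner_integral_diff has_bochner_integral_mult_right r1 r2 c1)
  have "has_bochner_integral M (\<lambda>\<omega>. (rho \<sigma> h (incr s t \<omega>))\<^sup>2 - (2 * \<sigma>) * ((rho \<sigma> h (incr s t \<omega>))\<^sup>2 * incr s t \<omega>)
       + \<sigma>\<^sup>2 * ((rho \<sigma> h (incr s t \<omega>))\<^sup>2 * (incr s t \<omega>)\<^sup>2) - 2 * rho \<sigma> h (incr s t \<omega>)
       + (2 * \<sigma>) * (rho \<sigma> h (incr s t \<omega>) * incr s t \<omega>) + 1)
     (exp (3 * k) - (2 * \<sigma>) * (exp (3 * k) * (2 * \<sigma> * h)) + \<sigma>\<^sup>2 * (exp (3 * k) * (h + (2 * \<sigma>)\<^sup>2 * h\<^sup>2))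
       - 2 * exp k + (2 * \<sigma>) * (exp k * (\<sigma> * h)) + 1)"
    by (intro has_bochner_integral_diff has_bochner_integral_add has_bochner_integral_mult_right r1 r2 c1 q0 q1 q2)
  also have "(\<lambda>\<omega>. (rho \<sigma> h (incr s t \<omega>))\<^sup>2 - (2 * \<sigma>) * ((rho \<sigma> h (incr s t \<omega>))\<^sup>2 * incr s t \<omega>)
       + \<sigma>\<^sup>2 * ((rho \<sigma> h (incr s t \<omega>))\<^sup>2 * (incr s t \<omega>)\<^sup>2) - 2 * rho \<sigma> h (incr s t \<omega>)
       + (2 * \<sigma>) * (rho \<sigma> h (incr s t \<omega>) * incr s t \<omega>) + 1) =
     (\<lambda>\<omega>. (rho \<sigma> h (incr s t \<omega>) - 1 - \<sigma> * (rho \<sigma> h (incr s t \<omega>) * incr s t \<omega>))\<^sup>2)"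
  proof (intro ext)
    fix \<omega>
    have "r\<^sup>2 - (2 * \<sigma>) * (r\<^sup>2 * z) + \<sigma>\<^sup>2 * (r\<^sup>2 * z\<^sup>2) - 2 * r + (2 * \<sigma>) * (r * z) + 1 = (r - 1 - \<sigma> * (r * z))\<^sup>2" for r z :: real
      by algebra
    then show "(rho \<sigma> h (incr s t \<omega>))\<^sup>2 - (2 * \<sigma>) * ((rho \<sigma> h (incr s t \<omega>))\<^sup>2 * incr s t \<omega>)
       + \<sigma>\<^sup>2 * ((rho \<sigma> h (incr s t \<omega>))\<^sup>2 * (incr s t \<omega>)\<^sup>2) - 2 * rho \<sigma> h (incr s t \<omega>)
       + (2 * \<sigma>) * (rho \<sigma> h (incr s t \<omega>) * incr s t \<omega>) + 1 =
      (rho \<sigma> h (incr s t \<omega>) - 1 - \<sigma> * (rho \<sigma> h (incr s t \<omega>) * incr s t \<omega>))\<^sup>2" .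
  qed
  \<comment> \<open>Regrouped into \<open>exp y * (1 - y)\<close> with y = 3 k and y = k, the form
    that \<open>exp_times_one_minus_le\<close> bounds.\<close>
  also have "exp (3 * k) - (2 * \<sigma>) * (exp (3 * k) * (2 * \<sigma> * h)) + \<sigma>\<^sup>2 * (exp (3 * k) * (h + (2 * \<sigma>)\<^sup>2 * h\<^sup>2))
       - 2 * exp k + (2 * \<sigma>) * (exp k * (\<sigma> * h)) + 1 =
     exp (3 * k) * (1 - 3 * k) + 4 * k\<^sup>2 * exp (3 * k) - 2 * (exp k * (1 - k)) + 1"
    unfolding k_def by (simp add: power2_eq_square algebra_simps)
  finally have B: "has_bochner_integral M (\<lambda>\<omega>. (rho \<sigma> h (incr s t \<omega>) - 1 - \<sigma> * (rho \<sigma> h (incr s t \<omega>) * incr s t \<omega>))\<^sup>2)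
    (exp (3 * k) * (1 - 3 * k) + 4 * k\<^sup>2 * exp (3 * k) - 2 * (exp k * (1 - k)) + 1)" .
  have kk: "k\<^sup>2 = \<sigma>^4 * h\<^sup>2" by (simp add: k_def power_mult_distrib)
  have C0: "exp (3 * \<sigma>\<^sup>2 * T) * (6 * \<sigma>^4) \<le> mom_const \<sigma> T" "exp (3 * \<sigma>\<^sup>2 * T) * \<sigma> \<le> mom_const \<sigma> T"
    "exp (3 * \<sigma>\<^sup>2 * T) * (1 + 4 * \<sigma>\<^sup>2 * T) \<le> mom_const \<sigma> T"
    using assms(1) h unfolding mom_const_def by (auto simp: mult.commute intro!: mult_right_mono add_increasing)
  have C1: "6 * k\<^sup>2 * exp (3 * \<sigma>\<^sup>2 * T) \<le> mom_const \<sigma> T * h\<^sup>2"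
    using mult_right_mono[OF C0(1), of "h\<^sup>2"] unfolding kk by (simp add: mult_ac)
  have m1: "exp k - 1 - \<sigma> * (exp k * (\<sigma> * h)) = exp k * (1 - k) - 1"
    by (simp add: k_def power2_eq_square algebra_simps)
  have k2e: "k\<^sup>2 * exp k \<le> k\<^sup>2 * exp (3 * \<sigma>\<^sup>2 * T)" "k\<^sup>2 * exp (3 * k) \<le> k\<^sup>2 * exp (3 * \<sigma>\<^sup>2 * T)"
    using ek by (auto intro: mult_left_mono)
  have k2n: "0 \<le> k\<^sup>2 * exp (3 * \<sigma>\<^sup>2 * T)" by simp
  have b1: "\<bar>exp k - 1 - \<sigma> * (exp k * (\<sigma> * h))\<bar> \<le> mom_const \<sigma> T * h\<^sup>2"
    unfolding m1 using exp_times_one_minus_le[OF k(1)] k2e k2n C1 by linarith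
  have b2: "exp (3 * k) * (1 - 3 * k) + 4 * k\<^sup>2 * exp (3 * k) - 2 * (exp k * (1 - k)) + 1 \<le> mom_const \<sigma> T * h\<^sup>2"
    using exp_times_one_minus_le(1)[of "3 * k"] exp_times_one_minus_le(2)[of k] k k2e k2n C1 by linarith
  show ?th1
    unfolding h_def[symmetric] mult.assoc
    by (intro exI conjI, rule A, rule B, rule b1, rule b2)
  have D: "has_bochner_integral M (\<lambda>\<omega>. (rho \<sigma> h (incr s t \<omega>) * incr s t \<omega>)\<^sup>2) (exp (3 * k) * (h + (2 * \<sigma>)\<^sup>2 * h\<^sup>2))"
    using q2 by (simp add: power_mult_distrib)
  have d1: "\<bar>exp k * (\<sigma> * h)\<bar> \<le> mom_const \<sigma> T * h"
  proof -
    have "exp k * (\<sigma> * h) \<le> exp (3 * \<sigma>\<^sup>2 * T) * (\<sigma> * h)" using ek assms(1) h by (intro mult_right_mono) auto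
    also have "\<dots> \<le> mom_const \<sigma> T * h" using mult_right_mono[OF C0(2), of h] h by (simp add: mult_ac)
    finally show ?thesis using assms(1) h by simp
  qed
  have d2: "exp (3 * k) * (h + (2 * \<sigma>)\<^sup>2 * h\<^sup>2) \<le> mom_const \<sigma> T * h"
  proof -
    have "\<sigma>\<^sup>2 * h * h \<le> \<sigma>\<^sup>2 * T * h" using k(2) h by (intro mult_right_mono) (auto simp: k_def)
    then have "h + (2 * \<sigma>)\<^sup>2 * h\<^sup>2 \<le> (1 + 4 * \<sigma>\<^sup>2 * T) * h"
      by (simp add: power2_eq_square algebra_simps)
    then have "exp (3 * k) * (h + (2 * \<sigma>)\<^sup>2 * h\<^sup>2) \<le> exp (3 * \<sigma>\<^sup>2 * T) * ((1 + 4 * \<sigma>\<^sup>2 * T) * h)"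
      using ek h by (intro mult_mono) auto
    also have "\<dots> \<le> mom_const \<sigma> T * h" using mult_right_mono[OF C0(3), of h] h by (simp add: mult_ac)
    finally show ?thesis .
  qed
  show ?th2
    unfolding h_def[symmetric] by (intro exI conjI, rule r2, rule D, rule d1, rule d2)
qed

section \<open>Martingale transforms of Gaussian increments\<close>

lemma indep_expectation_mult:
  fixes u :: "(real \<Rightarrow> real) \<Rightarrow> real" and g :: "real \<Rightarrow> real"
  assumes "0 \<le> s" "s < t" "u \<in> borel_measurable (F s)" "integrable M u"
    and "g \<in> borel_measurable borel" "integrable M (\<lambda>\<omega>. g (incr s t \<omega>))"
  shows "integrable M (\<lambda>\<omega>. u \<omega> * g (incr s t \<omega>))"
    and "M.expectation (\<lambda>\<omega>. u \<omega> * g (incr s t \<omega>)) = M.expectation u * M.expectation (\<lambda>\<omega>. g (incr s t \<omega>))"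
proof -
  have ind: "M.indep_var borel u borel (\<lambda>\<omega>. g (incr s t \<omega>))"
    using M.indep_var_compose[OF indep_increment[OF assms(1-3)], of "\<lambda>x. x" borel g borel] assms(5)
    by (simp add: comp_def)
  show "integrable M (\<lambda>\<omega>. u \<omega> * g (incr s t \<omega>))"
    by (rule M.indep_var_integrable[OF ind assms(4,6)])
  show "M.expectation (\<lambda>\<omega>. u \<omega> * g (incr s t \<omega>)) = M.expectation u * M.expectation (\<lambda>\<omega>. g (incr s t \<omega>))"
    by (rule M.indep_var_lebesgue_integral[OF ind assms(4,6)])
qed

text \<open>The coefficients are stopped before the accumulated variance
  exceeds \<open>\<delta>\<close>; the stopped sum is a square-integrable martingale transform with variance at most \<open>\<delta>\<close>.\<close>

lemma discrete_lenglart: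
  fixes s v :: "nat \<Rightarrow> real" and u :: "nat \<Rightarrow> (real \<Rightarrow> real) \<Rightarrow> real" and g :: "nat \<Rightarrow> real \<Rightarrow> real"
  assumes s0: "0 \<le> s 0" and sS: "\<And>j. j < n \<Longrightarrow> s j < s (Suc j)"
    and u: "\<And>j. j < n \<Longrightarrow> u j \<in> borel_measurable (F (s j))"
    and g: "\<And>j. j < n \<Longrightarrow> g j \<in> borel_measurable borel"
    and g1: "\<And>j. j < n \<Longrightarrow> integrable M (\<lambda>\<omega>. g j (incr (s j) (s (Suc j)) \<omega>))"
    and g0: "\<And>j. j < n \<Longrightarrow> M.expectation (\<lambda>\<omega>. g j (incr (s j) (s (Suc j)) \<omega>)) = 0"
    and g2: "\<And>j. j < n \<Longrightarrow> integrable M (\<lambda>\<omega>. (g j (incr (s j) (s (Suc j)) \<omega>))\<^sup>2)"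
    and gv: "\<And>j. j < n \<Longrightarrow> M.expectation (\<lambda>\<omega>. (g j (incr (s j) (s (Suc j)) \<omega>))\<^sup>2) \<le> v j"
    and v: "\<And>j. j < n \<Longrightarrow> 0 < v j" and \<delta>: "0 < \<delta>"
  shows "M.expectation (\<lambda>\<omega>. min 1 \<bar>\<Sum>j<n. u j \<omega> * g j (incr (s j) (s (Suc j)) \<omega>)\<bar>)
    \<le> M.prob {\<omega> \<in> space M. \<delta> < (\<Sum>j<n. (u j \<omega>)\<^sup>2 * v j)} + sqrt \<delta>"
proof -
  define G where "G j \<omega> = g j (incr (s j) (s (Suc j)) \<omega>)" for j \<omega>
  \<comment> \<open>The term with index j is included: the coefficient is switched off before the
    level is passed, and \<open>V j\<close> is still known at time \<open>s j\<close>.\<close>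
  define V where "V j \<omega> = (\<Sum>l\<le>j. (u l \<omega>)\<^sup>2 * v l)" for j \<omega>
  define w where "w j \<omega> = (if V j \<omega> \<le> \<delta> then u j \<omega> else 0)" for j \<omega>
  define S where "S m \<omega> = (\<Sum>j<m. w j \<omega> * G j \<omega>)" for m \<omega>
  have smono: "s i \<le> s j" if "i \<le> j" "j \<le> n" for i j
    using that
  proof (induction j)
    case (Suc j)
    then show ?case using sS[of j] by (cases "i = Suc j") auto
  qed simp
  have snn: "0 \<le> s j" if "j \<le> n" for j
    using smono[of 0 j] s0 that by simp
  have Vm: "V j \<in> borel_measurable (F (s j))" if "j < n" for j
  proof -
    have [measurable]: "u l \<in> borel_measurable (F (s j))" if "l \<le> j" for l
      using F_measurable_mono[OF u smono] that \<open>j < n\<close> by auto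
    show ?thesis unfolding V_def by (intro borel_measurable_sum) auto
  qed
  have wm: "w j \<in> borel_measurable (F (s j))" if "j < n" for j
    using Vm[OF that] u[OF that] unfolding w_def[abs_def] by measurable
  have wsum: "(\<Sum>j<m. (w j \<omega>)\<^sup>2 * v j) \<le> \<delta>" if "m \<le> n" for m \<omega>
    using that
  proof (induction m)
    case 0 then show ?case using \<delta> by simp
  next
    case (Suc m)
    show ?case
    proof (cases "V m \<omega> \<le> \<delta>")
      case True
      have "(\<Sum>j<Suc m. (w j \<omega>)\<^sup>2 * v j) \<le> (\<Sum>j<Suc m. (u j \<omega>)\<^sup>2 * v j)"
        using v Suc.prems by (intro sum_mono mult_right_mono) (auto simp: w_def less_imp_le)
      also have "\<dots> = V m \<omega>" by (simp add: V_def lessThan_Suc_atMost)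
      finally show ?thesis using True by simp
    next
      case False
      then show ?thesis using Suc by (simp add: w_def)
    qed
  qed
  have wb: "(w j \<omega>)\<^sup>2 * v j \<le> \<delta>" if "j < n" for j \<omega>
  proof -
    have "(w j \<omega>)\<^sup>2 * v j \<le> (\<Sum>i<n. (w i \<omega>)\<^sup>2 * v i)"
      using v that by (intro member_le_sum) (auto simp: less_imp_le)
    then show ?thesis using wsum[of n \<omega>] by simp
  qed
  \<comment> \<open>Dividing by \<open>v j > 0\<close> bounds each stopped coefficient by a
    constant. This makes it integrable, whereas \<open>u j\<close> itself is only
    measurable.\<close>
  have wb2: "(w j \<omega>)\<^sup>2 \<le> \<delta> / v j" if "j < n" for j \<omega>
    using wb[OF that, of \<omega>] v[OF that] by (simp add: field_simps)
  have wb1: "\<bar>w j \<omega>\<bar> \<le> sqrt (\<delta> / v j)" if "j < n" for j \<omega>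
    using real_sqrt_le_mono[OF wb2[OF that, of \<omega>]] by simp
  have w2int: "integrable M (\<lambda>\<omega>. (w j \<omega>)\<^sup>2)" if "j < n" for j
    using F_measurable_M[OF wm[OF that]] wb2[OF that]
    by (intro M.integrable_const_bound[where B="\<delta> / v j"]) auto
  have Gm: "G j \<in> borel_measurable (F (s (Suc j)))" if "j < n" for j
  proof -
    have "incr (s j) (s (Suc j)) \<in> borel_measurable (F (s (Suc j)))"
      using that snn[of j] snn[of "Suc j"] sS[of j] by (intro borel_measurable_diff W_measurable_F) auto
    from measurable_compose[OF this g[OF that]] show ?thesis by (simp add: G_def[abs_def])
  qed
  have "S m \<in> borel_measurable (F (s m)) \<and> integrable M (\<lambda>\<omega>. (S m \<omega>)\<^sup>2) \<and>
      M.expectation (\<lambda>\<omega>. (S m \<omega>)\<^sup>2) \<le> M.expectation (\<lambda>\<omega>. \<Sum>j<m. (w j \<omega>)\<^sup>2 * v j)" if "m \<le> n" for m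
    using that
  proof (induction m)
    case 0 then show ?case by (simp add: S_def)
  next
    case (Suc m)
    then have m: "m < n" by simp
    have IH: "S m \<in> borel_measurable (F (s m))" "integrable M (\<lambda>\<omega>. (S m \<omega>)\<^sup>2)"
      "M.expectation (\<lambda>\<omega>. (S m \<omega>)\<^sup>2) \<le> M.expectation (\<lambda>\<omega>. \<Sum>j<m. (w j \<omega>)\<^sup>2 * v j)"
      using Suc by auto
    have S_Suc: "S (Suc m) \<omega> = S m \<omega> + w m \<omega> * G m \<omega>" for \<omega>
      by (simp add: S_def)
    have sm: "0 \<le> s m" "s m < s (Suc m)" using m snn[of m] sS by auto
    have meas: "S (Suc m) \<in> borel_measurable (F (s (Suc m)))"
      unfolding S_Suc[abs_def]
      using F_measurable_mono[OF IH(1), of "s (Suc m)"] F_measurable_mono[OF wm[OF m], of "s (Suc m)"] Gm[OF m] sm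
      by (intro borel_measurable_add borel_measurable_times) auto
    have SM: "S m \<in> borel_measurable M" "w m \<in> borel_measurable M"
      using F_measurable_M IH(1) wm[OF m] by auto
    have Sint: "integrable M (S m)"
      by (rule M.square_integrable_imp_integrable[OF SM(1) IH(2)])
    have Swint: "integrable M (\<lambda>\<omega>. 2 * S m \<omega> * w m \<omega>)"
    proof (rule Bochner_Integration.integrable_bound[where f="\<lambda>\<omega>. 2 * sqrt (\<delta> / v m) * S m \<omega>"])
      show "AE \<omega> in M. norm (2 * S m \<omega> * w m \<omega>) \<le> norm (2 * sqrt (\<delta> / v m) * S m \<omega>)"
      proof (rule AE_I2)
        fix \<omega> assume "\<omega> \<in> space M"
        have "\<bar>w m \<omega>\<bar> * \<bar>S m \<omega>\<bar> \<le> \<bar>sqrt (\<delta> / v m)\<bar> * \<bar>S m \<omega>\<bar>"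
          using wb1[OF m, of \<omega>] by (intro mult_right_mono) auto
        then show "norm (2 * S m \<omega> * w m \<omega>) \<le> norm (2 * sqrt (\<delta> / v m) * S m \<omega>)"
          by (simp add: abs_mult mult_ac)
      qed
    qed (use Sint SM in auto)
    \<comment> \<open>The coefficient is \<open>F (s m)\<close>-measurable and the new factor is
      centred and independent of it, so successive differences are orthogonal.\<close>
    have cross: "integrable M (\<lambda>\<omega>. 2 * S m \<omega> * w m \<omega> * G m \<omega>)"
      "M.expectation (\<lambda>\<omega>. 2 * S m \<omega> * w m \<omega> * G m \<omega>) = 0"
    proof -
      have mm: "(\<lambda>\<omega>. 2 * S m \<omega> * w m \<omega>) \<in> borel_measurable (F (s m))"
        using IH(1) wm[OF m] by (intro borel_measurable_times) auto
      show "integrable M (\<lambda>\<omega>. 2 * S m \<omega> * w m \<omega> * G m \<omega>)"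
        unfolding G_def by (rule indep_expectation_mult(1)[OF sm mm Swint g[OF m] g1[OF m]])
      show "M.expectation (\<lambda>\<omega>. 2 * S m \<omega> * w m \<omega> * G m \<omega>) = 0"
        unfolding G_def indep_expectation_mult(2)[OF sm mm Swint g[OF m] g1[OF m]] g0[OF m] by simp
    qed
    have sq: "integrable M (\<lambda>\<omega>. (w m \<omega>)\<^sup>2 * (G m \<omega>)\<^sup>2)"
      "M.expectation (\<lambda>\<omega>. (w m \<omega>)\<^sup>2 * (G m \<omega>)\<^sup>2) \<le> M.expectation (\<lambda>\<omega>. (w m \<omega>)\<^sup>2 * v m)"
    proof -
      have mm: "(\<lambda>\<omega>. (w m \<omega>)\<^sup>2) \<in> borel_measurable (F (s m))"
        using wm[OF m] by (intro borel_measurable_power) auto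
      have gg: "(\<lambda>x. (g m x)\<^sup>2) \<in> borel_measurable borel"
        using g[OF m] by (intro borel_measurable_power) auto
      note ind = indep_expectation_mult[OF sm mm w2int[OF m] gg g2[OF m]]
      show "integrable M (\<lambda>\<omega>. (w m \<omega>)\<^sup>2 * (G m \<omega>)\<^sup>2)"
        unfolding G_def by (rule ind(1))
      have "M.expectation (\<lambda>\<omega>. (w m \<omega>)\<^sup>2 * (G m \<omega>)\<^sup>2) =
          M.expectation (\<lambda>\<omega>. (w m \<omega>)\<^sup>2) * M.expectation (\<lambda>\<omega>. (G m \<omega>)\<^sup>2)"
        unfolding G_def by (rule ind(2))
      also have "\<dots> \<le> M.expectation (\<lambda>\<omega>. (w m \<omega>)\<^sup>2) * v m"
        using gv[OF m] unfolding G_def by (intro mult_left_mono) auto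
      finally show "M.expectation (\<lambda>\<omega>. (w m \<omega>)\<^sup>2 * (G m \<omega>)\<^sup>2) \<le> M.expectation (\<lambda>\<omega>. (w m \<omega>)\<^sup>2 * v m)"
        by simp
    qed
    have expand: "(S (Suc m) \<omega>)\<^sup>2 = ((S m \<omega>)\<^sup>2 + 2 * S m \<omega> * w m \<omega> * G m \<omega>) + (w m \<omega>)\<^sup>2 * (G m \<omega>)\<^sup>2" for \<omega>
      unfolding S_Suc by (simp add: power2_eq_square algebra_simps)
    have int: "integrable M (\<lambda>\<omega>. (S (Suc m) \<omega>)\<^sup>2)"
      unfolding expand by (intro Bochner_Integration.integrable_add IH(2) cross(1) sq(1))
    have "M.expectation (\<lambda>\<omega>. (S (Suc m) \<omega>)\<^sup>2) = M.expectation (\<lambda>\<omega>. (S m \<omega>)\<^sup>2) +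
        M.expectation (\<lambda>\<omega>. (w m \<omega>)\<^sup>2 * (G m \<omega>)\<^sup>2)"
      unfolding expand using IH(2) cross sq(1) by simp
    also have "\<dots> \<le> M.expectation (\<lambda>\<omega>. \<Sum>j<m. (w j \<omega>)\<^sup>2 * v j) + M.expectation (\<lambda>\<omega>. (w m \<omega>)\<^sup>2 * v m)"
      using IH(3) sq(2) by simp
    also have "\<dots> = M.expectation (\<lambda>\<omega>. \<Sum>j<Suc m. (w j \<omega>)\<^sup>2 * v j)"
      using w2int m by (subst Bochner_Integration.integral_add[symmetric])
        (auto intro!: Bochner_Integration.integrable_sum)
    finally show ?case using meas int by blast
  qed
  from this[of n] have Sn: "S n \<in> borel_measurable M" "integrable M (\<lambda>\<omega>. (S n \<omega>)\<^sup>2)"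
      "M.expectation (\<lambda>\<omega>. (S n \<omega>)\<^sup>2) \<le> M.expectation (\<lambda>\<omega>. \<Sum>j<n. (w j \<omega>)\<^sup>2 * v j)"
    using F_measurable_M by auto
  have "M.expectation (\<lambda>\<omega>. \<Sum>j<n. (w j \<omega>)\<^sup>2 * v j) \<le> M.expectation (\<lambda>\<omega>. \<delta>)"
    using wsum[of n] w2int by (intro integral_mono) auto
  then have "M.expectation (\<lambda>\<omega>. (S n \<omega>)\<^sup>2) \<le> \<delta>"
    using Sn(3) by (simp add: P.prob_space)
  then have "sqrt (M.expectation (\<lambda>\<omega>. (S n \<omega>)\<^sup>2)) \<le> sqrt \<delta>" by simp
  then have ES: "M.expectation (\<lambda>\<omega>. \<bar>S n \<omega>\<bar>) \<le> sqrt \<delta>"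
    using M.abs_expectation_le_sqrt[OF Sn(1,2)] by linarith
  let ?A = "{\<omega> \<in> space M. \<delta> < (\<Sum>j<n. (u j \<omega>)\<^sup>2 * v j)}"
  have uM: "u j \<in> borel_measurable M" if "j < n" for j using F_measurable_M u that by auto
  have GM: "G j \<in> borel_measurable M" if "j < n" for j using F_measurable_M Gm that by auto
  have "(\<lambda>\<omega>. \<Sum>j<n. (u j \<omega>)\<^sup>2 * v j) \<in> borel_measurable M"
    using uM by (intro borel_measurable_sum borel_measurable_times borel_measurable_power) auto
  then have A: "?A \<in> sets M" by measurable
  then have A1: "integrable M (indicator ?A :: _ \<Rightarrow> real)"
    by (intro integrable_real_indicator) (auto simp: M.emeasure_eq_measure simp del: space_completion emeasure_completion)
  have tot: "(\<lambda>\<omega>. \<Sum>j<n. u j \<omega> * G j \<omega>) \<in> borel_measurable M"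
    using uM GM by (intro borel_measurable_sum borel_measurable_times) auto
  have "M.expectation (\<lambda>\<omega>. min 1 \<bar>\<Sum>j<n. u j \<omega> * G j \<omega>\<bar>) \<le> M.expectation (\<lambda>\<omega>. indicator ?A \<omega> + \<bar>S n \<omega>\<bar>)"
  proof (rule integral_mono)
    show "integrable M (\<lambda>\<omega>. min 1 \<bar>\<Sum>j<n. u j \<omega> * G j \<omega>\<bar>)"
      using tot by (intro M.integrable_const_bound[where B=1]) auto
    show "integrable M (\<lambda>\<omega>. indicator ?A \<omega> + \<bar>S n \<omega>\<bar>)"
      using A1 M.square_integrable_imp_integrable[OF Sn(1,2)] by (intro Bochner_Integration.integrable_add) auto
    fix \<omega> assume \<omega>: "\<omega> \<in> space M"
    \<comment> \<open>On the exceptional set the truncation at 1 is enough; off it the variance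
      never passes the level, so the stopped and the original sum agree.\<close>
    show "min 1 \<bar>\<Sum>j<n. u j \<omega> * G j \<omega>\<bar> \<le> indicator ?A \<omega> + \<bar>S n \<omega>\<bar>"
    proof (cases "\<omega> \<in> ?A")
      case False
      have "w j \<omega> = u j \<omega>" if "j < n" for j
      proof -
        have "V j \<omega> \<le> (\<Sum>j<n. (u j \<omega>)\<^sup>2 * v j)"
          unfolding V_def using that v by (intro sum_mono2) (auto simp: less_imp_le)
        then show ?thesis using False \<omega> by (simp add: w_def)
      qed
      then show ?thesis by (simp add: S_def min.coboundedI2 add_increasing)
    qed simp
  qed
  also have "\<dots> = M.prob ?A + M.expectation (\<lambda>\<omega>. \<bar>S n \<omega>\<bar>)"
  proof -
    have "?A \<inter> space P = ?A" by auto
    then show ?thesis using A A1 M.square_integrable_imp_integrable[OF Sn(1,2)] by simp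
  qed
  finally show ?thesis using ES unfolding G_def by linarith
qed

end

section \<open>Partitions\<close>

definition partition_of :: "real \<Rightarrow> nat \<Rightarrow> (nat \<Rightarrow> real) \<Rightarrow> bool" where
  "partition_of T N s \<longleftrightarrow> s 0 = 0 \<and> s N = T \<and> (\<forall>j<N. s j < s (Suc j))"

lemma partition_of_mono:
  assumes "partition_of T N s" "i \<le> j" "j \<le> N"
  shows "s i \<le> s j"
  using assms(2,3)
proof (induction j)
  case (Suc j)
  then show ?case
    using assms(1) unfolding partition_of_def
    by (metis Suc_le_lessD le_SucE less_imp_le order_refl order_trans less_imp_le_nat)
qed simp

lemma partition_of_bounds:
  assumes "partition_of T N s" "j \<le> N"
  shows "0 \<le> s j" "s j \<le> T"
  using partition_of_mono[OF assms(1), of 0 j] partition_of_mono[OF assms(1), of j N] assms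
  by (auto simp: partition_of_def)

lemma exists_partition_of_set:
  fixes S :: "real set"
  assumes "finite S" "S \<subseteq> {0..T}" "0 \<in> S" "T \<in> S"
  shows "\<exists>N s. partition_of T N s \<and> (\<forall>j<N. S \<inter> {s j<..<s (Suc j)} = {})"
proof -
  define l where "l = sorted_list_of_set S"
  have l: "sorted l" "distinct l" "set l = S" using assms(1) by (simp_all add: l_def)
  have lt: "l ! i < l ! j" if "i < j" "j < length l" for i j
    using l(1,2) that sorted_nth_mono[of l i j] nth_eq_iff_index_eq[of l i j] by force
  obtain N where N: "length l = Suc N"
    using l(3) assms(3) by (cases l) auto
  obtain i0 where i0: "i0 \<le> N" "l ! i0 = 0" using l(3) assms(3) N by (metis in_set_conv_nth less_Suc_eq_le)
  obtain iT where iT: "iT \<le> N" "l ! iT = T" using l(3) assms(4) N by (metis in_set_conv_nth less_Suc_eq_le)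
  have mem: "l ! i \<in> {0..T}" if "i \<le> N" for i using nth_mem[of i l] that N l(3) assms(2) by auto
  have "l ! 0 = 0" using lt[of 0 i0] i0 mem[of 0] N by (cases "i0 = 0") auto
  moreover have "l ! N = T" using lt[of iT N] iT mem[of N] N by (cases "iT = N") auto
  moreover have "S \<inter> {l ! j<..<l ! Suc j} = {}" if "j < N" for j
  proof (rule ccontr)
    assume "S \<inter> {l ! j<..<l ! Suc j} \<noteq> {}"
    then obtain x where "x \<in> set l" and x: "l ! j < x" "x < l ! Suc j" using l(3) by auto
    then obtain i where i: "i < length l" "l ! i = x" by (metis in_set_conv_nth)
    have "j < i"
    proof (rule ccontr)
      assume "\<not> j < i"
      then have "l ! i \<le> l ! j" using l(1) that N by (intro sorted_nth_mono) auto
      then show False using x i by simp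
    qed
    then have "Suc j \<le> i" by simp
    then have "l ! Suc j \<le> x" using lt[of "Suc j" i] i by (cases "i = Suc j") auto
    then show False using x by simp
  qed
  ultimately show ?thesis
    unfolding partition_of_def using lt N by (intro exI[of _ N] exI[of _ "\<lambda>i. l ! i"]) auto
qed

text \<open>The points of A are added to a grid of step h. With A the jump times of a simple
  integrand, the integrand is constant on every left-open cell.\<close>

lemma exists_fine_partition:
  fixes A :: "real set"
  assumes "0 < T" "0 < h" "finite A"
  shows "\<exists>N s. partition_of T N s \<and> (\<forall>j<N. s (Suc j) - s j \<le> h) \<and> (\<forall>j<N. A \<inter> {s j<..<s (Suc j)} = {})"
proof -
  define S where "S = insert 0 (insert T (A \<inter> {0..T} \<union> ((\<lambda>i. real i * h) ` {..nat \<lceil>T / h\<rceil>} \<inter> {0..T})))"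
  obtain N s where s: "partition_of T N s" "\<forall>j<N. S \<inter> {s j<..<s (Suc j)} = {}"
    using exists_partition_of_set[of S T] assms by (auto simp: S_def)
  have "s (Suc j) - s j \<le> h" if "j < N" for j
  proof (rule ccontr)
    assume far: "\<not> s (Suc j) - s j \<le> h"
    have b: "0 \<le> s j" "s (Suc j) \<le> T" using partition_of_bounds[OF s(1)] that by (auto simp: Suc_leI)
    \<comment> \<open>\<open>i * h\<close> is the first grid point strictly to the right of
      \<open>s j\<close>; a cell longer than h would have it in its interior.\<close>
    define i where "i = nat (\<lfloor>s j / h\<rfloor> + 1)"
    have ri: "real i = real_of_int \<lfloor>s j / h\<rfloor> + 1" using b assms by (simp add: i_def)
    have "s j / h < real i" "real i \<le> s j / h + 1" unfolding ri by linarith+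
    then have x: "s j < real i * h" "real i * h \<le> s j + h" using assms by (auto simp: field_simps)
    then have x2: "real i * h < s (Suc j)" using far by simp
    then have "real i * h \<le> T" using b by simp
    then have "real i \<le> T / h" using assms by (simp add: field_simps)
    then have "i \<le> nat \<lceil>T / h\<rceil>" by linarith
    then have "real i * h \<in> S" using x x2 b assms by (auto simp: S_def)
    then show False using s(2) that x x2 by fastforce
  qed
  moreover have "A \<inter> {s j<..<s (Suc j)} = {}" if "j < N" for j
  proof -
    have b: "0 \<le> s j" "s (Suc j) \<le> T" using partition_of_bounds[OF s(1)] that by (auto simp: Suc_leI)
    then have "A \<inter> {s j<..<s (Suc j)} \<subseteq> S \<inter> {s j<..<s (Suc j)}" unfolding S_def by auto
    then show ?thesis using s(2) that by blast
  qed
  ultimately show ?thesis using s(1) by blast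
qed

lemma partition_increment_bound:
  fixes a s :: "nat \<Rightarrow> real" and \<beta> :: "real \<Rightarrow> real"
  assumes "\<And>j. j < N \<Longrightarrow> \<bar>a j\<bar> \<le> \<epsilon> * (\<beta> (s (Suc j)) - \<beta> (s j))"
  shows "\<bar>\<Sum>j<N. a j\<bar> \<le> \<epsilon> * (\<beta> (s N) - \<beta> (s 0))"
proof -
  have "\<bar>\<Sum>j<N. a j\<bar> \<le> (\<Sum>j<N. \<bar>a j\<bar>)" by (rule sum_abs)
  also have "\<dots> \<le> (\<Sum>j<N. \<epsilon> * (\<beta> (s (Suc j)) - \<beta> (s j)))" using assms by (intro sum_mono) auto
  also have "\<dots> = \<epsilon> * (\<beta> (s N) - \<beta> (s 0))"
    using sum_lessThan_telescope[of "\<lambda>k. \<beta> (s k)" N] by (simp add: sum_distrib_left[symmetric])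
  finally show ?thesis .
qed

text \<open>Absolutely continuous functions are compared through their increments: this replaces
  differentiation almost everywhere.\<close>

lemma eq_of_small_increments:
  fixes \<Phi> \<beta> :: "real \<Rightarrow> real"
  assumes "0 < T"
    and inc: "\<And>\<epsilon>. 0 < \<epsilon> \<Longrightarrow> \<exists>\<delta>>0. \<forall>u v. 0 \<le> u \<and> u \<le> v \<and> v \<le> T \<and> v - u < \<delta> \<longrightarrow>
      \<bar>\<Phi> v - \<Phi> u\<bar> \<le> \<epsilon> * (\<beta> v - \<beta> u)"
  shows "\<Phi> T = \<Phi> 0"
proof -
  have bd: "\<bar>\<Phi> T - \<Phi> 0\<bar> \<le> \<epsilon> * (\<beta> T - \<beta> 0)" if "0 < \<epsilon>" for \<epsilon>
  proof -
    obtain \<delta> where \<delta>: "0 < \<delta>" "\<And>u v. 0 \<le> u \<Longrightarrow> u \<le> v \<Longrightarrow> v \<le> T \<Longrightarrow> v - u < \<delta> \<Longrightarrow> \<bar>\<Phi> v - \<Phi> u\<bar> \<le> \<epsilon> * (\<beta> v - \<beta> u)"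
      using inc[OF \<open>0 < \<epsilon>\<close>] by metis
    obtain N s where s: "partition_of T N s" "\<forall>j<N. s (Suc j) - s j \<le> \<delta> / 2"
      using exists_fine_partition[of T "\<delta> / 2" "{}"] assms \<delta>(1) by auto
    have "\<bar>\<Phi> (s (Suc j)) - \<Phi> (s j)\<bar> \<le> \<epsilon> * (\<beta> (s (Suc j)) - \<beta> (s j))" if "j < N" for j
    proof (rule \<delta>(2))
      show "0 \<le> s j" "s (Suc j) \<le> T" using partition_of_bounds[OF s(1)] that by (auto simp: Suc_leI)
      show "s j \<le> s (Suc j)" using partition_of_mono[OF s(1)] that by simp
      show "s (Suc j) - s j < \<delta>" using s(2) that \<delta>(1) by force
    qed
    from partition_increment_bound[of N "\<lambda>j. \<Phi> (s (Suc j)) - \<Phi> (s j)" \<epsilon> \<beta> s, OF this]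
    have "\<bar>\<Sum>j<N. \<Phi> (s (Suc j)) - \<Phi> (s j)\<bar> \<le> \<epsilon> * (\<beta> (s N) - \<beta> (s 0))" by blast
    then show ?thesis
      using sum_lessThan_telescope[of "\<lambda>k. \<Phi> (s k)" N] s(1) by (simp add: partition_of_def)
  qed
  have "\<bar>\<Phi> T - \<Phi> 0\<bar> \<le> 0"
  proof (rule field_le_epsilon)
    fix e :: real assume "0 < e"
    define K where "K = \<bar>\<beta> T - \<beta> 0\<bar> + 1"
    have K: "0 < K" "\<beta> T - \<beta> 0 \<le> K" by (auto simp: K_def)
    have "\<bar>\<Phi> T - \<Phi> 0\<bar> \<le> e / K * (\<beta> T - \<beta> 0)" using bd[of "e / K"] K \<open>0 < e\<close> by simp
    also have "\<dots> \<le> e / K * K" using K \<open>0 < e\<close> by (intro mult_left_mono) auto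
    finally show "\<bar>\<Phi> T - \<Phi> 0\<bar> \<le> 0 + e" using K by simp
  qed
  then show ?thesis by simp
qed

section \<open>Lebesgue integrals over subintervals\<close>

lemma set_integral_increment:
  fixes f :: "real \<Rightarrow> real"
  assumes "set_integrable lborel {0..T} f" "0 \<le> u" "u \<le> v" "v \<le> T"
  shows "(LINT r:{0..v}|lborel. f r) - (LINT r:{0..u}|lborel. f r) = (LINT r:{u..v}|lborel. f r)"
    and "set_integrable lborel {u..v} f"
proof -
  have i: "set_integrable lborel {a..b} f" if "0 \<le> a" "b \<le> T" for a b
    using set_integrable_subset[OF assms(1), of "{a..b}"] that by auto
  show "set_integrable lborel {u..v} f" by (rule i) (use assms in auto)
  have "integral {0..u} f + integral {u..v} f = integral {0..v} f"
    using set_borel_integral_eq_integral(1)[OF i[of 0 v]] assms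
    by (intro Henstock_Kurzweil_Integration.integral_combine) auto
  then show "(LINT r:{0..v}|lborel. f r) - (LINT r:{0..u}|lborel. f r) = (LINT r:{u..v}|lborel. f r)"
    using set_borel_integral_eq_integral(2)[OF i] assms by simp
qed

lemma set_integrable_continuous_mult:
  fixes e b :: "real \<Rightarrow> real"
  assumes "continuous_on {u..v} e" "set_integrable lborel {u..v} b"
  shows "set_integrable lborel {u..v} (\<lambda>r. e r * b r)"
proof -
  obtain K where K: "\<And>r. r \<in> {u..v} \<Longrightarrow> \<bar>e r\<bar> \<le> K"
    using compact_imp_bounded[OF compact_continuous_image[OF assms(1) compact_Icc]]
    unfolding bounded_iff real_norm_def by blast
  have m1: "(\<lambda>r. indicator {u..v} r *\<^sub>R e r) \<in> borel_measurable borel"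
    using assms(1) by (intro borel_measurable_continuous_on_indicator) auto
  have i: "integrable lborel (\<lambda>r. indicator {u..v} r *\<^sub>R b r)"
    using assms(2) by (simp add: set_integrable_def)
  have m2: "(\<lambda>r. indicator {u..v} r *\<^sub>R b r) \<in> borel_measurable borel"
    using borel_measurable_integrable[OF i] by simp
  have eq: "indicator {u..v} r *\<^sub>R (e r * b r) = (indicator {u..v} r *\<^sub>R e r) * (indicator {u..v} r *\<^sub>R b r)" for r
    by (simp add: indicator_def)
  have "integrable lborel (\<lambda>r. indicator {u..v} r *\<^sub>R (e r * b r))"
  proof (rule Bochner_Integration.integrable_bound)
    show "integrable lborel (\<lambda>r. K * (indicator {u..v} r *\<^sub>R b r))"
      using i by simp
    show "(\<lambda>r. indicator {u..v} r *\<^sub>R (e r * b r)) \<in> borel_measurable lborel"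
      unfolding eq using m1 m2 by simp
    show "AE r in lborel. norm (indicator {u..v} r *\<^sub>R (e r * b r)) \<le> norm (K * (indicator {u..v} r *\<^sub>R b r))"
      using K by (intro AE_I2) (force simp: indicator_def abs_mult intro!: mult_right_mono)
  qed
  then show ?thesis by (simp add: set_integrable_def)
qed

lemma set_integral_abs_bound:
  fixes f g :: "real \<Rightarrow> real"
  assumes "set_integrable lborel {u..v} f" "set_integrable lborel {u..v} g"
    and "\<And>r. r \<in> {u..v} \<Longrightarrow> \<bar>f r\<bar> \<le> g r"
  shows "\<bar>LINT r:{u..v}|lborel. f r\<bar> \<le> (LINT r:{u..v}|lborel. g r)"
proof -
  have "\<bar>LINT r:{u..v}|lborel. f r\<bar> \<le> (LINT r:{u..v}|lborel. \<bar>f r\<bar>)"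
    using set_integral_norm_bound[OF assms(1)] by simp
  also have "\<dots> \<le> (LINT r:{u..v}|lborel. g r)"
    using assms set_integrable_abs[OF assms(1)] by (intro set_integral_mono) auto
  finally show ?thesis .
qed

text \<open>Freezing the continuous factor on a short interval costs at most its oscillation times
  the variation of the integral of b, a bound that adds up along a partition.\<close>

lemma set_integral_continuous_approx:
  fixes e b :: "real \<Rightarrow> real"
  assumes e: "continuous_on {u..v} e" and b: "set_integrable lborel {u..v} b"
    and k: "\<And>r. r \<in> {u..v} \<Longrightarrow> \<bar>k - e r\<bar> \<le> \<epsilon>"
  shows "\<bar>k * (LINT r:{u..v}|lborel. b r) - (LINT r:{u..v}|lborel. e r * b r)\<bar> \<le> \<epsilon> * (LINT r:{u..v}|lborel. \<bar>b r\<bar>)"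
proof -
  note eb = set_integrable_continuous_mult[OF e b]
  have kb: "set_integrable lborel {u..v} (\<lambda>r. k * b r)" using b by (rule set_integrable_mult_right)
  have "k * (LINT r:{u..v}|lborel. b r) - (LINT r:{u..v}|lborel. e r * b r) = (LINT r:{u..v}|lborel. k * b r - e r * b r)"
    using set_integral_diff(2)[OF kb eb] b by simp
  also have "\<bar>\<dots>\<bar> \<le> (LINT r:{u..v}|lborel. \<epsilon> * \<bar>b r\<bar>)"
  proof (rule set_integral_abs_bound)
    show "set_integrable lborel {u..v} (\<lambda>r. k * b r - e r * b r)" by (rule set_integral_diff(1)[OF kb eb])
    show "set_integrable lborel {u..v} (\<lambda>r. \<epsilon> * \<bar>b r\<bar>)" using set_integrable_abs[OF b] by (rule set_integrable_mult_right)
    fix r assume "r \<in> {u..v}"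
    from k[OF this] have "\<bar>k - e r\<bar> * \<bar>b r\<bar> \<le> \<epsilon> * \<bar>b r\<bar>" by (intro mult_right_mono) auto
    then show "\<bar>k * b r - e r * b r\<bar> \<le> \<epsilon> * \<bar>b r\<bar>" by (simp add: abs_mult[symmetric] left_diff_distrib)
  qed
  finally show ?thesis by simp
qed

section \<open>Limits of sums along partitions of vanishing mesh\<close>

lemma uniformly_continuous_real:
  fixes f :: "real \<Rightarrow> real"
  assumes "continuous_on {0..T} f" "0 < \<epsilon>"
  shows "\<exists>\<delta>>0. \<forall>u\<in>{0..T}. \<forall>v\<in>{0..T}. \<bar>u - v\<bar> < \<delta> \<longrightarrow> \<bar>f u - f v\<bar> < \<epsilon>"
proof -
  have "uniformly_continuous_on {0..T} f"
    by (rule compact_uniformly_continuous[OF assms(1) compact_Icc])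
  then show ?thesis
    using assms(2) unfolding uniformly_continuous_on_def dist_real_def by blast
qed

text \<open>As b is only integrable, the increments of B are kept as integrals and only e is frozen,
  at the right end of each cell because that is where \<open>product_increment\<close> evaluates
  \<open>E\<close>. The summed errors are at most the oscillation of e times the integral of the
  absolute value of b.\<close>

lemma riemann_sum_limit:
  fixes e b B :: "real \<Rightarrow> real" and h :: "nat \<Rightarrow> real" and N :: "nat \<Rightarrow> nat" and s :: "nat \<Rightarrow> nat \<Rightarrow> real"
  assumes e: "continuous_on {0..T} e" and b: "set_integrable lborel {0..T} b"
    and B: "\<And>u. 0 \<le> u \<Longrightarrow> u \<le> T \<Longrightarrow> B u = x + (LINT r:{0..u}|lborel. b r)"
    and p: "\<And>l. partition_of T (N l) (s l)" and mesh: "\<And>l j. j < N l \<Longrightarrow> s l (Suc j) - s l j \<le> h l"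
    and h: "h \<longlonglongrightarrow> 0"
  shows "(\<lambda>l. \<Sum>j<N l. e (s l (Suc j)) * (B (s l (Suc j)) - B (s l j))) \<longlonglongrightarrow> (LINT r:{0..T}|lborel. e r * b r)"
proof -
  define \<Phi> where "\<Phi> v = (LINT r:{0..v}|lborel. e r * b r)" for v
  define \<beta> where "\<beta> v = (LINT r:{0..v}|lborel. \<bar>b r\<bar>)" for v
  define R where "R l = (\<Sum>j<N l. e (s l (Suc j)) * (B (s l (Suc j)) - B (s l j)))" for l
  note eb = set_integrable_continuous_mult[OF e b]
  note ab = set_integrable_abs[OF b]
  have "AE r in lborel. r \<noteq> (0::real)" by (rule AE_lborel_singleton)
  then have z: "\<Phi> 0 = 0" "\<beta> 0 = 0"
    unfolding \<Phi>_def \<beta>_def set_lebesgue_integral_def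
    by (intro integral_eq_zero_AE; eventually_elim; simp)+
  have \<beta>T: "0 \<le> \<beta> T" unfolding \<beta>_def set_lebesgue_integral_def by (intro integral_nonneg_AE) auto
  have key: "\<forall>\<^sub>F l in sequentially. \<bar>R l - \<Phi> T\<bar> \<le> \<epsilon> * \<beta> T" if "0 < \<epsilon>" for \<epsilon>
  proof -
    obtain \<delta> where \<delta>: "0 < \<delta>" "\<forall>u\<in>{0..T}. \<forall>v\<in>{0..T}. \<bar>u - v\<bar> < \<delta> \<longrightarrow> \<bar>e u - e v\<bar> < \<epsilon>"
      using uniformly_continuous_real[OF e \<open>0 < \<epsilon>\<close>] by blast
    have "\<forall>\<^sub>F l in sequentially. h l < \<delta>" using h \<delta>(1) by (rule order_tendstoD(2))
    then show ?thesis
    proof eventually_elim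
      case (elim l)
      define a where "a j = e (s l (Suc j)) * (B (s l (Suc j)) - B (s l j)) - (\<Phi> (s l (Suc j)) - \<Phi> (s l j))" for j
      have "\<bar>a j\<bar> \<le> \<epsilon> * (\<beta> (s l (Suc j)) - \<beta> (s l j))" if "j < N l" for j
      proof -
        have bd: "0 \<le> s l j" "s l j \<le> s l (Suc j)" "s l (Suc j) \<le> T"
          using partition_of_bounds[OF p] partition_of_mono[OF p, of j "Suc j" l] that by (auto simp: Suc_leI)
        have "\<bar>e (s l (Suc j)) - e r\<bar> \<le> \<epsilon>" if "r \<in> {s l j..s l (Suc j)}" for r
        proof (rule less_imp_le, rule \<delta>(2)[rule_format])
          show "\<bar>s l (Suc j) - r\<bar> < \<delta>" using that mesh[OF \<open>j < N l\<close>] elim by auto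
        qed (use that bd in auto)
        moreover have "continuous_on {s l j..s l (Suc j)} e"
          using e by (rule continuous_on_subset) (use bd in auto)
        moreover have "B (s l (Suc j)) - B (s l j) = (LINT r:{s l j..s l (Suc j)}|lborel. b r)"
          using set_integral_increment(1)[OF b bd] B[of "s l j"] B[of "s l (Suc j)"] bd by simp
        ultimately show ?thesis
          unfolding a_def \<Phi>_def \<beta>_def set_integral_increment(1)[OF eb bd] set_integral_increment(1)[OF ab bd]
          using set_integral_continuous_approx[OF _ set_integral_increment(2)[OF b bd]] by simp
      qed
      from partition_increment_bound[of "N l" a \<epsilon> \<beta> "s l", OF this]
      have "\<bar>\<Sum>j<N l. a j\<bar> \<le> \<epsilon> * (\<beta> T - \<beta> 0)" using p[of l] by (simp add: partition_of_def)
      moreover have "(\<Sum>j<N l. \<Phi> (s l (Suc j)) - \<Phi> (s l j)) = \<Phi> T"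
        using sum_lessThan_telescope[of "\<lambda>k. \<Phi> (s l k)" "N l"] p[of l] z by (simp add: partition_of_def)
      ultimately show ?case using z by (simp add: sum_subtractf a_def R_def)
    qed
  qed
  have "R \<longlonglongrightarrow> \<Phi> T"
  proof (rule tendstoI)
    fix \<epsilon> :: real assume "0 < \<epsilon>"
    then have "0 < \<epsilon> / (\<beta> T + 1)" using \<beta>T by simp
    from key[OF this]
    show "\<forall>\<^sub>F l in sequentially. dist (R l) (\<Phi> T) < \<epsilon>"
    proof eventually_elim
      case (elim l)
      have "\<epsilon> / (\<beta> T + 1) * \<beta> T < \<epsilon>" using \<beta>T \<open>0 < \<epsilon>\<close> by (simp add: field_simps)
      then show ?case using elim unfolding dist_real_def by linarith
    qed
  qed
  then show ?thesis by (simp add: \<Phi>_def R_def[abs_def])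
qed

text \<open>On a cell H has its right-end value throughout, so the j-th term is an integral over
  that cell. The square splits by \<open>(p + q)\<^sup>2 \<le> 2 * p\<^sup>2 + 2 * q\<^sup>2\<close>
  into the sampling error a and the L2 error of H, and the cells are disjoint.\<close>

lemma step_sum_bound:
  fixes H x y :: "real \<Rightarrow> real"
  assumes p: "partition_of T N s"
    and H: "\<And>j r. j < N \<Longrightarrow> s j < r \<Longrightarrow> r \<le> s (Suc j) \<Longrightarrow> H r = H (s (Suc j))"
    and Hm: "H \<in> borel_measurable borel" and x: "continuous_on {0..T} x"
    and y: "\<And>j r. j < N \<Longrightarrow> s j \<le> r \<Longrightarrow> r \<le> s (Suc j) \<Longrightarrow> \<bar>y (s j) - x r\<bar> \<le> a"
    and L2: "(\<integral>\<^sup>+r\<in>{0..T}. ennreal ((H r - x r)\<^sup>2) \<partial>lborel) \<le> ennreal q" and nn: "0 \<le> a" "0 \<le> q" "0 \<le> T"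
  shows "(\<Sum>j<N. (y (s j) - H (s (Suc j)))\<^sup>2 * (s (Suc j) - s j)) \<le> 2 * a\<^sup>2 * T + 2 * q"
proof -
  let ?I = "\<lambda>j. {s j<..s (Suc j)}"
  let ?A = "\<Union>j\<in>{..<N}. ?I j"
  have sj: "0 \<le> s j" "s j \<le> s (Suc j)" "s (Suc j) \<le> T" if "j < N" for j
    using partition_of_bounds[OF p] partition_of_mono[OF p, of j "Suc j"] that by (auto simp: Suc_leI)
  have disj: "disjoint_family_on ?I {..<N}"
  proof (unfold disjoint_family_on_def, intro ballI impI)
    have *: "?I i \<inter> ?I j = {}" if "i < j" "j < N" for i j
      using partition_of_mono[OF p, of "Suc i" j] that by auto
    fix i j assume "i \<in> {..<N}" "j \<in> {..<N}" "i \<noteq> j"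
    then show "?I i \<inter> ?I j = {}" using *[of i j] *[of j i] by (metis Int_commute lessThan_iff linorder_neqE_nat)
  qed
  have sub: "?A \<subseteq> {0..T}" using sj by fastforce
  have xm: "(\<lambda>r. indicator {0..T} r * x r) \<in> borel_measurable borel"
    using borel_measurable_continuous_on_indicator[OF _ x] by simp
  have fm: "(\<lambda>r. ennreal ((H r - x r)\<^sup>2) * indicator {0..T} r) \<in> borel_measurable borel"
  proof -
    have "(\<lambda>r. ennreal ((H r - indicator {0..T} r * x r)\<^sup>2) * indicator {0..T} r) \<in> borel_measurable borel"
      using Hm xm by measurable
    also have "(\<lambda>r. ennreal ((H r - indicator {0..T} r * x r)\<^sup>2) * indicator {0..T} r) =
        (\<lambda>r. ennreal ((H r - x r)\<^sup>2) * indicator {0..T} r)"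
      by (auto simp: fun_eq_iff indicator_def)
    finally show ?thesis .
  qed
  have "ennreal (\<Sum>j<N. (y (s j) - H (s (Suc j)))\<^sup>2 * (s (Suc j) - s j)) =
      (\<Sum>j<N. \<integral>\<^sup>+r. ennreal ((y (s j) - H (s (Suc j)))\<^sup>2) * indicator (?I j) r \<partial>lborel)"
    using sj by (subst sum_ennreal[symmetric]) (auto simp: nn_integral_cmult_indicator ennreal_mult intro!: sum.cong)
  also have "\<dots> \<le> (\<Sum>j<N. \<integral>\<^sup>+r. (ennreal (2 * a\<^sup>2) * indicator {0..T} r
      + ennreal 2 * (ennreal ((H r - x r)\<^sup>2) * indicator {0..T} r)) * indicator (?I j) r \<partial>lborel)"
  proof (intro sum_mono nn_integral_mono)
    fix j r assume j: "j \<in> {..<N}"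
    show "ennreal ((y (s j) - H (s (Suc j)))\<^sup>2) * indicator (?I j) r \<le>
      (ennreal (2 * a\<^sup>2) * indicator {0..T} r + ennreal 2 * (ennreal ((H r - x r)\<^sup>2) * indicator {0..T} r)) * indicator (?I j) r"
    proof (cases "r \<in> ?I j")
      case True
      then have rT: "r \<in> {0..T}" using sj[of j] j by auto
      have H': "H r = H (s (Suc j))" using H[of j r] True j by (simp only: lessThan_iff greaterThanAtMost_iff)
      have "\<bar>y (s j) - x r\<bar> \<le> a" using y[of j r] True j by simp
      then have "(y (s j) - x r)\<^sup>2 \<le> a\<^sup>2" using nn by (metis abs_ge_zero power2_abs power_mono)
      moreover have "(y (s j) - H r)\<^sup>2 \<le> 2 * (y (s j) - x r)\<^sup>2 + 2 * (H r - x r)\<^sup>2"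
        using zero_le_power2[of "(y (s j) - x r) + (H r - x r)"] by (simp add: power2_eq_square algebra_simps)
      ultimately have "(y (s j) - H (s (Suc j)))\<^sup>2 \<le> 2 * a\<^sup>2 + 2 * (H r - x r)\<^sup>2" unfolding H' by linarith
      then have "ennreal ((y (s j) - H (s (Suc j)))\<^sup>2) \<le> ennreal (2 * a\<^sup>2) + ennreal 2 * ennreal ((H r - x r)\<^sup>2)"
        by (subst ennreal_mult[symmetric], simp, simp)
          (metis ennreal_leI ennreal_plus mult_nonneg_nonneg zero_le_numeral zero_le_power2)
      then show ?thesis using True rT by simp
    qed simp
  qed
  also have "\<dots> = (\<integral>\<^sup>+r. (\<Sum>j<N. (ennreal (2 * a\<^sup>2) * indicator {0..T} r
      + ennreal 2 * (ennreal ((H r - x r)\<^sup>2) * indicator {0..T} r)) * indicator (?I j) r) \<partial>lborel)"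
    using fm by (subst nn_integral_sum) (auto intro!: borel_measurable_times borel_measurable_add)
  also have "\<dots> \<le> (\<integral>\<^sup>+r. ennreal (2 * a\<^sup>2) * indicator {0..T} r
      + ennreal 2 * (ennreal ((H r - x r)\<^sup>2) * indicator {0..T} r) \<partial>lborel)"
  proof (rule nn_integral_mono)
    fix r
    \<comment> \<open>At most one cell contains r, so no point is counted twice.\<close>
    have "(\<Sum>j<N. indicator (?I j) r) = (indicator ?A r :: real)"
      using indicator_UN_disjoint[OF finite_lessThan disj, of r] by (metis (no_types))
    then have "ennreal (\<Sum>j<N. indicator (?I j) r) \<le> 1" by (simp add: indicator_def)
    then have le: "(\<Sum>j<N. indicator (?I j) r) \<le> (1 :: ennreal)"
      by (subst (asm) sum_ennreal[symmetric]) (simp_all add: ennreal_indicator)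
    show "(\<Sum>j<N. (ennreal (2 * a\<^sup>2) * indicator {0..T} r + ennreal 2 * (ennreal ((H r - x r)\<^sup>2) * indicator {0..T} r)) * indicator (?I j) r)
      \<le> ennreal (2 * a\<^sup>2) * indicator {0..T} r + ennreal 2 * (ennreal ((H r - x r)\<^sup>2) * indicator {0..T} r)"
      unfolding sum_distrib_left[symmetric] using mult_left_mono[OF le] by fastforce
  qed
  also have "\<dots> = ennreal (2 * a\<^sup>2) * ennreal T + ennreal 2 * (\<integral>\<^sup>+r\<in>{0..T}. ennreal ((H r - x r)\<^sup>2) \<partial>lborel)"
    using fm nn by (subst nn_integral_add) (auto simp: nn_integral_cmult nn_integral_cmult_indicator)
  also have "\<dots> \<le> ennreal (2 * a\<^sup>2) * ennreal T + ennreal 2 * ennreal q"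
    using L2 by (intro add_left_mono mult_left_mono) auto
  also have "\<dots> = ennreal (2 * a\<^sup>2 * T + 2 * q)"
    using nn by (subst ennreal_plus) (auto simp: ennreal_mult)
  finally show ?thesis using nn by (subst (asm) ennreal_le_iff) auto
qed

text \<open>Read along one path, with e for \<open>E\<close>, x for the solution, y for its
  approximation by a simple integral, H for the simple integrand, and m, m' for the means of the two
  variables in \<open>rho_moments\<close>. The first two sums bound the accumulated conditional
  variances of the centred parts; the third collects the means.\<close>

lemma step_approximation_limits:
  fixes e x :: "real \<Rightarrow> real" and y H :: "nat \<Rightarrow> real \<Rightarrow> real" and s m m' :: "nat \<Rightarrow> nat \<Rightarrow> real" and h :: "nat \<Rightarrow> real"
  assumes T: "0 < T" and \<sigma>: "0 < \<sigma>" and K: "0 \<le> K"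
    and e: "continuous_on {0..T} e" and x: "continuous_on {0..T} x"
    and p: "\<And>l. partition_of T (N l) (s l)" and mesh: "\<And>l j. j < N l \<Longrightarrow> s l (Suc j) - s l j \<le> h l"
    and h: "h \<longlonglongrightarrow> 0"
    and y: "\<forall>\<^sub>F l in sequentially. \<forall>t\<in>{0..T}. \<bar>y l t - x t\<bar> \<le> (1/2)^l"
    and H: "\<And>l j r. j < N l \<Longrightarrow> s l j < r \<Longrightarrow> r \<le> s l (Suc j) \<Longrightarrow> H l r = H l (s l (Suc j))"
    and Hm: "\<And>l. H l \<in> borel_measurable borel"
    and L2: "\<forall>\<^sub>F l in sequentially. (\<integral>\<^sup>+r\<in>{0..T}. ennreal ((H l r - \<sigma> * x r)\<^sup>2) \<partial>lborel) \<le> ennreal ((1/2)^l)"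
    and m: "\<And>l j. j < N l \<Longrightarrow> \<bar>m l j\<bar> \<le> K * (s l (Suc j) - s l j)\<^sup>2"
    and m': "\<And>l j. j < N l \<Longrightarrow> \<bar>m' l j\<bar> \<le> K * (s l (Suc j) - s l j)"
  shows "(\<lambda>l. \<Sum>j<N l. (e (s l j) * y l (s l j))\<^sup>2 * (K * (s l (Suc j) - s l j)\<^sup>2)) \<longlonglongrightarrow> 0" (is ?t1)
    and "(\<lambda>l. \<Sum>j<N l. (e (s l j) * (\<sigma> * y l (s l j) - H l (s l (Suc j))))\<^sup>2 * (K * (s l (Suc j) - s l j))) \<longlonglongrightarrow> 0" (is ?t2)
    and "(\<lambda>l. (\<Sum>j<N l. e (s l j) * y l (s l j) * m l j)
        + (\<Sum>j<N l. e (s l j) * (\<sigma> * y l (s l j) - H l (s l (Suc j))) * m' l j)) \<longlonglongrightarrow> 0" (is ?t3)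
proof -
  have bd: "0 \<le> s l j" "s l j < s l (Suc j)" "s l (Suc j) \<le> T" if "j < N l" for l j
    using partition_of_bounds[OF p] p[of l] that by (auto simp: Suc_leI partition_of_def)
  have sum_len: "(\<Sum>j<N l. s l (Suc j) - s l j) = T" for l
    using sum_lessThan_telescope[of "s l" "N l"] p[of l] by (simp add: partition_of_def)
  obtain A where A: "\<And>t. t \<in> {0..T} \<Longrightarrow> \<bar>e t\<bar> \<le> A"
    using compact_imp_bounded[OF compact_continuous_image[OF e compact_Icc]]
    unfolding bounded_iff real_norm_def by blast
  obtain C where C: "\<And>t. t \<in> {0..T} \<Longrightarrow> \<bar>x t\<bar> \<le> C"
    using compact_imp_bounded[OF compact_continuous_image[OF x compact_Icc]]
    unfolding bounded_iff real_norm_def by blast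
  have A0: "0 \<le> A" using A[of 0] T by auto
  have C0: "0 \<le> C" using C[of 0] T by auto
  define D where "D = A * (C + 1)"
  have D0: "0 \<le> D" using A0 C0 by (simp add: D_def)
  have ey: "\<forall>\<^sub>F l in sequentially. \<forall>j<N l. \<bar>e (s l j) * y l (s l j)\<bar> \<le> D"
    using y
  proof eventually_elim
    case (elim l)
    show ?case
    proof (intro allI impI)
      fix j assume "j < N l"
      then have sj: "s l j \<in> {0..T}" using bd[of j l] by auto
      have "(1/2::real)^l \<le> 1" by (simp add: power_le_one)
      then have "\<bar>y l (s l j)\<bar> \<le> C + 1" using elim[rule_format, OF sj] C[OF sj] by linarith
      then show "\<bar>e (s l j) * y l (s l j)\<bar> \<le> D"
        unfolding D_def abs_mult using A[OF sj] A0 by (intro mult_mono) auto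
    qed
  qed
  \<comment> \<open>The discrete L2 distance between \<open>\<sigma> * y\<close> and the simple
    integrand. The moments attached to this difference are only of order h, so smallness must come
    from Q and not from the mesh.\<close>
  define Q where "Q l = (\<Sum>j<N l. (\<sigma> * y l (s l j) - H l (s l (Suc j)))\<^sup>2 * (s l (Suc j) - s l j))" for l
  have Q0: "0 \<le> Q l" for l unfolding Q_def using bd by (intro sum_nonneg mult_nonneg_nonneg) (auto simp: less_imp_le)
  have half: "(\<lambda>l. (1/2::real)^l) \<longlonglongrightarrow> 0" by (intro LIMSEQ_power_zero) auto
  have Qb: "\<forall>\<^sub>F l in sequentially. Q l \<le> 2 * (\<sigma> * (2 * \<epsilon>))\<^sup>2 * T + 2 * (1/2)^l" if "0 < \<epsilon>" for \<epsilon>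
  proof -
    obtain \<delta> where \<delta>: "0 < \<delta>" "\<forall>u\<in>{0..T}. \<forall>v\<in>{0..T}. \<bar>u - v\<bar> < \<delta> \<longrightarrow> \<bar>x u - x v\<bar> < \<epsilon>"
      using uniformly_continuous_real[OF x \<open>0 < \<epsilon>\<close>] by blast
    have "\<forall>\<^sub>F l in sequentially. h l < \<delta>" using h \<delta>(1) by (rule order_tendstoD(2))
    moreover have "\<forall>\<^sub>F l in sequentially. (1/2)^l < \<epsilon>" using half that by (rule order_tendstoD(2))
    ultimately show ?thesis using y L2
    proof eventually_elim
      case (elim l)
      show ?case unfolding Q_def
      proof (rule step_sum_bound[OF p, where y="\<lambda>t. \<sigma> * y l t" and x="\<lambda>t. \<sigma> * x t"])
        show "H l r = H l (s l (Suc j))" if "j < N l" "s l j < r" "r \<le> s l (Suc j)" for j r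
          by (rule H[OF that])
        show "continuous_on {0..T} (\<lambda>t. \<sigma> * x t)" using x by (intro continuous_intros)
        fix j r assume j: "j < N l" "s l j \<le> r" "r \<le> s l (Suc j)"
        then have sj: "s l j \<in> {0..T}" "r \<in> {0..T}" using bd[of j l] by auto
        have "\<bar>s l j - r\<bar> < \<delta>" using mesh[OF j(1)] j elim(1) by auto
        then have "\<bar>x (s l j) - x r\<bar> < \<epsilon>" using \<delta>(2) sj by blast
        moreover have "\<bar>y l (s l j) - x (s l j)\<bar> < \<epsilon>" using elim(3)[rule_format, OF sj(1)] elim(2) by linarith
        ultimately have "\<bar>y l (s l j) - x r\<bar> \<le> 2 * \<epsilon>" by linarith
        then have "\<sigma> * \<bar>y l (s l j) - x r\<bar> \<le> \<sigma> * (2 * \<epsilon>)" using \<sigma> by (intro mult_left_mono) auto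
        then show "\<bar>\<sigma> * y l (s l j) - \<sigma> * x r\<bar> \<le> \<sigma> * (2 * \<epsilon>)"
          using \<sigma> by (simp add: abs_mult right_diff_distrib[symmetric])
      qed (use elim \<sigma> T that Hm in auto)
    qed
  qed
  have Qlim: "Q \<longlonglongrightarrow> 0"
  proof (rule tendstoI)
    fix r :: real assume r: "0 < r"
    \<comment> \<open>With this choice the first term of \<open>Qb\<close> is r / 4, while the
      second is eventually below r / 2.\<close>
    define \<epsilon> where "\<epsilon> = sqrt (r / (32 * \<sigma>\<^sup>2 * T))"
    have \<epsilon>: "0 < \<epsilon>" "\<epsilon>\<^sup>2 = r / (32 * \<sigma>\<^sup>2 * T)" using r \<sigma> T by (auto simp: \<epsilon>_def)
    have \<epsilon>r: "2 * (\<sigma> * (2 * \<epsilon>))\<^sup>2 * T = r / 4" using \<epsilon>(2) \<sigma> T by (simp add: power_mult_distrib)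
    have "\<forall>\<^sub>F l in sequentially. (1/2)^l < r / 4" by (rule order_tendstoD(2)[OF half]) (use r in simp)
    then show "\<forall>\<^sub>F l in sequentially. dist (Q l) 0 < r" using Qb[OF \<epsilon>(1)]
    proof eventually_elim
      case (elim l)
      then show ?case using Q0[of l] r unfolding \<epsilon>r by (simp add: dist_real_def)
    qed
  qed
  show ?t1
  proof (rule Lim_null_comparison)
    show "\<forall>\<^sub>F l in sequentially. norm (\<Sum>j<N l. (e (s l j) * y l (s l j))\<^sup>2 * (K * (s l (Suc j) - s l j)\<^sup>2)) \<le> D\<^sup>2 * K * T * h l"
      using ey
    proof eventually_elim
      case (elim l)
      have "(\<Sum>j<N l. (e (s l j) * y l (s l j))\<^sup>2 * (K * (s l (Suc j) - s l j)\<^sup>2)) \<le> (\<Sum>j<N l. (D\<^sup>2 * K * h l) * (s l (Suc j) - s l j))"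
      proof (rule sum_mono)
        fix j assume "j \<in> {..<N l}"
        then have j: "j < N l" by simp
        have "(e (s l j) * y l (s l j))\<^sup>2 \<le> D\<^sup>2" using elim[rule_format, OF j] by (metis abs_ge_zero power2_abs power_mono)
        moreover have "(s l (Suc j) - s l j)\<^sup>2 \<le> h l * (s l (Suc j) - s l j)"
          unfolding power2_eq_square using mesh[OF j] bd[OF j] by (intro mult_right_mono) auto
        ultimately have "(e (s l j) * y l (s l j))\<^sup>2 * (K * (s l (Suc j) - s l j)\<^sup>2) \<le> D\<^sup>2 * (K * (h l * (s l (Suc j) - s l j)))"
          using K by (intro mult_mono) auto
        then show "(e (s l j) * y l (s l j))\<^sup>2 * (K * (s l (Suc j) - s l j)\<^sup>2) \<le> (D\<^sup>2 * K * h l) * (s l (Suc j) - s l j)"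
          by (simp add: mult_ac)
      qed
      also have "\<dots> = D\<^sup>2 * K * h l * T" by (simp add: sum_distrib_left[symmetric] sum_len)
      finally show ?case using K by (simp add: mult_ac sum_nonneg abs_of_nonneg)
    qed
    show "(\<lambda>l. D\<^sup>2 * K * T * h l) \<longlonglongrightarrow> 0" using tendsto_mult_left[OF h, of "D\<^sup>2 * K * T"] by simp
  qed
  have eA: "\<bar>e (s l j)\<bar> \<le> A" if "j < N l" for l j using A[of "s l j"] bd[OF that] by auto
  show ?t2
  proof (rule Lim_null_comparison)
    show "\<forall>\<^sub>F l in sequentially. norm (\<Sum>j<N l. (e (s l j) * (\<sigma> * y l (s l j) - H l (s l (Suc j))))\<^sup>2 * (K * (s l (Suc j) - s l j))) \<le> A\<^sup>2 * K * Q l"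
    proof (rule always_eventually, rule allI)
      fix l
      have "(\<Sum>j<N l. (e (s l j) * (\<sigma> * y l (s l j) - H l (s l (Suc j))))\<^sup>2 * (K * (s l (Suc j) - s l j)))
        \<le> (\<Sum>j<N l. (A\<^sup>2 * K) * ((\<sigma> * y l (s l j) - H l (s l (Suc j)))\<^sup>2 * (s l (Suc j) - s l j)))"
      proof (rule sum_mono)
        fix j assume "j \<in> {..<N l}"
        then have j: "j < N l" by simp
        have "(e (s l j))\<^sup>2 \<le> A\<^sup>2" using eA[OF j] by (metis abs_ge_zero power2_abs power_mono)
        then have "(e (s l j))\<^sup>2 * (K * ((\<sigma> * y l (s l j) - H l (s l (Suc j)))\<^sup>2 * (s l (Suc j) - s l j)))
           \<le> A\<^sup>2 * (K * ((\<sigma> * y l (s l j) - H l (s l (Suc j)))\<^sup>2 * (s l (Suc j) - s l j)))"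
          using K bd[OF j] by (intro mult_right_mono) auto
        then show "(e (s l j) * (\<sigma> * y l (s l j) - H l (s l (Suc j))))\<^sup>2 * (K * (s l (Suc j) - s l j))
            \<le> (A\<^sup>2 * K) * ((\<sigma> * y l (s l j) - H l (s l (Suc j)))\<^sup>2 * (s l (Suc j) - s l j))"
          by (simp add: mult_ac power_mult_distrib)
      qed
      also have "\<dots> = A\<^sup>2 * K * Q l" by (simp add: sum_distrib_left[symmetric] Q_def)
      finally show "norm (\<Sum>j<N l. (e (s l j) * (\<sigma> * y l (s l j) - H l (s l (Suc j))))\<^sup>2 * (K * (s l (Suc j) - s l j))) \<le> A\<^sup>2 * K * Q l"
        using K bd by (subst real_norm_def, subst abs_of_nonneg) (auto intro!: sum_nonneg mult_nonneg_nonneg simp: less_imp_le)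
    qed
    show "(\<lambda>l. A\<^sup>2 * K * Q l) \<longlonglongrightarrow> 0" using tendsto_mult_left[OF Qlim, of "A\<^sup>2 * K"] by simp
  qed
  have t3a: "(\<lambda>l. \<Sum>j<N l. e (s l j) * y l (s l j) * m l j) \<longlonglongrightarrow> 0"
  proof (rule Lim_null_comparison)
    show "\<forall>\<^sub>F l in sequentially. norm (\<Sum>j<N l. e (s l j) * y l (s l j) * m l j) \<le> D * K * T * h l"
      using ey
    proof eventually_elim
      case (elim l)
      have "norm (\<Sum>j<N l. e (s l j) * y l (s l j) * m l j) \<le> (\<Sum>j<N l. (D * K * h l) * (s l (Suc j) - s l j))"
      proof (rule sum_norm_le)
        fix j assume "j \<in> {..<N l}"
        then have j: "j < N l" by simp
        have "(s l (Suc j) - s l j)\<^sup>2 \<le> h l * (s l (Suc j) - s l j)"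
          unfolding power2_eq_square using mesh[OF j] bd[OF j] by (intro mult_right_mono) auto
        then have "K * (s l (Suc j) - s l j)\<^sup>2 \<le> K * (h l * (s l (Suc j) - s l j))" using K by (intro mult_left_mono) auto
        then have "\<bar>m l j\<bar> \<le> K * (h l * (s l (Suc j) - s l j))" using m[OF j] by linarith
        then have "\<bar>e (s l j) * y l (s l j)\<bar> * \<bar>m l j\<bar> \<le> D * (K * (h l * (s l (Suc j) - s l j)))"
          using elim[rule_format, OF j] D0 by (intro mult_mono) auto
        then show "norm (e (s l j) * y l (s l j) * m l j) \<le> (D * K * h l) * (s l (Suc j) - s l j)"
          by (simp add: abs_mult mult_ac)
      qed
      also have "\<dots> = D * K * h l * T" by (simp add: sum_distrib_left[symmetric] sum_len)
      finally show ?case by (simp add: mult_ac)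
    qed
    show "(\<lambda>l. D * K * T * h l) \<longlonglongrightarrow> 0" using tendsto_mult_left[OF h, of "D * K * T"] by simp
  qed
  have t3b: "(\<lambda>l. \<Sum>j<N l. e (s l j) * (\<sigma> * y l (s l j) - H l (s l (Suc j))) * m' l j) \<longlonglongrightarrow> 0"
  proof (rule Lim_null_comparison)
    show "\<forall>\<^sub>F l in sequentially. norm (\<Sum>j<N l. e (s l j) * (\<sigma> * y l (s l j) - H l (s l (Suc j))) * m' l j) \<le> A * K * sqrt (Q l * T)"
    proof (rule always_eventually, rule allI)
      fix l
      define z where "z j = \<bar>\<sigma> * y l (s l j) - H l (s l (Suc j))\<bar>" for j
      define d where "d j = s l (Suc j) - s l j" for j
      have d0: "0 \<le> d j" if "j < N l" for j using bd[OF that] by (simp add: d_def)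
      have "norm (\<Sum>j<N l. e (s l j) * (\<sigma> * y l (s l j) - H l (s l (Suc j))) * m' l j) \<le> (\<Sum>j<N l. (A * K) * (z j * d j))"
      proof (rule sum_norm_le)
        fix j assume "j \<in> {..<N l}"
        then have j: "j < N l" by simp
        have "\<bar>e (s l j)\<bar> * z j * \<bar>m' l j\<bar> \<le> A * z j * (K * d j)"
          using eA[OF j] m'[OF j] A0 by (intro mult_mono) (auto simp: z_def d_def)
        then show "norm (e (s l j) * (\<sigma> * y l (s l j) - H l (s l (Suc j))) * m' l j) \<le> (A * K) * (z j * d j)"
          by (simp add: abs_mult mult_ac z_def)
      qed
      also have "\<dots> = (A * K) * (\<Sum>j<N l. z j * d j)" by (simp add: sum_distrib_left)
      also have "\<dots> \<le> (A * K) * sqrt (Q l * T)"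
      proof (rule mult_left_mono)
        \<comment> \<open>Cauchy-Schwarz with each cell length split into two square roots: one
          factor sums to Q, the other to T.\<close>
        have "(\<Sum>j<N l. z j * d j) = (\<Sum>j<N l. (z j * sqrt (d j)) * sqrt (d j))"
          using d0 by (intro sum.cong) auto
        also have "\<dots> \<le> sqrt ((\<Sum>j<N l. (z j * sqrt (d j))\<^sup>2) * (\<Sum>j<N l. (sqrt (d j))\<^sup>2))"
          by (intro real_le_rsqrt Cauchy_Schwarz_ineq_sum)
        also have "(\<Sum>j<N l. (z j * sqrt (d j))\<^sup>2) = Q l"
          unfolding Q_def using d0 by (intro sum.cong) (auto simp: power_mult_distrib z_def d_def)
        also have "(\<Sum>j<N l. (sqrt (d j))\<^sup>2) = T"
          using d0 sum_len[of l] by (simp add: d_def)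
        finally show "(\<Sum>j<N l. z j * d j) \<le> sqrt (Q l * T)" .
      qed (use A0 K in auto)
      finally show "norm (\<Sum>j<N l. e (s l j) * (\<sigma> * y l (s l j) - H l (s l (Suc j))) * m' l j) \<le> A * K * sqrt (Q l * T)" .
    qed
    show "(\<lambda>l. A * K * sqrt (Q l * T)) \<longlonglongrightarrow> 0"
      using tendsto_mult_left[OF tendsto_real_sqrt[OF tendsto_mult_right[OF Qlim, of T]], of "A * K"] by simp
  qed
  show ?t3 using tendsto_add[OF t3a t3b] by simp
qed

section \<open>The integrating factor\<close>

lemma simple_process_const:
  assumes "\<And>i. i \<le> n \<Longrightarrow> \<tau> i \<le> a \<or> b \<le> \<tau> i" "a < t" "t \<le> b"
  shows "simple_process n \<tau> \<xi> t \<omega> = simple_process n \<tau> \<xi> b \<omega>"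
  unfolding simple_process_def
proof (intro sum.cong refl arg_cong2[where f="(*)"])
  fix i assume "i \<in> {..<n}"
  then have "\<tau> i \<le> a \<or> b \<le> \<tau> i" "\<tau> (Suc i) \<le> a \<or> b \<le> \<tau> (Suc i)" using assms(1) by auto
  then show "indicator {\<tau> i<..\<tau> (Suc i)} t = (indicator {\<tau> i<..\<tau> (Suc i)} b :: real)"
    using assms(2,3) by (auto simp: indicator_def)
qed

text \<open>No jump time lies strictly between a and b, so each step of the integrand covers the
  whole of \<open>{a<..b}\<close> or misses it.\<close>

lemma simple_integral_increment:
  assumes "\<And>i. i \<le> n \<Longrightarrow> \<tau> i \<le> a \<or> b \<le> \<tau> i" "a < b" "\<And>i. i < n \<Longrightarrow> \<tau> i \<le> \<tau> (Suc i)"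
  shows "simple_integral B n \<tau> \<xi> b \<omega> - simple_integral B n \<tau> \<xi> a \<omega> =
    simple_process n \<tau> \<xi> b \<omega> * (B b \<omega> - B a \<omega>)"
  unfolding simple_integral_def simple_process_def sum_subtractf[symmetric] sum_distrib_right
proof (intro sum.cong refl)
  fix i assume "i \<in> {..<n}"
  then have "\<tau> i \<le> a \<or> b \<le> \<tau> i" "\<tau> (Suc i) \<le> a \<or> b \<le> \<tau> (Suc i)" "\<tau> i \<le> \<tau> (Suc i)" using assms by auto
  then show "\<xi> i \<omega> * (B (min b (\<tau> (Suc i))) \<omega> - B (min b (\<tau> i)) \<omega>) - \<xi> i \<omega> * (B (min a (\<tau> (Suc i))) \<omega> - B (min a (\<tau> i)) \<omega>)
    = \<xi> i \<omega> * indicator {\<tau> i<..\<tau> (Suc i)} b * (B b \<omega> - B a \<omega>)"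
    using assms(2)
    by (cases "\<tau> i \<le> a"; cases "\<tau> (Suc i) \<le> a")
      (simp_all add: indicator_def min_absorb1 min_absorb2 algebra_simps)
qed

lemma simple_integrand_nonneg:
  assumes "simple_integrand M F n \<tau> \<xi>" "i \<le> n"
  shows "0 \<le> \<tau> i"
  using assms(2)
proof (induction i)
  case 0 then show ?case using assms(1) by (simp add: simple_integrand_def)
next
  case (Suc i)
  then have "\<tau> i \<le> \<tau> (Suc i)" using assms(1) by (simp add: simple_integrand_def)
  then show ?case using Suc by simp
qed

lemma simple_process_borel: "(\<lambda>t. simple_process n \<tau> \<xi> t \<omega>) \<in> borel_measurable borel"
  unfolding simple_process_def by measurable

lemma continuous_on_indefinite_integral:
  fixes f :: "real \<Rightarrow> real"
  assumes "\<And>t. 0 \<le> t \<Longrightarrow> set_integrable lborel {0..t} f"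
  shows "continuous_on {0..} (\<lambda>t. LINT r:{0..t}|lborel. f r)"
proof -
  have c: "continuous_on {0..u} (\<lambda>t. LINT r:{0..t}|lborel. f r)" if "0 \<le> u" for u
  proof -
    have "continuous_on {0..u} (\<lambda>t. integral {0..t} f)"
      using set_borel_integral_eq_integral(1)[OF assms[OF that]] by (rule indefinite_integral_continuous_1)
    then show ?thesis
      by (rule continuous_on_eq) (simp add: set_borel_integral_eq_integral(2)[OF assms])
  qed
  show ?thesis
    unfolding continuous_on_eq_continuous_within
  proof
    fix t :: real assume t: "t \<in> {0..}"
    then have "continuous (at t within {0..t + 1}) (\<lambda>t. LINT r:{0..t}|lborel. f r)"
      using c[of "t + 1"] by (auto simp: continuous_on_eq_continuous_within)
    \<comment> \<open>Continuity is local: near t the half-line agrees with a compact interval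
      reaching beyond t.\<close>
    moreover have "at t within {0..t + 1} = at t within {0..}"
      by (rule at_within_nhd[of t "{..<t + 1}"]) auto
    ultimately show "continuous (at t within {0..}) (\<lambda>t. LINT r:{0..t}|lborel. f r)" by simp
  qed
qed

context wiener
begin

text \<open>Only summands with \<open>\<tau> i \<le> a\<close> can be active at time b, so the value
  at the right end of a cell is known at its left end. This makes it an admissible coefficient in
  the Lenglart inequality.\<close>

lemma simple_process_measurable_left:
  assumes "simple_integrand M F n \<tau> \<xi>" "\<And>i. i \<le> n \<Longrightarrow> \<tau> i \<le> a \<or> b \<le> \<tau> i" "a < b"
  shows "simple_process n \<tau> \<xi> b \<in> borel_measurable (F a)"
proof -
  have "(\<lambda>\<omega>. \<Sum>i<n. \<xi> i \<omega> * indicator {\<tau> i<..\<tau> (Suc i)} b) \<in> borel_measurable (F a)"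
  proof (intro borel_measurable_sum)
    fix i assume i: "i \<in> {..<n}"
    show "(\<lambda>\<omega>. \<xi> i \<omega> * indicator {\<tau> i<..\<tau> (Suc i)} b) \<in> borel_measurable (F a)"
    proof (cases "\<tau> i \<le> a")
      case True
      have "\<xi> i \<in> borel_measurable (F (\<tau> i))" using assms(1) i by (simp add: simple_integrand_def)
      from F_measurable_mono[OF this True] show ?thesis by simp
    next
      case False
      then have "b \<le> \<tau> i" using assms(2)[of i] i by auto
      then show ?thesis by simp
    qed
  qed
  then show ?thesis by (simp add: simple_process_def[abs_def])
qed

lemma simple_integral_adapted:
  assumes "simple_integrand M F n \<tau> \<xi>" "0 \<le> t"
  shows "simple_integral W n \<tau> \<xi> t \<in> borel_measurable (F t)"
proof -
  have "(\<lambda>\<omega>. \<Sum>i<n. \<xi> i \<omega> * (W (min t (\<tau> (Suc i))) \<omega> - W (min t (\<tau> i)) \<omega>)) \<in> borel_measurable (F t)"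
  proof (intro borel_measurable_sum)
    fix i assume i: "i \<in> {..<n}"
    show "(\<lambda>\<omega>. \<xi> i \<omega> * (W (min t (\<tau> (Suc i))) \<omega> - W (min t (\<tau> i)) \<omega>)) \<in> borel_measurable (F t)"
    proof (cases "\<tau> i \<le> t")
      case True
      have "\<xi> i \<in> borel_measurable (F (\<tau> i))" using assms(1) i by (simp add: simple_integrand_def)
      then have "\<xi> i \<in> borel_measurable (F t)" using True by (rule F_measurable_mono)
      moreover have "0 \<le> \<tau> i" "0 \<le> \<tau> (Suc i)" using simple_integrand_nonneg[OF assms(1)] i by auto
      ultimately show ?thesis
        using assms(2) by (intro borel_measurable_times borel_measurable_diff W_measurable_F) auto
    next
      case False
      moreover have "\<tau> i \<le> \<tau> (Suc i)" using assms(1) i by (simp add: simple_integrand_def)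
      ultimately show ?thesis by (simp add: min_def)
    qed
  qed
  then show ?thesis by (simp add: simple_integral_def[abs_def])
qed

lemma simple_integral_continuous:
  assumes "simple_integrand M F n \<tau> \<xi>" "\<omega> \<in> space P"
  shows "continuous_on {0..} (\<lambda>t. simple_integral W n \<tau> \<xi> t \<omega>)"
  unfolding simple_integral_def
proof (intro continuous_intros continuous_on_compose2[OF path_continuous[OF assms(2)]])
  fix i assume "i \<in> {..<n}"
  then have "0 \<le> \<tau> i" "0 \<le> \<tau> (Suc i)" using simple_integrand_nonneg[OF assms(1)] by auto
  then show "(\<lambda>t. min t (\<tau> (Suc i))) ` {0..} \<subseteq> {0..}" "(\<lambda>t. min t (\<tau> i)) ` {0..} \<subseteq> {0..}" by auto
qed

lemma simple_integral_0:
  assumes "simple_integrand M F n \<tau> \<xi>"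
  shows "simple_integral W n \<tau> \<xi> 0 \<omega> = 0"
  unfolding simple_integral_def
proof (intro sum.neutral ballI)
  fix i assume "i \<in> {..<n}"
  then have "0 \<le> \<tau> i" "0 \<le> \<tau> (Suc i)" using simple_integrand_nonneg[OF assms] by auto
  then show "\<xi> i \<omega> * (W (min 0 (\<tau> (Suc i))) \<omega> - W (min 0 (\<tau> i)) \<omega>) = 0" by simp
qed

text \<open>As \<^const>\<open>measure\<close> is \<open>0\<close> on non-measurable sets, the limits in probability in
  \<^const>\<open>is_ito_integral\<close> carry information only because the exceptional sets are measurable.\<close>

lemma sup_event:
  fixes f :: "real \<Rightarrow> (real \<Rightarrow> real) \<Rightarrow> real"
  assumes "\<And>t. t \<in> {0..T} \<Longrightarrow> f t \<in> borel_measurable M" "AE \<omega> in M. continuous_on {0..T} (\<lambda>t. f t \<omega>)"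
  shows "{\<omega> \<in> space M. \<exists>t\<in>{0..T}. \<epsilon> < \<bar>f t \<omega>\<bar>} \<in> sets M"
proof -
  \<comment> \<open>By continuity the existence of an exceeding time is decided on a countable dense
    set. The paths without continuity form a null set, which the completed measure absorbs.\<close>
  obtain C :: "real set" where C: "countable C" "C \<subseteq> {0..T}" "{0..T} \<subseteq> closure C"
    using separable[of "{0..T}"] by auto
  have cl: "closure C = {0..T}" using C closure_minimal[OF C(2)] by auto
  have Am: "(\<Union>t\<in>C. {\<omega> \<in> space M. \<epsilon> < \<bar>f t \<omega>\<bar>}) \<in> sets M"
  proof (intro sets.countable_UN'' C(1))
    fix t assume "t \<in> C"
    then have [measurable]: "f t \<in> borel_measurable M" using assms(1) C(2) by auto
    show "{\<omega> \<in> space M. \<epsilon> < \<bar>f t \<omega>\<bar>} \<in> sets M" by measurable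
  qed
  show ?thesis
  proof (rule completion.in_sets_AE[OF _ Am])
    show "AE \<omega> in M. \<omega> \<in> (\<Union>t\<in>C. {\<omega> \<in> space M. \<epsilon> < \<bar>f t \<omega>\<bar>}) \<longleftrightarrow> \<omega> \<in> {\<omega> \<in> space M. \<exists>t\<in>{0..T}. \<epsilon> < \<bar>f t \<omega>\<bar>}"
      using assms(2)
    proof eventually_elim
      case (elim \<omega>)
      have c: "continuous_on (closure C) (\<lambda>t. \<bar>f t \<omega>\<bar>)" unfolding cl using elim by (intro continuous_intros)
      have "\<bar>f t \<omega>\<bar> \<le> \<epsilon>" if "\<And>t. t \<in> C \<Longrightarrow> \<bar>f t \<omega>\<bar> \<le> \<epsilon>" "t \<in> {0..T}" for t
        by (rule continuous_le_on_closure[OF c]) (use that cl in auto)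
      then show ?case using C(2) by (force simp: not_less[symmetric])
    qed
  qed auto
qed

text \<open>Progressive measurability supplies joint measurability in time and scenario, and Tonelli
  does the rest. As with \<open>sup_event\<close>, this is what gives the probabilities in the
  definition of the integral their content.\<close>

lemma L2_event:
  assumes "progressively_measurable F H" "simple_integrand M F n \<tau> \<xi>" "0 \<le> T"
  shows "(\<lambda>\<omega>. \<integral>\<^sup>+s\<in>{0..T}. ennreal ((simple_process n \<tau> \<xi> s \<omega> - H s \<omega>)\<^sup>2) \<partial>lborel) \<in> borel_measurable M"
proof -
  let ?R = "restrict_space lborel {0..T} :: real measure"
  interpret R: sigma_finite_measure ?R
    by (rule sigma_finite_measure_restrict_space) (auto intro: lborel.sigma_finite_measure_axioms)
  have "(\<lambda>(s, \<omega>). H s \<omega>) \<in> borel_measurable (restrict_space borel {0..T} \<Otimes>\<^sub>M F T)"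
    using assms(1,3) by (simp add: progressively_measurable_def)
  also have "borel_measurable (restrict_space borel {0..T} \<Otimes>\<^sub>M F T) = borel_measurable (?R \<Otimes>\<^sub>M F T)"
    by (intro measurable_cong_sets sets_pair_measure_cong) (auto simp: sets_restrict_space)
  finally have "(\<lambda>(\<omega>, s). H s \<omega>) \<in> borel_measurable (F T \<Otimes>\<^sub>M ?R)"
    by (subst measurable_pair_swap_iff) (simp add: split_def)
  \<comment> \<open>\<open>F T\<close> is contained in the completed sigma-algebra, so the identity
    carries joint measurability over from the one to the other.\<close>
  moreover have "(\<lambda>p. (fst p, snd p)) \<in> measurable (M \<Otimes>\<^sub>M ?R) (F T \<Otimes>\<^sub>M ?R)"
  proof (rule measurable_Pair)
    have "(\<lambda>\<omega>. \<omega>) \<in> measurable M (F T)" using sets_F_subset[of T] by (auto simp: measurable_def)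
    then show "(\<lambda>p. fst p) \<in> measurable (M \<Otimes>\<^sub>M ?R) (F T)" by (rule measurable_compose[OF measurable_fst])
  qed simp
  ultimately have H: "(\<lambda>p. H (snd p) (fst p)) \<in> borel_measurable (M \<Otimes>\<^sub>M ?R)"
    using measurable_compose by (fastforce simp: split_def)
  have xi: "\<xi> i \<in> borel_measurable M" if "i < n" for i
    using assms(2) that F_measurable_M by (auto simp: simple_integrand_def)
  have S: "(\<lambda>p. simple_process n \<tau> \<xi> (snd p) (fst p)) \<in> borel_measurable (M \<Otimes>\<^sub>M ?R)"
    unfolding simple_process_def
  proof (intro borel_measurable_sum borel_measurable_times)
    fix i assume "i \<in> {..<n}"
    then show "(\<lambda>p. \<xi> i (fst p)) \<in> borel_measurable (M \<Otimes>\<^sub>M ?R)"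
      using xi by (intro measurable_compose[OF measurable_fst]) auto
    have "(\<lambda>s. s) \<in> measurable ?R borel" by (rule measurable_restrict_space1) simp
    then show "(\<lambda>p. indicator {\<tau> i<..\<tau> (Suc i)} (snd p)) \<in> borel_measurable (M \<Otimes>\<^sub>M ?R)"
      by (intro measurable_compose[OF measurable_compose[OF measurable_snd]] borel_measurable_indicator) auto
  qed
  have "(\<lambda>\<omega>. \<integral>\<^sup>+s. ennreal ((simple_process n \<tau> \<xi> s \<omega> - H s \<omega>)\<^sup>2) \<partial>?R) \<in> borel_measurable M"
    using H S by (intro R.borel_measurable_nn_integral) (simp add: split_def)
  then show ?thesis by (simp add: nn_integral_restrict_space)
qed

section \<open>From convergence in probability to almost sure limits\<close>

lemma tendsto_zero_subsequence:
  fixes p :: "nat \<Rightarrow> nat \<Rightarrow> real"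
  assumes "\<And>l. p l \<longlonglongrightarrow> 0"
  shows "\<exists>\<kappa>. \<forall>l. p l (\<kappa> l) \<le> (1/2)^l"
proof -
  have "\<exists>k. p l k \<le> (1/2)^l" for l
  proof -
    have "\<forall>\<^sub>F k in sequentially. p l k < (1/2)^l" by (rule order_tendstoD(2)[OF assms]) simp
    then show ?thesis by (auto simp: eventually_sequentially intro: less_imp_le)
  qed
  then show ?thesis by metis
qed

text \<open>A subsequence chosen for the horizon T makes the two exceptional probabilities sum to at
  most 2^-l at stage l; Borel-Cantelli then turns convergence in probability into bounds that hold
  eventually on almost every path.\<close>

lemma ito_approximation:
  assumes ito: "is_ito_integral M F W H I" and T: "0 < T"
  shows "\<exists>n \<tau> \<xi>. (\<forall>l. simple_integrand M F (n l) (\<tau> l) (\<xi> l)) \<and>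
    (AE \<omega> in M. \<forall>\<^sub>F l in sequentially.
       (\<forall>t\<in>{0..T}. \<bar>simple_integral W (n l) (\<tau> l) (\<xi> l) t \<omega> - I t \<omega>\<bar> \<le> (1/2)^l) \<and>
       (\<integral>\<^sup>+s\<in>{0..T}. ennreal ((simple_process (n l) (\<tau> l) (\<xi> l) s \<omega> - H s \<omega>)\<^sup>2) \<partial>lborel) \<le> ennreal ((1/2)^l))"
proof -
  have "\<exists>n \<tau> \<xi>. (\<forall>k. simple_integrand M F (n k) (\<tau> k) (\<xi> k)) \<and>
       (\<forall>T\<ge>0. \<forall>\<epsilon>>0.
         (\<lambda>k. measure M {\<omega> \<in> space M. ennreal \<epsilon> <
            (\<integral>\<^sup>+s\<in>{0..T}. ennreal ((simple_process (n k) (\<tau> k) (\<xi> k) s \<omega> - H s \<omega>)\<^sup>2) \<partial>lborel)}) \<longlonglongrightarrow> 0 \<and>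
         (\<lambda>k. measure M {\<omega> \<in> space M. \<exists>t\<in>{0..T}.
            \<epsilon> < \<bar>simple_integral W (n k) (\<tau> k) (\<xi> k) t \<omega> - I t \<omega>\<bar>}) \<longlonglongrightarrow> 0)"
    using ito unfolding is_ito_integral_def by (elim conjE)
  then obtain n \<tau> \<xi> where S': "\<forall>k. simple_integrand M F (n k) (\<tau> k) (\<xi> k)" and
    lim': "\<forall>T\<ge>0. \<forall>\<epsilon>>0.
         (\<lambda>k. measure M {\<omega> \<in> space M. ennreal \<epsilon> <
            (\<integral>\<^sup>+s\<in>{0..T}. ennreal ((simple_process (n k) (\<tau> k) (\<xi> k) s \<omega> - H s \<omega>)\<^sup>2) \<partial>lborel)}) \<longlonglongrightarrow> 0 \<and>
         (\<lambda>k. measure M {\<omega> \<in> space M. \<exists>t\<in>{0..T}.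
            \<epsilon> < \<bar>simple_integral W (n k) (\<tau> k) (\<xi> k) t \<omega> - I t \<omega>\<bar>}) \<longlonglongrightarrow> 0"
    by (elim exE conjE)
  note S = S'[rule_format]
  note lim = lim'[rule_format, OF less_imp_le[OF T], THEN conjunct1] lim'[rule_format, OF less_imp_le[OF T], THEN conjunct2]
  define A where "A \<epsilon> k = {\<omega> \<in> space M. ennreal \<epsilon> <
            (\<integral>\<^sup>+s\<in>{0..T}. ennreal ((simple_process (n k) (\<tau> k) (\<xi> k) s \<omega> - H s \<omega>)\<^sup>2) \<partial>lborel)}" for \<epsilon> k
  define B where "B \<epsilon> k = {\<omega> \<in> space M. \<exists>t\<in>{0..T}. \<epsilon> < \<bar>simple_integral W (n k) (\<tau> k) (\<xi> k) t \<omega> - I t \<omega>\<bar>}" for \<epsilon> k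
  have prog: "progressively_measurable F H" and adI: "adapted F I" and cI: "AE \<omega> in M. continuous_on {0..} (\<lambda>t. I t \<omega>)"
    using ito by (auto simp: is_ito_integral_def continuous_process_def)
  have Am: "A \<epsilon> k \<in> sets M" for \<epsilon> k
  proof -
    note [measurable] = L2_event[OF prog S less_imp_le[OF T], of k]
    show ?thesis unfolding A_def by measurable
  qed
  have Bm: "B \<epsilon> k \<in> sets M" for \<epsilon> k
    unfolding B_def
  proof (rule sup_event)
    fix t assume t: "t \<in> {0..T}"
    show "(\<lambda>\<omega>. simple_integral W (n k) (\<tau> k) (\<xi> k) t \<omega> - I t \<omega>) \<in> borel_measurable M"
    proof (intro borel_measurable_diff)
      show "simple_integral W (n k) (\<tau> k) (\<xi> k) t \<in> borel_measurable M"
        using t by (intro F_measurable_M[OF simple_integral_adapted[OF S]]) simp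
      have "I t \<in> borel_measurable (F t)" using adI t by (simp add: adapted_def)
      then show "I t \<in> borel_measurable M" by (rule F_measurable_M)
    qed
  next
    show "AE \<omega> in M. continuous_on {0..T} (\<lambda>t. simple_integral W (n k) (\<tau> k) (\<xi> k) t \<omega> - I t \<omega>)"
      using cI AE_space
    proof eventually_elim
      case (elim \<omega>)
      then have "continuous_on {0..} (\<lambda>t. simple_integral W (n k) (\<tau> k) (\<xi> k) t \<omega> - I t \<omega>)"
        using simple_integral_continuous[OF S] by (intro continuous_on_diff) auto
      then show ?case by (rule continuous_on_subset) auto
    qed
  qed
  have "(\<lambda>k. measure M (A \<epsilon> k) + measure M (B \<epsilon> k)) \<longlonglongrightarrow> 0" if "0 < \<epsilon>" for \<epsilon>
    using tendsto_add[OF lim(1)[OF that] lim(2)[OF that]] by (simp add: A_def B_def)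
  then obtain \<kappa> where \<kappa>: "\<And>l. measure M (A ((1/2)^l) (\<kappa> l)) + measure M (B ((1/2)^l) (\<kappa> l)) \<le> (1/2)^l"
    using tendsto_zero_subsequence[of "\<lambda>l k. measure M (A ((1/2)^l) k) + measure M (B ((1/2)^l) k)"] by auto
  define C where "C l = A ((1/2)^l) (\<kappa> l) \<union> B ((1/2)^l) (\<kappa> l)" for l
  have Cm: "C l \<in> sets M" for l using Am Bm by (simp add: C_def)
  have "AE \<omega> in M. \<forall>\<^sub>F l in sequentially. \<omega> \<in> space M - C l"
  proof (rule borel_cantelli_AE1[OF Cm])
    show "emeasure M (C l) < \<infinity>" for l
      using M.emeasure_eq_measure[of "C l"] by (metis ennreal_less_top infinity_ennreal_def)
    show "summable (\<lambda>l. measure M (C l))"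
    proof (rule summable_comparison_test'[of "\<lambda>l. (1/2::real)^l"])
      show "summable (\<lambda>l. (1/2::real)^l)" by (simp add: summable_geometric)
      fix l
      have "measure M (C l) \<le> measure M (A ((1/2)^l) (\<kappa> l)) + measure M (B ((1/2)^l) (\<kappa> l))"
        unfolding C_def by (rule measure_Un_le[OF Am Bm])
      then show "norm (measure M (C l)) \<le> (1/2)^l" using \<kappa>[of l] by simp
    qed
  qed
  then have "AE \<omega> in M. \<forall>\<^sub>F l in sequentially.
       (\<forall>t\<in>{0..T}. \<bar>simple_integral W (n (\<kappa> l)) (\<tau> (\<kappa> l)) (\<xi> (\<kappa> l)) t \<omega> - I t \<omega>\<bar> \<le> (1/2)^l) \<and>
       (\<integral>\<^sup>+s\<in>{0..T}. ennreal ((simple_process (n (\<kappa> l)) (\<tau> (\<kappa> l)) (\<xi> (\<kappa> l)) s \<omega> - H s \<omega>)\<^sup>2) \<partial>lborel) \<le> ennreal ((1/2)^l)"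
  proof eventually_elim
    case (elim \<omega>)
    then show ?case
      by eventually_elim (auto simp: C_def A_def B_def not_less)
  qed
  then show ?thesis
    using S by (intro exI[of _ "\<lambda>l. n (\<kappa> l)"] exI[of _ "\<lambda>l. \<tau> (\<kappa> l)"] exI[of _ "\<lambda>l. \<xi> (\<kappa> l)"]) auto
qed

text \<open>The variance bounds tend to 0 almost surely, so the probability of passing a given level
  tends to 0, and the Lenglart inequality leaves only the square root of that level.\<close>

lemma lenglart_limit:
  fixes s v :: "nat \<Rightarrow> nat \<Rightarrow> real" and u :: "nat \<Rightarrow> nat \<Rightarrow> (real \<Rightarrow> real) \<Rightarrow> real" and g :: "nat \<Rightarrow> nat \<Rightarrow> real \<Rightarrow> real"
  assumes p: "\<And>l. partition_of T (n l) (s l)"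
    and u: "\<And>l j. j < n l \<Longrightarrow> u l j \<in> borel_measurable (F (s l j))"
    and g: "\<And>l j. j < n l \<Longrightarrow> g l j \<in> borel_measurable borel"
    and g1: "\<And>l j. j < n l \<Longrightarrow> has_bochner_integral M (\<lambda>\<omega>. g l j (incr (s l j) (s l (Suc j)) \<omega>)) (m l j)"
    and g2: "\<And>l j. j < n l \<Longrightarrow> has_bochner_integral M (\<lambda>\<omega>. (g l j (incr (s l j) (s l (Suc j)) \<omega>))\<^sup>2) (r l j)"
    and gv: "\<And>l j. j < n l \<Longrightarrow> r l j \<le> v l j"
    and v: "\<And>l j. j < n l \<Longrightarrow> 0 < v l j"
    and lim: "AE \<omega> in M. (\<lambda>l. \<Sum>j<n l. (u l j \<omega>)\<^sup>2 * v l j) \<longlonglongrightarrow> 0"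
  shows "(\<lambda>l. M.expectation (\<lambda>\<omega>. min 1 \<bar>\<Sum>j<n l. u l j \<omega> * (g l j (incr (s l j) (s l (Suc j)) \<omega>) - m l j)\<bar>)) \<longlonglongrightarrow> 0"
    (is "?E \<longlonglongrightarrow> 0")
proof (rule tendstoI)
  fix \<epsilon> :: real assume \<epsilon>: "0 < \<epsilon>"
  define \<delta> where "\<delta> = (\<epsilon> / 2)\<^sup>2"
  have \<delta>: "0 < \<delta>" "sqrt \<delta> = \<epsilon> / 2" using \<epsilon> by (auto simp: \<delta>_def)
  define A where "A l = {\<omega> \<in> space M. \<delta> < (\<Sum>j<n l. (u l j \<omega>)\<^sup>2 * v l j)}" for l
  have uM: "u l j \<in> borel_measurable M" if "j < n l" for l j using F_measurable_M u that by auto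
  have vm: "(\<lambda>\<omega>. \<Sum>j<n l. (u l j \<omega>)\<^sup>2 * v l j) \<in> borel_measurable M" for l
    using uM by (intro borel_measurable_sum borel_measurable_times borel_measurable_power) auto
  have Am: "A l \<in> sets M" for l
    using vm[of l] unfolding A_def by measurable
  have bd: "?E l \<le> M.prob (A l) + \<epsilon> / 2" for l
  proof -
    have "?E l \<le> M.prob (A l) + sqrt \<delta>"
      unfolding A_def
    proof (rule discrete_lenglart[where g="\<lambda>j x. g l j x - m l j"])
      show "0 \<le> s l 0" using p[of l] by (simp add: partition_of_def)
      fix j assume j: "j < n l"
      show "s l j < s l (Suc j)" using p[of l] j by (simp add: partition_of_def)
      show "u l j \<in> borel_measurable (F (s l j))" by (rule u[OF j])
      show "(\<lambda>x. g l j x - m l j) \<in> borel_measurable borel" using g[OF j] by simp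
      note c = centered_second_moment[OF g1[OF j] g2[OF j]]
      show "integrable M (\<lambda>\<omega>. g l j (incr (s l j) (s l (Suc j)) \<omega>) - m l j)"
        "M.expectation (\<lambda>\<omega>. g l j (incr (s l j) (s l (Suc j)) \<omega>) - m l j) = 0"
        "integrable M (\<lambda>\<omega>. (g l j (incr (s l j) (s l (Suc j)) \<omega>) - m l j)\<^sup>2)"
        using c by (auto simp: has_bochner_integral_iff)
      have "M.expectation (\<lambda>\<omega>. (g l j (incr (s l j) (s l (Suc j)) \<omega>) - m l j)\<^sup>2) = r l j - (m l j)\<^sup>2"
        using c(2) by (simp add: has_bochner_integral_iff)
      then show "M.expectation (\<lambda>\<omega>. (g l j (incr (s l j) (s l (Suc j)) \<omega>) - m l j)\<^sup>2) \<le> v l j"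
        using gv[OF j] zero_le_power2[of "m l j"] by linarith
    qed (use v \<delta> in auto)
    then show ?thesis using \<delta> by simp
  qed
  \<comment> \<open>Almost every scenario lies in only finitely many of the events, so dominated
    convergence applies to their indicators.\<close>
  have "(\<lambda>l. M.expectation (indicator (A l) :: _ \<Rightarrow> real)) \<longlonglongrightarrow> M.expectation (\<lambda>_. 0)"
  proof (rule integral_dominated_convergence[where w="\<lambda>_. 1"])
    show "AE \<omega> in M. (\<lambda>l. indicator (A l) \<omega> :: real) \<longlonglongrightarrow> 0"
      using lim
    proof eventually_elim
      case (elim \<omega>)
      have "\<forall>\<^sub>F l in sequentially. (\<Sum>j<n l. (u l j \<omega>)\<^sup>2 * v l j) < \<delta>"
        using elim \<delta>(1) by (rule order_tendstoD(2))
      then have "\<forall>\<^sub>F l in sequentially. indicator (A l) \<omega> = (0::real)"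
        by eventually_elim (auto simp: A_def indicator_def)
      then show ?case by (rule tendsto_eventually)
    qed
  qed (use Am in \<open>auto simp: indicator_def\<close>)
  moreover have "A l \<inter> space M = A l" for l by (auto simp: A_def)
  ultimately have "(\<lambda>l. M.prob (A l)) \<longlonglongrightarrow> 0" by simp
  then have "\<forall>\<^sub>F l in sequentially. M.prob (A l) < \<epsilon> / 2" by (rule order_tendstoD(2)) (use \<epsilon> in simp)
  then show "\<forall>\<^sub>F l in sequentially. dist (?E l) 0 < \<epsilon>"
  proof eventually_elim
    case (elim l)
    have "0 \<le> ?E l" by (intro integral_nonneg_AE) auto
    then show ?case using bd[of l] elim by (simp add: dist_real_def)
  qed
qed

text \<open>The expectation of \<open>min 1\<close> of the absolute value metrizes convergence in
  probability. In this sense the sums tend to 0, while almost surely they tend to R, so the two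
  limits must agree.\<close>

lemma AE_zero_of_limits:
  fixes S S' :: "nat \<Rightarrow> (real \<Rightarrow> real) \<Rightarrow> real" and R :: "(real \<Rightarrow> real) \<Rightarrow> real"
  assumes m: "\<And>l. S l \<in> borel_measurable M" "\<And>l. S' l \<in> borel_measurable M" "R \<in> borel_measurable M"
    and 0: "(\<lambda>l. M.expectation (\<lambda>\<omega>. min 1 \<bar>S l \<omega>\<bar>)) \<longlonglongrightarrow> 0" "(\<lambda>l. M.expectation (\<lambda>\<omega>. min 1 \<bar>S' l \<omega>\<bar>)) \<longlonglongrightarrow> 0"
    and R: "AE \<omega> in M. (\<lambda>l. S l \<omega> + S' l \<omega>) \<longlonglongrightarrow> R \<omega>"
  shows "AE \<omega> in M. R \<omega> = 0"
proof -
  note [measurable] = m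
  have i: "integrable M (\<lambda>\<omega>. min 1 \<bar>f \<omega>\<bar>)" if "f \<in> borel_measurable M" for f :: "_ \<Rightarrow> real"
    using that by (intro M.integrable_const_bound[where B=1]) auto
  have "(\<lambda>l. M.expectation (\<lambda>\<omega>. min 1 \<bar>S l \<omega> + S' l \<omega>\<bar>)) \<longlonglongrightarrow> M.expectation (\<lambda>\<omega>. min 1 \<bar>R \<omega>\<bar>)"
  proof (rule integral_dominated_convergence[where w="\<lambda>_. 1"])
    show "AE \<omega> in M. (\<lambda>l. min 1 \<bar>S l \<omega> + S' l \<omega>\<bar>) \<longlonglongrightarrow> min 1 \<bar>R \<omega>\<bar>"
      using R by eventually_elim (intro tendsto_intros)
  qed auto
  moreover have "M.expectation (\<lambda>\<omega>. min 1 \<bar>S l \<omega> + S' l \<omega>\<bar>) \<le>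
      M.expectation (\<lambda>\<omega>. min 1 \<bar>S l \<omega>\<bar>) + M.expectation (\<lambda>\<omega>. min 1 \<bar>S' l \<omega>\<bar>)" for l
    using m by (subst Bochner_Integration.integral_add[symmetric]) (auto intro!: i integral_mono)
  moreover have "(\<lambda>l. M.expectation (\<lambda>\<omega>. min 1 \<bar>S l \<omega>\<bar>) + M.expectation (\<lambda>\<omega>. min 1 \<bar>S' l \<omega>\<bar>)) \<longlonglongrightarrow> 0"
    using tendsto_add[OF 0] by simp
  ultimately have "M.expectation (\<lambda>\<omega>. min 1 \<bar>R \<omega>\<bar>) \<le> 0"
    by (intro LIMSEQ_le) auto
  moreover have "0 \<le> M.expectation (\<lambda>\<omega>. min 1 \<bar>R \<omega>\<bar>)" by (intro integral_nonneg_AE) auto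
  ultimately have "M.expectation (\<lambda>\<omega>. min 1 \<bar>R \<omega>\<bar>) = 0" by simp
  then have "AE \<omega> in M. min 1 \<bar>R \<omega>\<bar> = 0"
    using i[OF m(3)] by (subst (asm) integral_nonneg_eq_0_iff_AE) auto
  then show ?thesis by eventually_elim (auto simp: min_def split: if_splits)
qed

section \<open>The product rule for the solution times \<open>E\<close>\<close>

definition E :: "real \<Rightarrow> real \<Rightarrow> (real \<Rightarrow> real) \<Rightarrow> real" where
  "E \<sigma> t \<omega> = exp (\<sigma> * W t \<omega> + \<sigma>\<^sup>2 * t / 2)"

lemma E_increment: "E \<sigma> t \<omega> = E \<sigma> s \<omega> * rho \<sigma> (t - s) (incr s t \<omega>)"
  unfolding E_def rho_def exp_add[symmetric] by (simp add: field_simps)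

lemma E_continuous: "\<omega> \<in> space P \<Longrightarrow> continuous_on {0..} (\<lambda>t. E \<sigma> t \<omega>)"
  unfolding E_def by (intro continuous_intros path_continuous) auto

text \<open>With \<open>y = B - I\<^sup>l\<close> for a simple integral \<open>I\<^sup>l\<close> of an integrand close to \<open>\<sigma> X\<close>, the increments of
  \<open>y E\<close> along a partition split into those of \<open>B\<close> and two martingale-difference terms whose
  conditional moments are given by \<open>rho_moments\<close>.\<close>

lemma product_increment:
  fixes y0 y1 b0 b1 e k d \<sigma> r :: real
  assumes "y1 - y0 = (b1 - b0) - k * d"
  shows "y1 * (e * r) - y0 * e - (e * r) * (b1 - b0) =
    e * y0 * (r - 1 - \<sigma> * r * d) + e * (\<sigma> * y0 - k) * (r * d)"
proof -
  have y1: "y1 = y0 + (b1 - b0) - k * d" using assms by simp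
  show ?thesis unfolding y1 by (simp add: algebra_simps)
qed

text \<open>\<open>Y l\<close> is the solution with \<open>I\<close> replaced by a simple integral,
  so on a cell its noise is a known coefficient times a Gaussian increment. The increments of
  \<open>Y l * E\<close> add up to a Riemann sum for the drift, the sum \<open>c\<close> of the
  means and two centred sums \<open>V\<close> and \<open>V'\<close>. Here \<open>c\<close> tends to
  0 almost surely and the centred sums tend to 0 in probability.\<close>

lemma integrating_factor_at:
  fixes b :: "real \<Rightarrow> (real \<Rightarrow> real) \<Rightarrow> real"
  assumes \<sigma>: "0 < \<sigma>" and T: "0 < T" and adX: "adapted F X" and cX: "continuous_process M X"
    and ito: "is_ito_integral M F W (\<lambda>t \<omega>. \<sigma> * X t \<omega>) I"
    and eq: "AE \<omega> in M. \<forall>t\<ge>0. set_integrable lborel {0..t} (\<lambda>s. b s \<omega>) \<and>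
       X t \<omega> = x + (LINT s:{0..t}|lborel. b s \<omega>) - I t \<omega>"
  shows "AE \<omega> in M. X T \<omega> * E \<sigma> T \<omega> = x + (LINT s:{0..T}|lborel. E \<sigma> s \<omega> * b s \<omega>)"
proof -
  obtain n \<tau> \<xi> where S: "\<And>l. simple_integrand M F (n l) (\<tau> l) (\<xi> l)" and
    appr: "AE \<omega> in M. \<forall>\<^sub>F l in sequentially.
       (\<forall>t\<in>{0..T}. \<bar>simple_integral W (n l) (\<tau> l) (\<xi> l) t \<omega> - I t \<omega>\<bar> \<le> (1/2)^l) \<and>
       (\<integral>\<^sup>+s\<in>{0..T}. ennreal ((simple_process (n l) (\<tau> l) (\<xi> l) s \<omega> - \<sigma> * X s \<omega>)\<^sup>2) \<partial>lborel) \<le> ennreal ((1/2)^l)"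
    using ito_approximation[OF ito T] by blast
  define J where "J l t \<omega> = simple_integral W (n l) (\<tau> l) (\<xi> l) t \<omega>" for l t \<omega>
  define H where "H l t \<omega> = simple_process (n l) (\<tau> l) (\<xi> l) t \<omega>" for l t \<omega>
  \<comment> \<open>By the equation this is the absolutely continuous part
    \<open>x + LINT b\<close>. Written through X and I it is adapted at once, while b is given only
    path by path.\<close>
  define B where "B t \<omega> = X t \<omega> + I t \<omega>" for t \<omega>
  define Y where "Y l t \<omega> = B t \<omega> - J l t \<omega>" for l t \<omega>
  define h where "h l = 1 / (real l + 1)" for l
  have h0: "0 < h l" for l by (simp add: h_def)
  have hlim: "h \<longlonglongrightarrow> 0"
    using LIMSEQ_inverse_real_of_nat unfolding h_def by (simp add: inverse_eq_divide add.commute)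
  have "\<exists>N s. partition_of T N s \<and> (\<forall>j<N. s (Suc j) - s j \<le> h l) \<and> (\<forall>j<N. \<tau> l ` {..n l} \<inter> {s j<..<s (Suc j)} = {})" for l
    by (rule exists_fine_partition[OF T h0]) simp
  then obtain N s where p: "\<And>l. partition_of T (N l) (s l)" and mesh: "\<And>l j. j < N l \<Longrightarrow> s l (Suc j) - s l j \<le> h l"
    and sep: "\<And>l j. j < N l \<Longrightarrow> \<tau> l ` {..n l} \<inter> {s l j<..<s l (Suc j)} = {}"
    by metis
  have sep': "\<tau> l i \<le> s l j \<or> s l (Suc j) \<le> \<tau> l i" if "j < N l" "i \<le> n l" for l j i
    using sep[OF that(1)] that(2) by (force simp: disjoint_iff)
  have bd: "0 \<le> s l j" "s l j < s l (Suc j)" "s l (Suc j) \<le> T" if "j < N l" for l j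
    using partition_of_bounds[OF p] p[of l] that by (auto simp: Suc_leI partition_of_def)
  define K where "K = mom_const \<sigma> T"
  have K: "0 < K" using \<sigma> T by (auto simp: K_def mom_const_def intro!: mult_pos_pos add_nonneg_pos add_pos_nonneg)
  define \<phi> where "\<phi> l j z = rho \<sigma> (s l (Suc j) - s l j) z - 1 - \<sigma> * rho \<sigma> (s l (Suc j) - s l j) z * z" for l j z
  define \<psi> where "\<psi> l j z = rho \<sigma> (s l (Suc j) - s l j) z * z" for l j z
  have rhom: "rho \<sigma> d \<in> borel_measurable borel" for d
    unfolding rho_def[abs_def] by measurable
  have \<phi>m: "\<phi> l j \<in> borel_measurable borel" "\<psi> l j \<in> borel_measurable borel" for l j
    using rhom unfolding \<phi>_def[abs_def] \<psi>_def[abs_def] by measurable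
  have len: "s l (Suc j) - s l j \<le> T" if "j < N l" for l j using bd[OF that] by linarith
  note mom = rho_moments[OF \<sigma> bd(1,2) len, folded K_def]
  \<comment> \<open>\<open>rho_moments\<close> only asserts that suitable numbers exist;
    expectations name them for all l and j.\<close>
  define m where "m l j = M.expectation (\<lambda>\<omega>. \<phi> l j (incr (s l j) (s l (Suc j)) \<omega>))" for l j
  define r where "r l j = M.expectation (\<lambda>\<omega>. (\<phi> l j (incr (s l j) (s l (Suc j)) \<omega>))\<^sup>2)" for l j
  have m: "has_bochner_integral M (\<lambda>\<omega>. \<phi> l j (incr (s l j) (s l (Suc j)) \<omega>)) (m l j)"
     "has_bochner_integral M (\<lambda>\<omega>. (\<phi> l j (incr (s l j) (s l (Suc j)) \<omega>))\<^sup>2) (r l j)"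
     "\<bar>m l j\<bar> \<le> K * (s l (Suc j) - s l j)\<^sup>2" "r l j \<le> K * (s l (Suc j) - s l j)\<^sup>2" if "j < N l" for l j
    using mom(1)[OF that that that, folded \<phi>_def] unfolding m_def r_def
    by (auto simp: has_bochner_integral_iff)
  define m' where "m' l j = M.expectation (\<lambda>\<omega>. \<psi> l j (incr (s l j) (s l (Suc j)) \<omega>))" for l j
  define r' where "r' l j = M.expectation (\<lambda>\<omega>. (\<psi> l j (incr (s l j) (s l (Suc j)) \<omega>))\<^sup>2)" for l j
  have m': "has_bochner_integral M (\<lambda>\<omega>. \<psi> l j (incr (s l j) (s l (Suc j)) \<omega>)) (m' l j)"
     "has_bochner_integral M (\<lambda>\<omega>. (\<psi> l j (incr (s l j) (s l (Suc j)) \<omega>))\<^sup>2) (r' l j)"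
     "\<bar>m' l j\<bar> \<le> K * (s l (Suc j) - s l j)" "r' l j \<le> K * (s l (Suc j) - s l j)" if "j < N l" for l j
    using mom(2)[OF that that that, folded \<psi>_def] unfolding m'_def r'_def
    by (auto simp: has_bochner_integral_iff)
  define u where "u l j \<omega> = E \<sigma> (s l j) \<omega> * Y l (s l j) \<omega>" for l j \<omega>
  define u' where "u' l j \<omega> = E \<sigma> (s l j) \<omega> * (\<sigma> * Y l (s l j) \<omega> - H l (s l (Suc j)) \<omega>)" for l j \<omega>
  have adI: "adapted F I" and cI: "continuous_process M I" using ito by (auto simp: is_ito_integral_def)
  have Em: "E \<sigma> t \<in> borel_measurable (F t)" if "0 \<le> t" for t
  proof -
    have [measurable]: "W t \<in> borel_measurable (F t)" using that by (intro W_measurable_F) auto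
    show ?thesis unfolding E_def[abs_def] by measurable
  qed
  have Bm: "B t \<in> borel_measurable (F t)" if "0 \<le> t" for t
    using adX adI that unfolding B_def[abs_def] adapted_def by (intro borel_measurable_add) auto
  have Ym: "Y l t \<in> borel_measurable (F t)" if "0 \<le> t" for l t
  proof -
    have "J l t \<in> borel_measurable (F t)"
      using simple_integral_adapted[OF S that] unfolding J_def[abs_def] .
    then show ?thesis using Bm[OF that] unfolding Y_def[abs_def] by (intro borel_measurable_diff)
  qed
  have um: "u l j \<in> borel_measurable (F (s l j))" if "j < N l" for l j
    using Em Ym bd(1)[OF that] unfolding u_def[abs_def] by (intro borel_measurable_times)
  have u'm: "u' l j \<in> borel_measurable (F (s l j))" if "j < N l" for l j
  proof -
    have "H l (s l (Suc j)) \<in> borel_measurable (F (s l j))"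
      unfolding H_def[abs_def]
      by (rule simple_process_measurable_left[OF S sep'[OF that] bd(2)[OF that]])
    then show ?thesis
      using Em[OF bd(1)[OF that]] Ym[OF bd(1)[OF that]] unfolding u'_def[abs_def]
      by (intro borel_measurable_times borel_measurable_diff) auto
  qed
  have incm: "incr a c \<in> borel_measurable M" if "0 \<le> a" "0 \<le> c" for a c
    using W_measurable that by (intro borel_measurable_diff) auto
  have paths: "AE \<omega> in M. \<omega> \<in> space P \<and> continuous_on {0..T} (\<lambda>t. X t \<omega>) \<and> continuous_on {0..T} (\<lambda>t. E \<sigma> t \<omega>) \<and>
     (\<forall>\<^sub>F l in sequentially. \<forall>t\<in>{0..T}. \<bar>Y l t \<omega> - X t \<omega>\<bar> \<le> (1/2)^l) \<and>
     (\<forall>\<^sub>F l in sequentially. (\<integral>\<^sup>+t\<in>{0..T}. ennreal ((H l t \<omega> - \<sigma> * X t \<omega>)\<^sup>2) \<partial>lborel) \<le> ennreal ((1/2)^l))"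
    using appr cX[unfolded continuous_process_def] AE_space
  proof eventually_elim
    case (elim \<omega>)
    have sub: "{0..T} \<subseteq> {0..}" by auto
    have "continuous_on {0..T} (\<lambda>t. X t \<omega>)" "continuous_on {0..T} (\<lambda>t. E \<sigma> t \<omega>)"
      using continuous_on_subset[OF elim(2) sub] continuous_on_subset[OF E_continuous sub, of \<omega> \<sigma>] elim(3) by auto
    moreover have "\<forall>\<^sub>F l in sequentially. \<forall>t\<in>{0..T}. \<bar>Y l t \<omega> - X t \<omega>\<bar> \<le> (1/2)^l"
      using elim(1)
    proof eventually_elim
      case (elim l)
      have "\<bar>Y l t \<omega> - X t \<omega>\<bar> = \<bar>simple_integral W (n l) (\<tau> l) (\<xi> l) t \<omega> - I t \<omega>\<bar>" for t
        by (simp add: Y_def B_def J_def)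
      then show ?case using elim by simp
    qed
    moreover have "\<forall>\<^sub>F l in sequentially. (\<integral>\<^sup>+t\<in>{0..T}. ennreal ((H l t \<omega> - \<sigma> * X t \<omega>)\<^sup>2) \<partial>lborel) \<le> ennreal ((1/2)^l)"
      using elim(1) by eventually_elim (simp add: H_def)
    ultimately show ?case using elim(3) by simp
  qed
  \<comment> \<open>What centring takes out of the two sums. It carries no martingale structure and
    has to vanish pathwise.\<close>
  define c where "c l \<omega> = (\<Sum>j<N l. u l j \<omega> * m l j) + (\<Sum>j<N l. u' l j \<omega> * m' l j)" for l \<omega>
  have lims: "AE \<omega> in M. (\<lambda>l. \<Sum>j<N l. (u l j \<omega>)\<^sup>2 * (K * (s l (Suc j) - s l j)\<^sup>2)) \<longlonglongrightarrow> 0 \<and>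
      (\<lambda>l. \<Sum>j<N l. (u' l j \<omega>)\<^sup>2 * (K * (s l (Suc j) - s l j))) \<longlonglongrightarrow> 0 \<and> (\<lambda>l. c l \<omega>) \<longlonglongrightarrow> 0"
    using paths
  proof eventually_elim
    case (elim \<omega>)
    have Hc: "H l t \<omega> = H l (s l (Suc j)) \<omega>" if "j < N l" "s l j < t" "t \<le> s l (Suc j)" for l j t
      unfolding H_def by (rule simple_process_const[OF sep'[OF that(1)] that(2,3)])
    have Hb: "(\<lambda>t. H l t \<omega>) \<in> borel_measurable borel" for l unfolding H_def by (rule simple_process_borel)
    note L = step_approximation_limits[where e="\<lambda>t. E \<sigma> t \<omega>" and x="\<lambda>t. X t \<omega>" and y="\<lambda>l t. Y l t \<omega>" and H="\<lambda>l t. H l t \<omega>",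
        OF T \<sigma> less_imp_le[OF K] _ _ p mesh hlim _ Hc Hb _ m(3) m'(3)]
    show ?case
      unfolding u_def u'_def c_def using elim by (intro conjI L) auto
  qed
  define V where "V l \<omega> = (\<Sum>j<N l. u l j \<omega> * (\<phi> l j (incr (s l j) (s l (Suc j)) \<omega>) - m l j))" for l \<omega>
  define V' where "V' l \<omega> = (\<Sum>j<N l. u' l j \<omega> * (\<psi> l j (incr (s l j) (s l (Suc j)) \<omega>) - m' l j))" for l \<omega>
  have V0: "(\<lambda>l. M.expectation (\<lambda>\<omega>. min 1 \<bar>V l \<omega>\<bar>)) \<longlonglongrightarrow> 0"
    unfolding V_def
  proof (rule lenglart_limit[OF p um \<phi>m(1) m(1,2,4)])
    show "0 < K * (s l (Suc j) - s l j)\<^sup>2" if "j < N l" for l j using K bd[OF that] by simp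
    show "AE \<omega> in M. (\<lambda>l. \<Sum>j<N l. (u l j \<omega>)\<^sup>2 * (K * (s l (Suc j) - s l j)\<^sup>2)) \<longlonglongrightarrow> 0"
      using lims by eventually_elim simp
  qed
  have V'0: "(\<lambda>l. M.expectation (\<lambda>\<omega>. min 1 \<bar>V' l \<omega>\<bar>)) \<longlonglongrightarrow> 0"
    unfolding V'_def
  proof (rule lenglart_limit[OF p u'm \<phi>m(2) m'(1,2,4)])
    show "0 < K * (s l (Suc j) - s l j)" if "j < N l" for l j using K bd[OF that] by simp
    show "AE \<omega> in M. (\<lambda>l. \<Sum>j<N l. (u' l j \<omega>)\<^sup>2 * (K * (s l (Suc j) - s l j))) \<longlonglongrightarrow> 0"
      using lims by eventually_elim simp
  qed
  define D where "D l \<omega> = (\<Sum>j<N l. E \<sigma> (s l (Suc j)) \<omega> * (B (s l (Suc j)) \<omega> - B (s l j) \<omega>))" for l \<omega>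
  \<comment> \<open>Telescoping of \<open>Y l * E\<close> over the cells, with each increment split
    by \<open>product_increment\<close> and the means moved into c.\<close>
  have ident: "V l \<omega> + V' l \<omega> = Y l T \<omega> * E \<sigma> T \<omega> - Y l 0 \<omega> - D l \<omega> - c l \<omega>" if \<omega>: "\<omega> \<in> space P" for l \<omega>
  proof -
    define G where "G j = Y l (s l j) \<omega> * E \<sigma> (s l j) \<omega>" for j
    have step: "G (Suc j) - G j - E \<sigma> (s l (Suc j)) \<omega> * (B (s l (Suc j)) \<omega> - B (s l j) \<omega>) =
       u l j \<omega> * \<phi> l j (incr (s l j) (s l (Suc j)) \<omega>) + u' l j \<omega> * \<psi> l j (incr (s l j) (s l (Suc j)) \<omega>)" if "j < N l" for j
    proof -
      have "J l (s l (Suc j)) \<omega> - J l (s l j) \<omega> = H l (s l (Suc j)) \<omega> * incr (s l j) (s l (Suc j)) \<omega>"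
        unfolding J_def H_def using S[of l]
        by (intro simple_integral_increment[OF sep'[OF that] bd(2)[OF that]]) (auto simp: simple_integrand_def)
      then have "Y l (s l (Suc j)) \<omega> - Y l (s l j) \<omega> = (B (s l (Suc j)) \<omega> - B (s l j) \<omega>)
          - H l (s l (Suc j)) \<omega> * incr (s l j) (s l (Suc j)) \<omega>"
        by (simp add: Y_def)
      from product_increment[OF this, of "E \<sigma> (s l j) \<omega>" "rho \<sigma> (s l (Suc j) - s l j) (incr (s l j) (s l (Suc j)) \<omega>)" \<sigma>]
      show ?thesis
        unfolding G_def u_def u'_def \<phi>_def \<psi>_def E_increment[of \<sigma> "s l (Suc j)" \<omega> "s l j", symmetric] by (simp add: mult_ac)
    qed
    have "V l \<omega> + V' l \<omega> + c l \<omega> = (\<Sum>j<N l. u l j \<omega> * \<phi> l j (incr (s l j) (s l (Suc j)) \<omega>) + u' l j \<omega> * \<psi> l j (incr (s l j) (s l (Suc j)) \<omega>))"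
      unfolding V_def V'_def c_def sum.distrib[symmetric] by (intro sum.cong) (simp_all add: algebra_simps)
    also have "\<dots> = (\<Sum>j<N l. (G (Suc j) - G j) - E \<sigma> (s l (Suc j)) \<omega> * (B (s l (Suc j)) \<omega> - B (s l j) \<omega>))"
      using step by (intro sum.cong) auto
    also have "\<dots> = G (N l) - G 0 - D l \<omega>"
      using sum_lessThan_telescope[of G "N l"] by (simp add: sum_subtractf D_def)
    finally have "V l \<omega> + V' l \<omega> + c l \<omega> = G (N l) - G 0 - D l \<omega>" .
    moreover have "G (N l) = Y l T \<omega> * E \<sigma> T \<omega>" "G 0 = Y l 0 \<omega>"
      using p[of l] path_zero[OF \<omega>] by (auto simp: G_def partition_of_def E_def)
    ultimately show ?thesis by simp
  qed
  \<comment> \<open>The defect in the claimed identity; it is identified as the almost sure limit of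
    the centred sums.\<close>
  define L where "L \<omega> = X T \<omega> * E \<sigma> T \<omega> - x - (LINT t:{0..T}|lborel. E \<sigma> t \<omega> * b t \<omega>)" for \<omega>
  have conv: "AE \<omega> in M. (\<lambda>l. V l \<omega> + V' l \<omega>) \<longlonglongrightarrow> L \<omega>"
    using paths lims eq
  proof eventually_elim
    case (elim \<omega>)
    have \<omega>: "\<omega> \<in> space P" using elim(1) by simp
    have BB: "B t \<omega> = x + (LINT r:{0..t}|lborel. b r \<omega>)" if "0 \<le> t" for t using elim(3) that by (simp add: B_def)
    have D: "(\<lambda>l. D l \<omega>) \<longlonglongrightarrow> (LINT t:{0..T}|lborel. E \<sigma> t \<omega> * b t \<omega>)"
      unfolding D_def
    proof (rule riemann_sum_limit[OF _ _ _ p mesh hlim])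
      show "continuous_on {0..T} (\<lambda>t. E \<sigma> t \<omega>)" using elim(1) by simp
      show "set_integrable lborel {0..T} (\<lambda>t. b t \<omega>)" using elim(3) T by simp
      show "B t \<omega> = x + (LINT r:{0..t}|lborel. b r \<omega>)" if "0 \<le> t" "t \<le> T" for t by (rule BB[OF that(1)])
    qed
    have YT: "(\<lambda>l. Y l T \<omega>) \<longlonglongrightarrow> X T \<omega>"
    proof (rule LIM_zero_cancel, rule Lim_null_comparison)
      show "\<forall>\<^sub>F l in sequentially. norm (Y l T \<omega> - X T \<omega>) \<le> (1/2)^l"
        using elim(1)[THEN conjunct2, THEN conjunct2, THEN conjunct2, THEN conjunct1] by eventually_elim (use T in auto)
      show "(\<lambda>l. (1/2::real)^l) \<longlonglongrightarrow> 0" by (intro LIMSEQ_power_zero) auto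
    qed
    have "(LINT r:{0..0}|lborel. b r \<omega>) = 0"
      using set_integral_increment(1)[of 0 "\<lambda>r. b r \<omega>" 0 0] elim(3) by simp
    then have Y0: "Y l 0 \<omega> = x" for l
      using BB[of 0] simple_integral_0[OF S] by (simp add: Y_def J_def)
    have "(\<lambda>l. Y l T \<omega> * E \<sigma> T \<omega> - x - D l \<omega> - c l \<omega>) \<longlonglongrightarrow> X T \<omega> * E \<sigma> T \<omega> - x - (LINT t:{0..T}|lborel. E \<sigma> t \<omega> * b t \<omega>) - 0"
      using D YT elim(2) by (intro tendsto_intros) auto
    then show ?case unfolding ident[OF \<omega>] Y0 L_def by simp
  qed
  have Vm: "V l \<in> borel_measurable M" "V' l \<in> borel_measurable M" for l
  proof -
    have a: "(\<lambda>\<omega>. \<phi> l j (incr (s l j) (s l (Suc j)) \<omega>)) \<in> borel_measurable M"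
      "(\<lambda>\<omega>. \<psi> l j (incr (s l j) (s l (Suc j)) \<omega>)) \<in> borel_measurable M" if "j < N l" for j
      using measurable_compose[OF incm \<phi>m(1)] measurable_compose[OF incm \<phi>m(2)] bd[OF that] by auto
    show "V l \<in> borel_measurable M"
      unfolding V_def[abs_def] using a(1) F_measurable_M[OF um]
      by (intro borel_measurable_sum borel_measurable_times borel_measurable_diff) auto
    show "V' l \<in> borel_measurable M"
      unfolding V'_def[abs_def] using a(2) F_measurable_M[OF u'm]
      by (intro borel_measurable_sum borel_measurable_times borel_measurable_diff) auto
  qed
  \<comment> \<open>L contains an integral known only path by path. R agrees with it almost
    everywhere and is measurable as a limit of measurable functions.\<close>
  define R where "R \<omega> = lim (\<lambda>l. V l \<omega> + V' l \<omega>)" for \<omega>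
  have Rm: "R \<in> borel_measurable M"
    unfolding R_def[abs_def] using Vm by (intro borel_measurable_lim_metric borel_measurable_add)
  have RL: "AE \<omega> in M. R \<omega> = L \<omega>"
    using conv by eventually_elim (simp add: R_def limI)
  have "AE \<omega> in M. R \<omega> = 0"
  proof (rule AE_zero_of_limits[OF Vm Rm V0 V'0])
    show "AE \<omega> in M. (\<lambda>l. V l \<omega> + V' l \<omega>) \<longlonglongrightarrow> R \<omega>" using conv RL by eventually_elim simp
  qed
  then show ?thesis using RL by eventually_elim (simp add: L_def)
qed

text \<open>The fixed-time statement has an exceptional null set for each time. A countable dense
  set of times needs only one such set, and continuity of both sides fills in the others.\<close>

lemma integrating_factor:
  fixes b :: "real \<Rightarrow> (real \<Rightarrow> real) \<Rightarrow> real"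
  assumes \<sigma>: "0 < \<sigma>" and adX: "adapted F X" and cX: "continuous_process M X"
    and ito: "is_ito_integral M F W (\<lambda>t \<omega>. \<sigma> * X t \<omega>) I"
    and eq: "AE \<omega> in M. \<forall>t\<ge>0. set_integrable lborel {0..t} (\<lambda>s. b s \<omega>) \<and>
       X t \<omega> = x + (LINT s:{0..t}|lborel. b s \<omega>) - I t \<omega>"
  shows "AE \<omega> in M. \<forall>t\<ge>0. X t \<omega> * E \<sigma> t \<omega> = x + (LINT s:{0..t}|lborel. E \<sigma> s \<omega> * b s \<omega>)"
proof -
  \<comment> \<open>Dense times are taken positive because the fixed-time statement is about
    positive horizons; time 0 is recovered in the closure.\<close>
  obtain C :: "real set" where C: "countable C" "C \<subseteq> {0<..}" "{0<..} \<subseteq> closure C"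
    using separable[of "{0<..}"] by auto
  have "{0..} = closure {0::real<..}" by simp
  also have "\<dots> \<subseteq> closure C" using C(3) by (rule closure_minimal) simp
  finally have cl: "closure C = {0..}"
    using closure_minimal[of C "{0..}"] C(2) by force
  have "AE \<omega> in M. \<forall>t\<in>C. X t \<omega> * E \<sigma> t \<omega> = x + (LINT s:{0..t}|lborel. E \<sigma> s \<omega> * b s \<omega>)"
    using C(2) by (subst AE_ball_countable[OF C(1)]) (auto intro!: integrating_factor_at[OF \<sigma> _ adX cX ito eq])
  then show ?thesis using eq cX[unfolded continuous_process_def] AE_space
  proof eventually_elim
    case (elim \<omega>)
    have Ec: "continuous_on {0..} (\<lambda>t. E \<sigma> t \<omega>)" using E_continuous elim(4) by simp
    have "set_integrable lborel {0..t} (\<lambda>s. E \<sigma> s \<omega> * b s \<omega>)" if "0 \<le> t" for t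
      using elim(2) that continuous_on_subset[OF Ec, of "{0..t}"] by (intro set_integrable_continuous_mult) auto
    then have "continuous_on {0..} (\<lambda>t. LINT s:{0..t}|lborel. E \<sigma> s \<omega> * b s \<omega>)"
      by (rule continuous_on_indefinite_integral)
    then have "continuous_on (closure C) (\<lambda>t. X t \<omega> * E \<sigma> t \<omega> - (x + (LINT s:{0..t}|lborel. E \<sigma> s \<omega> * b s \<omega>)))"
      unfolding cl using elim(3) Ec by (intro continuous_intros)
    from continuous_constant_on_closure[OF this, of 0] elim(1) show ?case
      unfolding cl by auto
  qed
qed

end

section \<open>The pathwise equation\<close>

text \<open>Convexity of the power function as a tangent inequality at m. It follows from Young's
  inequality for a and \<open>m powr (p - 1)\<close> with conjugate exponents, which also covers the
  boundary cases a = 0 and m = 0.\<close>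

lemma powr_above_tangent:
  fixes a m p :: real
  assumes "0 \<le> a" "0 \<le> m" "1 < p"
  shows "m powr p + p * m powr (p - 1) * (a - m) \<le> a powr p"
proof -
  define q where "q = p / (p - 1)"
  have q: "1 < q" "1 / p + 1 / q = 1" "(p - 1) * q = p" "p / q = p - 1"
    using assms(3) by (auto simp: q_def field_simps)
  have "a * m powr (p - 1) \<le> a powr p / p + (m powr (p - 1)) powr q / q"
    by (rule Youngs_inequality) (use q assms in auto)
  then have "p * (a * m powr (p - 1)) \<le> p * (a powr p / p + m powr p / q)"
    using assms by (intro mult_left_mono) (auto simp: powr_powr q)
  also have "\<dots> = a powr p + (p - 1) * m powr p"
  proof -
    have "p * (m powr p / q) = (p / q) * m powr p" by simp
    then show ?thesis using assms unfolding q(4) by (simp add: distrib_left)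
  qed
  finally have 1: "p * (a * m powr (p - 1)) \<le> a powr p + (p - 1) * m powr p" .
  have "m * m powr (p - 1) = m powr p"
    using powr_mult_base[OF assms(2), of "p - 1"] by simp
  moreover have "p * m powr (p - 1) * (a - m) = p * (a * m powr (p - 1)) - p * (m * m powr (p - 1))"
    by (simp add: algebra_simps)
  moreover have "(p - 1) * m powr p = p * m powr p - m powr p" by (simp add: left_diff_distrib)
  ultimately show ?thesis using 1 by simp
qed

text \<open>Adding the tangent inequalities for a and b at their midpoint cancels the linear terms.
  This is the origin of the factor \<open>2 powr (\<eta> - 1)\<close>.\<close>

lemma powr_add_le:
  fixes a b p :: real
  assumes "0 \<le> a" "0 \<le> b" "1 < p"
  shows "(a + b) powr p \<le> 2 powr (p - 1) * (a powr p + b powr p)"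
proof -
  define m where "m = (a + b) / 2"
  have m: "0 \<le> m" "a + b = 2 * m" using assms by (auto simp: m_def)
  have "2 * m powr p + p * m powr (p - 1) * ((a - m) + (b - m)) \<le> a powr p + b powr p"
    using powr_above_tangent[OF assms(1) m(1) assms(3)] powr_above_tangent[OF assms(2) m(1) assms(3)]
    by (simp add: algebra_simps)
  moreover have "(a - m) + (b - m) = 0" using m by simp
  ultimately have "2 * m powr p \<le> a powr p + b powr p" by simp
  then have "2 powr (p - 1) * (2 * m powr p) \<le> 2 powr (p - 1) * (a powr p + b powr p)"
    by (intro mult_left_mono) auto
  moreover have "2 powr (p - 1) * (2 * m powr p) = (2 * m) powr p"
    using m(1) powr_mult_base[of 2 "p - 1"] by (simp add: powr_mult mult_ac)
  ultimately show ?thesis by (simp add: m(2))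
qed

text \<open>Write \<open>z powr p\<close> as \<open>z * z powr (p - 1)\<close>: the second factor
  can only grow when its base is raised to \<open>a + b\<close>.\<close>

lemma powr_superadditive:
  fixes a b p :: real
  assumes "0 \<le> a" "0 \<le> b" "1 \<le> p"
  shows "a powr p + b powr p \<le> (a + b) powr p"
proof -
  have base: "z * z powr (p - 1) = z powr p" if "0 \<le> z" for z
    using powr_mult_base[OF that, of "p - 1"] by simp
  have "a * a powr (p - 1) + b * b powr (p - 1) \<le> a * (a + b) powr (p - 1) + b * (a + b) powr (p - 1)"
    using assms by (intro add_mono mult_left_mono powr_mono2) auto
  then show ?thesis using assms base by (simp add: distrib_right[symmetric])
qed

text \<open>With d = u - v, convexity bounds the left side by
  \<open>p * d * (u + A) powr (p - 1)\<close>. If d is at most \<open>\<delta> * (u + A)\<close>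
  this is a small multiple of \<open>(u + A) powr p\<close>. Otherwise \<open>u + A\<close> is below
  \<open>d / \<delta>\<close>, and \<open>d powr p\<close>, with a large factor, is bounded by
  superadditivity. For p = \<eta> and u, v the powers of two initial values,
  \<open>u powr p - v powr p\<close> is the difference of those values.\<close>

lemma powr_difference_bound:
  fixes u v A p \<delta> :: real
  assumes "0 \<le> v" "v \<le> u" "0 \<le> A" "1 < p" "0 < \<delta>"
  shows "(u + A) powr p - (v + A) powr p \<le>
    p * \<delta> powr (1 - p) * (u powr p - v powr p) + p * \<delta> * 2 powr (p - 1) * (u powr p + A powr p)"
proof -
  define a where "a = u + A"
  define d where "d = u - v"
  have a: "0 \<le> a" "0 \<le> d" using assms by (auto simp: a_def d_def)
  have "(u + A) powr p - (v + A) powr p \<le> p * (d * a powr (p - 1))"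
    using powr_above_tangent[of "v + A" a p] assms a by (simp add: a_def d_def algebra_simps)
  also have "d * a powr (p - 1) \<le> \<delta> powr (1 - p) * d powr p + \<delta> * a powr p"
  proof (cases "d \<le> \<delta> * a")
    case True
    then have "d * a powr (p - 1) \<le> \<delta> * a * a powr (p - 1)" by (intro mult_right_mono) auto
    also have "\<dots> = \<delta> * a powr p" using powr_mult_base[OF a(1), of "p - 1"] by simp
    finally show ?thesis by (smt (verit) mult_nonneg_nonneg powr_ge_zero)
  next
    case False
    then have "a \<le> d / \<delta>" using assms(5) by (simp add: field_simps)
    then have "d * a powr (p - 1) \<le> d * (d / \<delta>) powr (p - 1)"
      using a assms by (intro mult_left_mono powr_mono2) auto
    also have "\<dots> = \<delta> powr (1 - p) * (d * d powr (p - 1))"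
    proof -
      have "(d / \<delta>) powr (p - 1) = d powr (p - 1) / \<delta> powr (p - 1)"
        by (rule powr_divide)
      moreover have "\<delta> powr (1 - p) = 1 / \<delta> powr (p - 1)"
        using powr_minus_divide[of \<delta> "p - 1"] by simp
      ultimately show ?thesis by simp
    qed
    also have "\<dots> = \<delta> powr (1 - p) * d powr p" using powr_mult_base[OF a(2), of "p - 1"] by simp
    finally show ?thesis using assms by (smt (verit) mult_nonneg_nonneg powr_ge_zero)
  qed
  also have "d powr p \<le> u powr p - v powr p"
    using powr_superadditive[of v d p] assms a by (simp add: d_def)
  also have "a powr p \<le> 2 powr (p - 1) * (u powr p + A powr p)"
    unfolding a_def using assms by (intro powr_add_le) auto
  finally show ?thesis using assms by (simp add: distrib_left mult_ac)
qed

section \<open>Jensen's inequality and the integral equations along one path\<close>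

lemma set_integrable_continuous:
  fixes f :: "real \<Rightarrow> real"
  assumes "continuous_on {a..b} f"
  shows "set_integrable lborel {a..b} f"
  using borel_integrable_compact[OF compact_Icc assms]
  by (simp add: set_integrable_def indicator_def if_distrib cong: if_cong)

lemma set_integral_singleton_0: "(LINT s:{0::real}|lborel. f s :: real) = 0"
proof -
  have "AE r in lborel. r \<noteq> (0::real)" by (rule AE_lborel_singleton)
  then show ?thesis
    unfolding set_lebesgue_integral_def by (intro integral_eq_zero_AE; eventually_elim; simp)
qed

text \<open>Jensen's inequality for the uniform distribution on \<open>{0..t}\<close>: the tangent
  inequality at the mean m of f is integrated, and its linear term integrates to 0.\<close>

lemma set_integral_powr_le:
  fixes f :: "real \<Rightarrow> real"
  assumes f: "continuous_on {0..t} f" and f0: "\<And>s. s \<in> {0..t} \<Longrightarrow> 0 \<le> f s" and p: "1 < p" and t: "0 \<le> t"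
  shows "(LINT s:{0..t}|lborel. f s) powr p \<le> t powr (p - 1) * (LINT s:{0..t}|lborel. f s powr p)"
proof (cases "t = 0")
  case True
  then show ?thesis using p by (simp add: set_integral_singleton_0)
next
  case False
  then have t: "0 < t" using t by simp
  define I where "I = (LINT s:{0..t}|lborel. f s)"
  define m where "m = I / t"
  have I0: "0 \<le> I" unfolding I_def set_lebesgue_integral_def using f0 by (intro integral_nonneg_AE) (auto simp: indicator_def)
  have m: "0 \<le> m" "I = t * m" using t I0 by (auto simp: m_def)
  have fi: "set_integrable lborel {0..t} f" using f by (rule set_integrable_continuous)
  have fpi: "set_integrable lborel {0..t} (\<lambda>s. f s powr p)"
    using f f0 p by (intro set_integrable_continuous continuous_on_powr') (auto intro: continuous_intros)
  have ci: "set_integrable lborel {0..t} (\<lambda>s. k)" for k :: real by (intro set_integrable_continuous continuous_intros)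
  have cI: "(LINT s:{0..t}|lborel. k) = t * k" for k :: real
    using t by (simp add: set_lebesgue_integral_def)
  have ti: "set_integrable lborel {0..t} (\<lambda>s. m powr p + p * m powr (p - 1) * (f s - m))"
    using f by (intro set_integrable_continuous continuous_intros)
  have eq: "m powr p + p * m powr (p - 1) * (f s - m) = (m powr p - p * m powr (p - 1) * m) + p * m powr (p - 1) * f s" for s
    by (simp add: algebra_simps)
  have "(LINT s:{0..t}|lborel. m powr p + p * m powr (p - 1) * (f s - m)) = t * (m powr p - p * m powr (p - 1) * m) + p * m powr (p - 1) * I"
    unfolding eq I_def using fi ci by (subst set_integral_add(2)) (auto simp: cI)
  also have "\<dots> = t * m powr p" by (simp add: m(2) algebra_simps)
  finally have "t * m powr p \<le> (LINT s:{0..t}|lborel. f s powr p)"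
    using set_integral_mono[OF ti fpi] powr_above_tangent[OF f0 m(1) p] by simp
  then have "t powr (p - 1) * (t * m powr p) \<le> t powr (p - 1) * (LINT s:{0..t}|lborel. f s powr p)"
    by (intro mult_left_mono) auto
  moreover have "t powr (p - 1) * (t * m powr p) = I powr p"
    using t m powr_mult_base[of t "p - 1"] by (simp add: powr_mult mult_ac)
  ultimately show ?thesis by (simp add: I_def)
qed

text \<open>As g is only integrable, the exponential factor need not be differentiable, and the
  product is compared with its integral through \<open>eq_of_small_increments\<close>. In the result
  g survives only inside the exponential, so the integrand has become continuous.\<close>

lemma exp_product_rule:
  fixes p g Q :: "real \<Rightarrow> real"
  assumes T: "0 < T" and p: "continuous_on {0..T} p" and g: "set_integrable lborel {0..T} g"
    and g0: "\<And>s. 0 \<le> s \<Longrightarrow> 0 \<le> g s" and Q: "continuous_on {0..T} Q"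
    and eq: "\<And>t. 0 \<le> t \<Longrightarrow> t \<le> T \<Longrightarrow> Q t = x + (LINT s:{0..t}|lborel. p s - g s * Q s)"
  shows "Q T * exp (LINT s:{0..T}|lborel. g s) =
    x + (LINT s:{0..T}|lborel. p s * exp (LINT r:{0..s}|lborel. g r))"
proof -
  define \<Gamma> where "\<Gamma> t = (LINT r:{0..t}|lborel. g r)" for t
  define G where "G t = exp (\<Gamma> t)" for t
  have \<Gamma>c: "continuous_on {0..T} \<Gamma>"
  proof -
    have "continuous_on {0..T} (\<lambda>t. integral {0..t} g)"
      using set_borel_integral_eq_integral(1)[OF g] by (rule indefinite_integral_continuous_1)
    then show ?thesis
    proof (rule continuous_on_eq)
      fix t assume "t \<in> {0..T}"
      then have "set_integrable lborel {0..t} g" by (intro set_integrable_subset[OF g]) auto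
      then show "integral {0..t} g = \<Gamma> t" by (simp add: \<Gamma>_def set_borel_integral_eq_integral(2))
    qed
  qed
  then have Gc: "continuous_on {0..T} G" unfolding G_def by (intro continuous_intros)
  have pi: "set_integrable lborel {0..T} p" using p by (rule set_integrable_continuous)
  have gQ: "set_integrable lborel {0..T} (\<lambda>s. Q s * g s)" by (rule set_integrable_continuous_mult[OF Q g])
  have pG: "set_integrable lborel {0..T} (\<lambda>s. G s * p s)" by (rule set_integrable_continuous_mult[OF Gc pi])
  have pQ: "set_integrable lborel {0..T} (\<lambda>s. p s - g s * Q s)"
    using set_integral_diff(1)[OF pi gQ] by (simp add: mult.commute)
  obtain K where K: "\<And>t. t \<in> {0..T} \<Longrightarrow> \<bar>G t\<bar> \<le> K"
    using compact_imp_bounded[OF compact_continuous_image[OF Gc compact_Icc]]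
    unfolding bounded_iff real_norm_def by blast
  obtain L where L: "\<And>t. t \<in> {0..T} \<Longrightarrow> \<bar>Q t\<bar> \<le> L"
    using compact_imp_bounded[OF compact_continuous_image[OF Q compact_Icc]]
    unfolding bounded_iff real_norm_def by blast
  have KL: "0 \<le> K" "0 \<le> L" using K[of 0] L[of 0] T by auto
  define \<Phi> where "\<Phi> t = Q t * G t - (LINT s:{0..t}|lborel. G s * p s)" for t
  \<comment> \<open>The increment of \<open>\<Phi>\<close> has three error terms, measured by the
    variation of p, by G times the increment of \<open>\<Gamma>\<close>, and by Q times G times that
    increment; K and L bound G and Q.\<close>
  define \<beta> where "\<beta> t = (LINT s:{0..t}|lborel. \<bar>p s\<bar>) + (K + L * K) * \<Gamma> t" for t
  have "\<Phi> T = \<Phi> 0"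
  proof (rule eq_of_small_increments[OF T, of \<Phi> \<beta>])
    fix \<epsilon> :: real assume \<epsilon>: "0 < \<epsilon>"
    obtain \<delta>1 where \<delta>1: "0 < \<delta>1" "\<forall>u\<in>{0..T}. \<forall>v\<in>{0..T}. \<bar>u - v\<bar> < \<delta>1 \<longrightarrow> \<bar>G u - G v\<bar> < \<epsilon>"
      using uniformly_continuous_real[OF Gc \<epsilon>] by blast
    obtain \<delta>2 where \<delta>2: "0 < \<delta>2" "\<forall>u\<in>{0..T}. \<forall>v\<in>{0..T}. \<bar>u - v\<bar> < \<delta>2 \<longrightarrow> \<bar>Q u - Q v\<bar> < \<epsilon>"
      using uniformly_continuous_real[OF Q \<epsilon>] by blast
    obtain \<delta>3 where \<delta>3: "0 < \<delta>3" "\<forall>u\<in>{0..T}. \<forall>v\<in>{0..T}. \<bar>u - v\<bar> < \<delta>3 \<longrightarrow> \<bar>\<Gamma> u - \<Gamma> v\<bar> < \<epsilon>"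
      using uniformly_continuous_real[OF \<Gamma>c \<epsilon>] by blast
    define \<delta> where "\<delta> = min \<delta>1 (min \<delta>2 \<delta>3)"
    have "\<bar>\<Phi> v - \<Phi> u\<bar> \<le> \<epsilon> * (\<beta> v - \<beta> u)" if uv: "0 \<le> u" "u \<le> v" "v \<le> T" "v - u < \<delta>" for u v
    proof -
      have m: "u \<in> {0..T}" "v \<in> {0..T}" using uv by auto
      have near: "\<bar>a - b\<bar> < \<delta>" "a \<in> {0..T}" if "a \<in> {u..v}" "b \<in> {u..v}" for a b using that uv by auto
      have cs: "continuous_on {u..v} f" if "continuous_on {0..T} f" for f :: "real \<Rightarrow> real"
        using that by (rule continuous_on_subset) (use uv in auto)
      define \<Delta> where "\<Delta> = (LINT s:{u..v}|lborel. g s)"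
      have \<Delta>: "\<Gamma> v - \<Gamma> u = \<Delta>" unfolding \<Gamma>_def \<Delta>_def by (rule set_integral_increment(1)[OF g uv(1-3)])
      have \<Delta>0: "0 \<le> \<Delta>" unfolding \<Delta>_def set_lebesgue_integral_def
        using g0 uv by (intro integral_nonneg_AE) (auto simp: indicator_def)
      have absg: "(LINT s:{u..v}|lborel. \<bar>g s\<bar>) = \<Delta>" unfolding \<Delta>_def
        using g0 uv by (intro set_lebesgue_integral_cong) auto
      have \<Delta>\<epsilon>: "\<Delta> \<le> \<epsilon>" using \<delta>3(2)[rule_format, OF m(2,1)] uv \<Delta> by (simp add: \<delta>_def)
      define ip where "ip = (LINT s:{u..v}|lborel. p s)"
      define iap where "iap = (LINT s:{u..v}|lborel. \<bar>p s\<bar>)"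
      define iGp where "iGp = (LINT s:{u..v}|lborel. G s * p s)"
      define iQg where "iQg = (LINT s:{u..v}|lborel. Q s * g s)"
      have inc_p: "\<bar>G v * ip - iGp\<bar> \<le> \<epsilon> * iap"
        unfolding ip_def iGp_def iap_def
      proof (rule set_integral_continuous_approx[OF cs[OF Gc] set_integral_increment(2)[OF pi uv(1-3)]])
        fix r assume "r \<in> {u..v}"
        then show "\<bar>G v - G r\<bar> \<le> \<epsilon>" using \<delta>1(2) near[of v r] near[of r v] uv by (intro less_imp_le) (auto simp: \<delta>_def)
      qed
      have inc_g: "\<bar>Q u * \<Delta> - iQg\<bar> \<le> \<epsilon> * \<Delta>"
      proof -
        have "\<bar>Q u * (LINT s:{u..v}|lborel. g s) - (LINT s:{u..v}|lborel. Q s * g s)\<bar> \<le> \<epsilon> * (LINT s:{u..v}|lborel. \<bar>g s\<bar>)"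
        proof (rule set_integral_continuous_approx[OF cs[OF Q] set_integral_increment(2)[OF g uv(1-3)]])
          fix r assume "r \<in> {u..v}"
          then show "\<bar>Q u - Q r\<bar> \<le> \<epsilon>" using \<delta>2(2) near[of u r] near[of r u] uv by (intro less_imp_le) (auto simp: \<delta>_def)
        qed
        then show ?thesis unfolding absg unfolding \<Delta>_def iQg_def .
      qed
      have Qi: "Q v - Q u = ip - iQg"
      proof -
        have "Q v - Q u = (LINT s:{u..v}|lborel. p s - g s * Q s)"
          using set_integral_increment(1)[OF pQ uv(1-3)] eq[of u] eq[of v] uv by simp
        also have "\<dots> = ip - iQg"
          unfolding ip_def iQg_def using set_integral_diff(2)[OF set_integral_increment(2)[OF pi uv(1-3)] set_integral_increment(2)[OF gQ uv(1-3)]]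
          by (simp add: mult.commute)
        finally show ?thesis .
      qed
      \<comment> \<open>\<open>exp (- \<Delta>)\<close> equals \<open>1 - \<Delta>\<close> up to
        \<open>\<Delta>\<^sup>2\<close>, and on a short interval one of the two factors is at most
        \<open>\<epsilon>\<close>.\<close>
      have Gi: "\<bar>G v - G u - G v * \<Delta>\<bar> \<le> G v * (\<epsilon> * \<Delta>)"
      proof -
        have Gu: "G u = G v * exp (- \<Delta>)" unfolding G_def exp_add[symmetric] using \<Delta> by simp
        have l: "1 - \<Delta> \<le> exp (- \<Delta>)" using exp_ge_add_one_self[of "-\<Delta>"] by simp
        have "exp \<Delta> * exp (-\<Delta>) \<le> exp \<Delta> * (1 - \<Delta> + \<Delta>\<^sup>2)"
          using exp_times_one_minus_le(2)[OF \<Delta>0] by (simp add: exp_minus algebra_simps)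
        then have "exp (- \<Delta>) \<le> 1 - \<Delta> + \<Delta>\<^sup>2" by simp
        moreover have "\<Delta>\<^sup>2 \<le> \<epsilon> * \<Delta>" unfolding power2_eq_square using \<Delta>\<epsilon> \<Delta>0 by (intro mult_right_mono)
        ultimately have "\<bar>1 - exp (-\<Delta>) - \<Delta>\<bar> \<le> \<epsilon> * \<Delta>" using l by linarith
        then have "G v * \<bar>1 - exp (-\<Delta>) - \<Delta>\<bar> \<le> G v * (\<epsilon> * \<Delta>)" by (intro mult_left_mono) (auto simp: G_def)
        moreover have "G v * \<bar>1 - exp (-\<Delta>) - \<Delta>\<bar> = \<bar>G v - G u - G v * \<Delta>\<bar>"
        proof -
          have "G v * (1 - exp (-\<Delta>) - \<Delta>) = G v - G u - G v * \<Delta>" unfolding Gu by (simp add: right_diff_distrib)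
          moreover have "\<bar>G v * (1 - exp (-\<Delta>) - \<Delta>)\<bar> = G v * \<bar>1 - exp (-\<Delta>) - \<Delta>\<bar>" by (simp add: abs_mult G_def)
          ultimately show ?thesis by simp
        qed
        ultimately show ?thesis by simp
      qed
      have Gv: "0 \<le> G v" "G v \<le> K" using K[OF m(2)] by (auto simp: G_def)
      \<comment> \<open>The increment of Q is paired with the right-end value of G and the increment
        of G with the left-end value of Q, so no cross term remains.\<close>
      have "\<Phi> v - \<Phi> u = (G v * ip - iGp) + G v * (Q u * \<Delta> - iQg) + Q u * (G v - G u - G v * \<Delta>)"
      proof -
        have "\<Phi> v - \<Phi> u = Q v * G v - Q u * G u - iGp"
          unfolding \<Phi>_def iGp_def using set_integral_increment(1)[OF pG uv(1-3)] by simp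
        moreover have "Q v = Q u + ip - iQg" using Qi by simp
        ultimately show ?thesis by (simp add: algebra_simps)
      qed
      also have "\<bar>\<dots>\<bar> \<le> \<epsilon> * iap + K * (\<epsilon> * \<Delta>) + L * (K * (\<epsilon> * \<Delta>))"
      proof -
        have "\<bar>G v * (Q u * \<Delta> - iQg)\<bar> \<le> K * (\<epsilon> * \<Delta>)"
          unfolding abs_mult using inc_g Gv by (intro mult_mono) auto
        moreover have "\<bar>Q u * (G v - G u - G v * \<Delta>)\<bar> \<le> L * (K * (\<epsilon> * \<Delta>))"
          unfolding abs_mult using L[OF m(1)] KL
            order_trans[OF Gi mult_right_mono[OF Gv(2), of "\<epsilon> * \<Delta>"]] \<epsilon> \<Delta>0 by (intro mult_mono) auto
        ultimately show ?thesis using inc_p by linarith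
      qed
      also have "\<dots> = \<epsilon> * (\<beta> v - \<beta> u)"
        unfolding \<beta>_def iap_def
        using set_integral_increment(1)[OF set_integrable_abs[OF pi] uv(1-3)] \<Delta> by (simp add: algebra_simps)
      finally show ?thesis .
    qed
    then show "\<exists>\<delta>>0. \<forall>u v. 0 \<le> u \<and> u \<le> v \<and> v \<le> T \<and> v - u < \<delta> \<longrightarrow> \<bar>\<Phi> v - \<Phi> u\<bar> \<le> \<epsilon> * (\<beta> v - \<beta> u)"
      using \<delta>1(1) \<delta>2(1) \<delta>3(1) by (intro exI[of _ \<delta>]) (auto simp: \<delta>_def)
  qed
  moreover have "\<Phi> 0 = x"
    using eq[of 0] T by (simp add: \<Phi>_def G_def \<Gamma>_def set_integral_singleton_0)
  ultimately show ?thesis by (simp add: \<Phi>_def G_def \<Gamma>_def mult.commute)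
qed

text \<open>The sign of the integrand keeps Z above x, away from 0, where
  \<open>z powr \<alpha>\<close> is not Lipschitz and uniqueness may fail. There
  \<open>Z powr (1 - \<alpha>)\<close> is differentiable with derivative
  \<open>(1 - \<alpha>) * k\<close>, and integrating this gives the formula.\<close>

lemma bernoulli_ode:
  fixes Z k :: "real \<Rightarrow> real"
  assumes \<alpha>: "0 < \<alpha>" "\<alpha> < 1" and x: "0 < x" and t: "0 \<le> t"
    and k: "continuous_on {0..t} k" and k0: "\<And>s. s \<in> {0..t} \<Longrightarrow> 0 \<le> k s"
    and Zc: "continuous_on {0..t} Z"
    and Z: "\<And>s. s \<in> {0..t} \<Longrightarrow> Z s = x + (LINT r:{0..s}|lborel. Z r powr \<alpha> * k r)"
  shows "Z t = (x powr (1 - \<alpha>) + (1 - \<alpha>) * (LINT s:{0..t}|lborel. k s)) powr (1 / (1 - \<alpha>))"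
proof -
  have Zx: "x \<le> Z s" if "s \<in> {0..t}" for s
  proof -
    have "0 \<le> (LINT r:{0..s}|lborel. Z r powr \<alpha> * k r)"
      unfolding set_lebesgue_integral_def using k0 that by (intro integral_nonneg_AE) (auto simp: indicator_def)
    then show ?thesis using Z[OF that] by simp
  qed
  have fc: "continuous_on {0..t} (\<lambda>r. Z r powr \<alpha> * k r)"
    using Zc k Zx x by (intro continuous_intros) force+
  have hi: "(LINT r:{0..s}|lborel. f r) = integral {0..s} f" if "continuous_on {0..t} f" "s \<in> {0..t}" for f :: "real \<Rightarrow> real" and s
    using that by (intro set_borel_integral_eq_integral(2) set_integrable_continuous continuous_on_subset[OF that(1)]) auto
  have dZ: "(Z has_real_derivative Z s powr \<alpha> * k s) (at s within {0..t})" if "s \<in> {0..t}" for s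
  proof -
    have "((\<lambda>s. x + integral {0..s} (\<lambda>r. Z r powr \<alpha> * k r)) has_real_derivative 0 + Z s powr \<alpha> * k s) (at s within {0..t})"
      by (intro DERIV_add DERIV_const integral_has_real_derivative[OF fc that])
    then have "((\<lambda>s. x + integral {0..s} (\<lambda>r. Z r powr \<alpha> * k r)) has_real_derivative Z s powr \<alpha> * k s) (at s within {0..t})"
      by simp
    then show ?thesis
      by (rule has_field_derivative_transform_within[OF _ zero_less_one that]) (simp add: Z hi[OF fc])
  qed
  have dZp: "((\<lambda>s. Z s powr (1 - \<alpha>)) has_vector_derivative (1 - \<alpha>) * k s) (at s within {0..t})" if "s \<in> {0..t}" for s
  proof -
    have Z0: "0 < Z s" using Zx[OF that] x by simp
    have "((\<lambda>s. Z s powr (1 - \<alpha>)) has_real_derivative (1 - \<alpha>) * Z s powr (1 - \<alpha> - 1) * (Z s powr \<alpha> * k s)) (at s within {0..t})"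
      using DERIV_chain2[OF has_real_derivative_powr[OF Z0, of "1 - \<alpha>"] dZ[OF that]] .
    moreover have "Z s powr (1 - \<alpha> - 1) * Z s powr \<alpha> = 1"
      using Z0 by (simp add: powr_add[symmetric])
    ultimately show ?thesis
      by (simp add: has_real_derivative_iff_has_vector_derivative[symmetric] mult.assoc[symmetric])
         (simp add: mult.assoc)
  qed
  have "((\<lambda>s. (1 - \<alpha>) * k s) has_integral Z t powr (1 - \<alpha>) - Z 0 powr (1 - \<alpha>)) {0..t}"
    by (rule fundamental_theorem_of_calculus[OF t dZp])
  then have "integral {0..t} (\<lambda>s. (1 - \<alpha>) * k s) = Z t powr (1 - \<alpha>) - Z 0 powr (1 - \<alpha>)"
    by (rule integral_unique)
  moreover have "Z 0 = x" using Z[of 0] t by (simp add: set_integral_singleton_0)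
  ultimately have "Z t powr (1 - \<alpha>) = x powr (1 - \<alpha>) + (1 - \<alpha>) * (LINT s:{0..t}|lborel. k s)"
    using hi[OF k, of t] t by simp
  then have "(x powr (1 - \<alpha>) + (1 - \<alpha>) * (LINT s:{0..t}|lborel. k s)) powr (1 / (1 - \<alpha>)) = (Z t powr (1 - \<alpha>)) powr (1 / (1 - \<alpha>))"
    by simp
  also have "\<dots> = Z t" using Zx[of t] x t \<alpha> by (simp add: powr_powr)
  finally show ?thesis by simp
qed

lemma explicit_solution:
  fixes X e c :: "real \<Rightarrow> real"
  assumes \<alpha>: "0 < \<alpha>" "\<alpha> < 1" and \<mu>: "0 < \<mu>" and x: "0 < x"
    and e: "continuous_on {0..} e" "\<And>t. 0 < e t"
    and X: "continuous_on {0..} X" "\<And>t. 0 \<le> t \<Longrightarrow> 0 \<le> X t"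
    and c: "\<And>t. 0 \<le> t \<Longrightarrow> 0 \<le> c t" "\<And>t. 0 \<le> t \<Longrightarrow> set_integrable lborel {0..t} c"
    and eq: "\<And>t. 0 \<le> t \<Longrightarrow> X t * e t = x + (LINT s:{0..t}|lborel. e s * (X s powr \<alpha> - \<mu> * X s - c s * X s))"
    and G: "\<And>t. G t = exp (LINT s:{0..t}|lborel. \<mu> + c s)" and t: "0 \<le> t"
  shows "X t * e t * G t =
    (x powr (1 - \<alpha>) + (1 - \<alpha>) * (LINT s:{0..t}|lborel. (e s * G s) powr (1 - \<alpha>))) powr (1 / (1 - \<alpha>))"
proof -
  define Q where "Q t = X t * e t" for t
  define p where "p t = X t powr \<alpha> * e t" for t
  define g where "g t = \<mu> + c t" for t
  have sub: "{0..s} \<subseteq> {0..}" for s :: real by auto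
  have gi: "set_integrable lborel {0..s} g" if "0 \<le> s" for s
    unfolding g_def using c(2)[OF that] by (intro set_integral_add(1)) (auto intro: set_integrable_continuous)
  have pc: "continuous_on {0..s} p" for s
    unfolding p_def using X e \<alpha> continuous_on_subset[OF X(1) sub] continuous_on_subset[OF e(1) sub]
    by (intro continuous_on_mult continuous_on_powr' continuous_intros) auto
  have Qc: "continuous_on {0..s} Q" for s
    unfolding Q_def using continuous_on_subset[OF X(1) sub] continuous_on_subset[OF e(1) sub] by (intro continuous_intros)
  have Qeq: "Q s = x + (LINT r:{0..s}|lborel. p r - g r * Q r)" if "0 \<le> s" for s
    using eq[OF that] by (simp add: Q_def p_def g_def algebra_simps)
  have Gc: "continuous_on {0..} G"
    unfolding G using gi by (intro continuous_intros continuous_on_indefinite_integral) (simp add: g_def[abs_def])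
  have G0: "0 < G s" for s by (simp add: G)
  have prod: "Q s * G s = x + (LINT r:{0..s}|lborel. p r * G r)" if "0 \<le> s" for s
  proof (cases "s = 0")
    case True
    then show ?thesis using Qeq[of 0] by (simp add: G set_integral_singleton_0)
  next
    case False
    have "Q s * exp (LINT r:{0..s}|lborel. g r) = x + (LINT r:{0..s}|lborel. p r * exp (LINT r:{0..r}|lborel. g r))"
    proof (rule exp_product_rule[OF _ pc gi _ Qc Qeq])
      show "0 \<le> g r" if "0 \<le> r" for r using c(1)[OF that] \<mu> by (simp add: g_def)
    qed (use that False in auto)
    then show ?thesis by (simp add: G g_def)
  qed
  define k where "k s = (e s * G s) powr (1 - \<alpha>)" for s
  define Z where "Z s = Q s * G s" for s
  \<comment> \<open>Splitting \<open>e * G\<close> into its powers \<open>\<alpha>\<close> and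
    \<open>1 - \<alpha>\<close> lets the first one join X, which closes the equation in Z.\<close>
  have int: "p s * G s = Z s powr \<alpha> * k s" if "0 \<le> s" for s
  proof -
    have "e s * G s = (e s * G s) powr \<alpha> * (e s * G s) powr (1 - \<alpha>)"
      using e(2)[of s] G0[of s] by (simp add: powr_add[symmetric])
    moreover have "Z s powr \<alpha> = X s powr \<alpha> * (e s * G s) powr \<alpha>"
      using X(2)[OF that] e(2)[of s] G0[of s] unfolding Z_def Q_def by (simp add: powr_mult mult_ac)
    ultimately show ?thesis by (simp add: p_def k_def)
  qed
  have "Z t = (x powr (1 - \<alpha>) + (1 - \<alpha>) * (LINT s:{0..t}|lborel. k s)) powr (1 / (1 - \<alpha>))"
  proof (rule bernoulli_ode[OF \<alpha> x t])
    show "continuous_on {0..t} k"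
      unfolding k_def using continuous_on_subset[OF Gc sub] continuous_on_subset[OF e(1) sub] e(2) G0
      by (intro continuous_on_powr' continuous_intros) (auto simp: less_imp_le \<alpha>)
    show "continuous_on {0..t} Z"
      unfolding Z_def using Qc continuous_on_subset[OF Gc sub] by (intro continuous_intros)
    show "0 \<le> k s" for s by (simp add: k_def)
    fix s assume "s \<in> {0..t}"
    then have s: "0 \<le> s" by simp
    have "(LINT r:{0..s}|lborel. p r * G r) = (LINT r:{0..s}|lborel. Z r powr \<alpha> * k r)"
      by (rule set_lebesgue_integral_cong) (auto simp: int)
    then show "Z s = x + (LINT r:{0..s}|lborel. Z r powr \<alpha> * k r)"
      using prod[OF s] by (simp add: Z_def)
  qed
  then show ?thesis by (simp add: Z_def Q_def k_def)
qed

text \<open>Jensen with exponent \<open>\<eta>\<close> undoes the power inside the integral, the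
  factor \<open>1 - \<alpha>\<close> is at most 1, and \<open>G s \<le> G t\<close> takes the
  control out of the integral. What remains carries the factor \<open>e t * G t\<close> that
  multiplies the solution.\<close>

lemma explicit_integral_bound:
  fixes e G :: "real \<Rightarrow> real"
  assumes \<alpha>: "0 < \<alpha>" "\<alpha> < 1" and t: "0 \<le> t" and \<eta>: "\<eta> = 1 / (1 - \<alpha>)"
    and e: "continuous_on {0..t} e" "\<And>s. 0 < e s" and G: "continuous_on {0..t} G" "\<And>s. 0 < G s"
    and mono: "\<And>s. 0 \<le> s \<Longrightarrow> s \<le> t \<Longrightarrow> G s \<le> G t"
  shows "0 \<le> (1 - \<alpha>) * (LINT s:{0..t}|lborel. (e s * G s) powr (1 - \<alpha>))"
    and "((1 - \<alpha>) * (LINT s:{0..t}|lborel. (e s * G s) powr (1 - \<alpha>))) powr \<eta> \<le> e t * G t * (t powr (\<eta> - 1) * (LINT s:{0..t}|lborel. e s / e t))"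
proof -
  have \<eta>1: "1 < \<eta>" "(1 - \<alpha>) * \<eta> = 1" using \<alpha> by (auto simp: \<eta>)
  let ?I = "LINT s:{0..t}|lborel. (e s * G s) powr (1 - \<alpha>)"
  let ?A = "(1 - \<alpha>) * ?I"
  have I0: "0 \<le> ?I" unfolding set_lebesgue_integral_def by (intro integral_nonneg_AE) (auto simp: indicator_def)
  then show A0: "0 \<le> ?A" using \<alpha> by simp
  have c: "continuous_on {0..t} (\<lambda>s. (e s * G s) powr (1 - \<alpha>))"
    using e G by (intro continuous_on_powr' continuous_intros) (auto simp: less_imp_le \<alpha>)
  have "?A \<le> ?I" using I0 \<alpha> by (intro mult_left_le_one_le) auto
  then have "?A powr \<eta> \<le> ?I powr \<eta>" using A0 \<eta>1 by (intro powr_mono2) auto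
  also have "\<dots> \<le> t powr (\<eta> - 1) * (LINT s:{0..t}|lborel. ((e s * G s) powr (1 - \<alpha>)) powr \<eta>)"
    by (rule set_integral_powr_le[OF c _ \<eta>1(1) t]) simp
  also have "(LINT s:{0..t}|lborel. ((e s * G s) powr (1 - \<alpha>)) powr \<eta>) = (LINT s:{0..t}|lborel. e s * G s)"
    using e(2) G(2) \<eta>1 by (intro set_lebesgue_integral_cong) (auto simp: powr_powr mult_nonneg_nonneg less_imp_le)
  finally have 1: "?A powr \<eta> \<le> t powr (\<eta> - 1) * (LINT s:{0..t}|lborel. e s * G s)" .
  have "(LINT s:{0..t}|lborel. e s * G s) \<le> (LINT s:{0..t}|lborel. (e t * G t) * (e s / e t))"
  proof (rule set_integral_mono)
    show "set_integrable lborel {0..t} (\<lambda>s. e s * G s)" using e G by (intro set_integrable_continuous continuous_intros)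
    show "set_integrable lborel {0..t} (\<lambda>s. (e t * G t) * (e s / e t))"
      using e less_imp_neq[OF e(2)[of t]] by (intro set_integrable_continuous continuous_intros) auto
    fix s assume "s \<in> {0..t}"
    then have "e s * G s \<le> e s * G t" using mono e(2)[of s] by (intro mult_left_mono) auto
    then show "e s * G s \<le> (e t * G t) * (e s / e t)" using less_imp_neq[OF e(2)[of t]] by (simp add: field_simps)
  qed
  also have "\<dots> = (e t * G t) * (LINT s:{0..t}|lborel. e s / e t)" by (rule set_integral_mult_right)
  finally have "t powr (\<eta> - 1) * (LINT s:{0..t}|lborel. e s * G s) \<le>
      t powr (\<eta> - 1) * ((e t * G t) * (LINT s:{0..t}|lborel. e s / e t))"
    by (intro mult_left_mono) auto
  with 1 have "?A powr \<eta> \<le> t powr (\<eta> - 1) * ((e t * G t) * (LINT s:{0..t}|lborel. e s / e t))"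
    by (rule order_trans)
  then show "?A powr \<eta> \<le> e t * G t * (t powr (\<eta> - 1) * (LINT s:{0..t}|lborel. e s / e t))"
    by (simp only: mult_ac)
qed

text \<open>q stands for \<open>t powr (\<eta> - 1)\<close> times the integrated ratios. As
  \<open>1 \<le> g\<close>, x can be replaced by \<open>x * g\<close>; then every term carries g,
  and it cancels.\<close>

lemma explicit_bound:
  fixes x A \<eta> \<alpha> q X e g :: real
  assumes \<eta>: "\<eta> = 1 / (1 - \<alpha>)" "0 < \<alpha>" "\<alpha> < 1" and x: "0 < x" and e: "0 < e" and g: "1 \<le> g" and A: "0 \<le> A" "A powr \<eta> \<le> e * g * q"
    and X: "X * e * g = (x powr (1 - \<alpha>) + A) powr \<eta>"
  shows "X \<le> 2 powr (\<eta> - 1) * (x * (1 / e) + q)"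
proof -
  have \<eta>1: "1 < \<eta>" "(1 - \<alpha>) * \<eta> = 1" using \<eta> by auto
  have "X * e * g \<le> 2 powr (\<eta> - 1) * ((x powr (1 - \<alpha>)) powr \<eta> + A powr \<eta>)"
    unfolding X by (rule powr_add_le) (use A \<eta>1 in auto)
  also have "(x powr (1 - \<alpha>)) powr \<eta> = x" using x \<eta>1 by (simp add: powr_powr)
  also have "2 powr (\<eta> - 1) * (x + A powr \<eta>) \<le> 2 powr (\<eta> - 1) * (x * g + e * g * q)"
    using x g A(2) by (intro mult_left_mono add_mono) auto
  also have "\<dots> = (2 powr (\<eta> - 1) * (x * (1 / e) + q)) * (e * g)"
    using e by (simp add: field_simps)
  finally have "X * (e * g) \<le> (2 powr (\<eta> - 1) * (x * (1 / e) + q)) * (e * g)" by (simp add: mult.assoc)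
  moreover have "0 < e * g" using e g by simp
  ultimately show ?thesis by (rule mult_right_le_imp_le)
qed

text \<open>Both solutions share A, so \<open>powr_difference_bound\<close> applies to the powers of
  x and y. The resulting constant involves \<open>\<epsilon>\<close> and \<open>\<eta>\<close>
  alone.\<close>

lemma explicit_difference_bound:
  fixes x y A \<eta> \<alpha> q X Y e g \<epsilon> :: real
  assumes \<eta>: "\<eta> = 1 / (1 - \<alpha>)" "0 < \<alpha>" "\<alpha> < 1" and xy: "0 < x" "0 < y" and e: "0 < e" and g: "1 \<le> g" and A: "0 \<le> A" "A powr \<eta> \<le> e * g * q"
    and X: "X * e * g = (x powr (1 - \<alpha>) + A) powr \<eta>" and Y: "Y * e * g = (y powr (1 - \<alpha>) + A) powr \<eta>" and \<epsilon>: "0 < \<epsilon>"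
  shows "\<bar>X - Y\<bar> \<le> \<eta> * (\<epsilon> / (\<eta> * 2 powr (\<eta> - 1))) powr (1 - \<eta>) * \<bar>x - y\<bar> * (1 / e) + \<epsilon> * ((x + y) * (1 / e) + q)"
proof -
  have \<eta>1: "1 < \<eta>" "(1 - \<alpha>) * \<eta> = 1" using \<eta> by auto
  \<comment> \<open>Chosen so that the coefficient of the second term in
    \<open>powr_difference_bound\<close> is exactly \<open>\<epsilon>\<close>.\<close>
  define \<delta> where "\<delta> = \<epsilon> / (\<eta> * 2 powr (\<eta> - 1))"
  have \<delta>: "0 < \<delta>" "\<eta> * \<delta> * 2 powr (\<eta> - 1) = \<epsilon>" using \<eta>1 \<epsilon> by (auto simp: \<delta>_def)
  define C where "C = \<eta> * \<delta> powr (1 - \<eta>)"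
  have C0: "0 \<le> C" using \<eta>1 by (simp add: C_def)
  have *: "\<bar>X - Y\<bar> \<le> C * \<bar>x - y\<bar> * (1 / e) + \<epsilon> * ((x + y) * (1 / e) + q)"
    if yx: "y \<le> x" "0 < x" "0 < y" and X: "X * e * g = (x powr (1 - \<alpha>) + A) powr \<eta>" and Y: "Y * e * g = (y powr (1 - \<alpha>) + A) powr \<eta>" for x y X Y
  proof -
    have uv: "y powr (1 - \<alpha>) \<le> x powr (1 - \<alpha>)" using yx \<eta> by (intro powr_mono2) auto
    have pw: "(x powr (1 - \<alpha>)) powr \<eta> = x" "(y powr (1 - \<alpha>)) powr \<eta> = y" using yx \<eta>1 by (auto simp: powr_powr)
    have "(X - Y) * (e * g) = (x powr (1 - \<alpha>) + A) powr \<eta> - (y powr (1 - \<alpha>) + A) powr \<eta>"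
      using X Y by (simp add: left_diff_distrib mult.assoc)
    also have "\<dots> \<le> \<eta> * \<delta> powr (1 - \<eta>) * ((x powr (1 - \<alpha>)) powr \<eta> - (y powr (1 - \<alpha>)) powr \<eta>)
        + \<eta> * \<delta> * 2 powr (\<eta> - 1) * ((x powr (1 - \<alpha>)) powr \<eta> + A powr \<eta>)"
      by (rule powr_difference_bound) (use uv A \<eta>1 \<delta> in auto)
    also have "\<dots> = C * (x - y) + \<epsilon> * (x + A powr \<eta>)" by (simp add: pw \<delta>(2) C_def)
    also have "\<dots> \<le> C * (x - y) * g + \<epsilon> * ((x + y) * g + e * g * q)"
    proof (intro add_mono mult_left_mono)
      show "C * (x - y) \<le> C * (x - y) * g"
        using mult_left_mono[OF g, of "C * (x - y)"] C0 yx by simp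
      have "x + y \<le> (x + y) * g" using mult_left_mono[OF g, of "x + y"] yx by simp
      then show "x \<le> (x + y) * g" by (rule order_trans[rotated]) (use yx in simp)
    qed (use A \<epsilon> in auto)
    also have "\<dots> = (C * (x - y) * (1 / e) + \<epsilon> * ((x + y) * (1 / e) + q)) * (e * g)"
      using e by (simp add: field_simps)
    finally have "X - Y \<le> C * (x - y) * (1 / e) + \<epsilon> * ((x + y) * (1 / e) + q)"
      by (rule mult_right_le_imp_le) (use e g in simp)
    moreover have "0 \<le> X - Y"
    proof -
      have "(y powr (1 - \<alpha>) + A) powr \<eta> \<le> (x powr (1 - \<alpha>) + A) powr \<eta>" using uv A \<eta>1 by (intro powr_mono2) auto
      then have "Y * (e * g) \<le> X * (e * g)" using X Y by (simp add: mult.assoc)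
      then have "Y \<le> X" by (rule mult_right_le_imp_le) (use e g in simp)
      then show ?thesis by simp
    qed
    ultimately show ?thesis using yx by simp
  qed
  have "\<bar>X - Y\<bar> \<le> C * \<bar>x - y\<bar> * (1 / e) + \<epsilon> * ((x + y) * (1 / e) + q)"
  proof (cases "y \<le> x")
    case True
    then show ?thesis using *[OF _ xy X Y] by blast
  next
    case False
    then show ?thesis using *[OF _ xy(2,1) Y X] by (simp add: abs_minus_commute add.commute)
  qed
  then show ?thesis by (simp add: C_def \<delta>_def)
qed

section \<open>Moment estimates\<close>

lemma consumption_factor:
  fixes c :: "real \<Rightarrow> real"
  assumes c: "\<And>t. 0 \<le> t \<Longrightarrow> 0 \<le> c t" "\<And>t. 0 \<le> t \<Longrightarrow> set_integrable lborel {0..t} c" and \<mu>: "0 < \<mu>"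
  defines "G \<equiv> \<lambda>t. exp (LINT s:{0..t}|lborel. \<mu> + c s)"
  shows "continuous_on {0..} G" "\<And>t. 1 \<le> G t" "\<And>s t. 0 \<le> s \<Longrightarrow> s \<le> t \<Longrightarrow> G s \<le> G t"
proof -
  have gi: "set_integrable lborel {0..t} (\<lambda>s. \<mu> + c s)" if "0 \<le> t" for t
    using c(2)[OF that] by (intro set_integral_add(1)) (auto intro: set_integrable_continuous)
  show "continuous_on {0..} G"
    unfolding G_def using gi by (intro continuous_intros continuous_on_indefinite_integral)
  have nn: "0 \<le> (LINT r:{s..t}|lborel. \<mu> + c r)" if "0 \<le> s" for s t
    unfolding set_lebesgue_integral_def using c(1) \<mu> that by (intro integral_nonneg_AE) (auto simp: indicator_def add_nonneg_nonneg)
  show "1 \<le> G t" for t using nn[of 0 t] by (simp add: G_def)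
  show "G s \<le> G t" if "0 \<le> s" "s \<le> t" for s t
    using set_integral_increment(1)[OF gi that order_refl] nn[OF that(1), of t] that by (simp add: G_def)
qed

section \<open>Moments of the ratios of \<open>E\<close> and of their time integrals\<close>

context wiener
begin

text \<open>Time is rounded down to multiples of \<open>1 / real (Suc i)\<close>, which leaves
  countably many measurable sections, and path continuity gives the limit. Times are cut at 0
  because the paths are continuous only on the half-line.\<close>

lemma W_jointly_measurable: "(\<lambda>p. W (max 0 (fst p)) (snd p)) \<in> borel_measurable ((borel :: real measure) \<Otimes>\<^sub>M M)"
proof (rule borel_measurable_LIMSEQ_real)
  fix p assume p: "p \<in> space ((borel :: real measure) \<Otimes>\<^sub>M M)"
  have "(\<lambda>i. real_of_int \<lfloor>real (Suc i) * fst p\<rfloor> / real (Suc i)) \<longlonglongrightarrow> fst p"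
  proof (rule LIM_zero_cancel, rule Lim_null_comparison)
    show "\<forall>\<^sub>F i in sequentially. norm (real_of_int \<lfloor>real (Suc i) * fst p\<rfloor> / real (Suc i) - fst p) \<le> inverse (real (Suc i))"
    proof (rule always_eventually, rule allI)
      fix i
      have "real_of_int \<lfloor>real (Suc i) * fst p\<rfloor> / real (Suc i) - fst p = (real_of_int \<lfloor>real (Suc i) * fst p\<rfloor> - real (Suc i) * fst p) / real (Suc i)"
        by (simp add: field_simps)
      moreover have "\<bar>real_of_int \<lfloor>real (Suc i) * fst p\<rfloor> - real (Suc i) * fst p\<bar> \<le> 1" by linarith
      ultimately show "norm (real_of_int \<lfloor>real (Suc i) * fst p\<rfloor> / real (Suc i) - fst p) \<le> inverse (real (Suc i))"
        by (simp add: abs_divide inverse_eq_divide divide_right_mono del: of_nat_Suc)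
    qed
    show "(\<lambda>i. inverse (real (Suc i))) \<longlonglongrightarrow> 0" by (rule LIMSEQ_inverse_real_of_nat)
  qed
  then have "(\<lambda>i. max 0 (real_of_int \<lfloor>real (Suc i) * fst p\<rfloor> / real (Suc i))) \<longlonglongrightarrow> max 0 (fst p)"
    by (intro tendsto_max tendsto_const)
  moreover have "continuous_on {0..} (\<lambda>t. W t (snd p))"
    using p by (intro path_continuous) (auto simp: space_pair_measure)
  ultimately show "(\<lambda>i. W (max 0 (real_of_int \<lfloor>real (Suc i) * fst p\<rfloor> / real (Suc i))) (snd p)) \<longlonglongrightarrow> W (max 0 (fst p)) (snd p)"
    by (intro continuous_on_tendsto_compose[where s="{0..}" and f="\<lambda>t. W t (snd p)"]) auto
next
  fix i
  show "(\<lambda>p. W (max 0 (real_of_int \<lfloor>real (Suc i) * fst p\<rfloor> / real (Suc i))) (snd p)) \<in> borel_measurable ((borel :: real measure) \<Otimes>\<^sub>M M)"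
  proof (rule measurable_compose_countable[where f="\<lambda>k p. W (max 0 (real_of_int k / real (Suc i))) (snd p)"])
    show "(\<lambda>p. W (max 0 (real_of_int k / real (Suc i))) (snd p)) \<in> borel_measurable ((borel :: real measure) \<Otimes>\<^sub>M M)" for k
      by (intro measurable_compose[OF measurable_snd] W_measurable) simp
    show "(\<lambda>p. \<lfloor>real (Suc i) * fst p\<rfloor>) \<in> measurable ((borel :: real measure) \<Otimes>\<^sub>M M) (count_space UNIV)" by measurable
  qed
qed

lemma E_pos: "0 < E \<sigma> t \<omega>"
  by (simp add: E_def)

lemma E_ratio_moments:
  assumes "0 \<le> s" "s \<le> t"
  shows "has_bochner_integral M (\<lambda>\<omega>. E \<sigma> s \<omega> / E \<sigma> t \<omega>) 1"
    and "has_bochner_integral M (\<lambda>\<omega>. (E \<sigma> s \<omega> / E \<sigma> t \<omega>)\<^sup>2) (exp (\<sigma>\<^sup>2 * (t - s)))"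
proof -
  have c: "has_bochner_integral M (\<lambda>\<omega>. 1 :: real) 1" by (simp add: has_bochner_integral_iff P.prob_space)
  have "has_bochner_integral M (\<lambda>\<omega>. E \<sigma> s \<omega> / E \<sigma> t \<omega>) 1 \<and> has_bochner_integral M (\<lambda>\<omega>. (E \<sigma> s \<omega> / E \<sigma> t \<omega>)\<^sup>2) (exp (\<sigma>\<^sup>2 * (t - s)))"
  \<comment> \<open>The normal law of the increments is available for s < t; for equal times the
    ratio is 1.\<close>
  proof (cases "s = t")
    case True
    then show ?thesis using c E_pos[of \<sigma> t, THEN less_imp_neq] by simp
  next
    case False
    then have st: "s < t" using assms by simp
    have r1: "E \<sigma> s \<omega> / E \<sigma> t \<omega> = exp (- (\<sigma>\<^sup>2 * (t - s) / 2)) * exp ((-\<sigma>) * incr s t \<omega>)" for \<omega>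
      unfolding E_def exp_diff[symmetric] exp_add[symmetric] by (simp add: field_simps)
    have r2: "(E \<sigma> s \<omega> / E \<sigma> t \<omega>)\<^sup>2 = exp (- (\<sigma>\<^sup>2 * (t - s))) * exp ((-2 * \<sigma>) * incr s t \<omega>)" for \<omega>
      unfolding E_def exp_diff[symmetric] exp_add[symmetric] exp_double[symmetric] by (simp add: field_simps)
    have "has_bochner_integral M (\<lambda>\<omega>. exp (- (\<sigma>\<^sup>2 * (t - s) / 2)) * exp ((-\<sigma>) * incr s t \<omega>)) (exp (- (\<sigma>\<^sup>2 * (t - s) / 2)) * exp ((-\<sigma>)\<^sup>2 * (t - s) / 2))"
      by (intro has_bochner_integral_mult_right incr_exp_moments(1) assms(1) st)
    moreover have "exp (- (\<sigma>\<^sup>2 * (t - s) / 2)) * exp ((-\<sigma>)\<^sup>2 * (t - s) / 2) = 1"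
      unfolding exp_add[symmetric] by simp
    moreover have "has_bochner_integral M (\<lambda>\<omega>. exp (- (\<sigma>\<^sup>2 * (t - s))) * exp ((-2 * \<sigma>) * incr s t \<omega>)) (exp (- (\<sigma>\<^sup>2 * (t - s))) * exp ((-2 * \<sigma>)\<^sup>2 * (t - s) / 2))"
      by (intro has_bochner_integral_mult_right incr_exp_moments(1) assms(1) st)
    moreover have "exp (- (\<sigma>\<^sup>2 * (t - s))) * exp ((-2 * \<sigma>)\<^sup>2 * (t - s) / 2) = exp (\<sigma>\<^sup>2 * (t - s))"
      unfolding exp_add[symmetric] by (simp add: field_simps)
    ultimately show ?thesis unfolding r2 unfolding r1 by simp
  qed
  then show "has_bochner_integral M (\<lambda>\<omega>. E \<sigma> s \<omega> / E \<sigma> t \<omega>) 1"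
    and "has_bochner_integral M (\<lambda>\<omega>. (E \<sigma> s \<omega> / E \<sigma> t \<omega>)\<^sup>2) (exp (\<sigma>\<^sup>2 * (t - s)))" by auto
qed

text \<open>Tonelli, carried out in the extended nonnegative reals so that integrability of the time
  integral comes out of the computation.\<close>

lemma time_integral_expectation:
  fixes f :: "real \<Rightarrow> (real \<Rightarrow> real) \<Rightarrow> real"
  assumes meas: "(\<lambda>p. f (fst p) (snd p)) \<in> borel_measurable ((borel :: real measure) \<Otimes>\<^sub>M M)"
    and cont: "\<And>\<omega>. \<omega> \<in> space P \<Longrightarrow> continuous_on {0..t} (\<lambda>s. f s \<omega>)"
    and nn: "\<And>s \<omega>. 0 \<le> f s \<omega>"
    and k: "\<And>s. s \<in> {0..t} \<Longrightarrow> has_bochner_integral M (f s) (k s)" and kc: "continuous_on {0..t} k"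
  shows "has_bochner_integral M (\<lambda>\<omega>. LINT s:{0..t}|lborel. f s \<omega>) (LINT s:{0..t}|lborel. k s)"
proof -
  interpret pair_sigma_finite lborel M
    by (intro pair_sigma_finite.intro lborel.sigma_finite_measure_axioms M.sigma_finite_measure_axioms)
  have k0: "0 \<le> k s" if "s \<in> {0..t}" for s
  proof -
    have "0 \<le> M.expectation (f s)" by (rule Bochner_Integration.integral_nonneg) (rule nn)
    then show ?thesis using k[OF that] by (simp add: has_bochner_integral_iff)
  qed
  have meas': "(\<lambda>p. f (fst p) (snd p)) \<in> borel_measurable (lborel \<Otimes>\<^sub>M M)"
    using meas by (subst measurable_cong_sets[OF sets_pair_measure_cong[OF sets_lborel refl] refl])
  have ms: "(\<lambda>p. ennreal (f (fst p) (snd p)) * indicator {0..t} (fst p)) \<in> borel_measurable (lborel \<Otimes>\<^sub>M M)"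
    using meas' by measurable
  have ms2: "(\<lambda>(\<omega>, s). indicator {0..t} s *\<^sub>R f s \<omega>) \<in> borel_measurable (M \<Otimes>\<^sub>M lborel)"
    using meas' by (subst measurable_pair_swap_iff) (simp add: split_def)
  have eqn: "ennreal (LINT s:{0..t}|lborel. h s) = (\<integral>\<^sup>+s. ennreal (h s) * indicator {0..t} s \<partial>lborel)"
    if "continuous_on {0..t} h" "\<And>s. s \<in> {0..t} \<Longrightarrow> 0 \<le> h s" for h :: "real \<Rightarrow> real"
  proof -
    have "integrable lborel (\<lambda>s. indicator {0..t} s *\<^sub>R h s)"
      using set_integrable_continuous[OF that(1)] by (simp add: set_integrable_def)
    then have "(\<integral>\<^sup>+s. ennreal (indicator {0..t} s *\<^sub>R h s) \<partial>lborel) = ennreal (LINT s:{0..t}|lborel. h s)"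
      unfolding set_lebesgue_integral_def using that(2) by (intro nn_integral_eq_integral) (auto simp: indicator_def)
    moreover have "ennreal (indicator {0..t} s *\<^sub>R h s) = ennreal (h s) * indicator {0..t} s" for s
      by (simp add: indicator_def)
    ultimately show ?thesis by simp
  qed
  have "(\<integral>\<^sup>+\<omega>. ennreal (LINT s:{0..t}|lborel. f s \<omega>) \<partial>M) = (\<integral>\<^sup>+\<omega>. (\<integral>\<^sup>+s. ennreal (f s \<omega>) * indicator {0..t} s \<partial>lborel) \<partial>M)"
    using cont nn by (intro nn_integral_cong eqn) auto
  also have "\<dots> = (\<integral>\<^sup>+s. (\<integral>\<^sup>+\<omega>. ennreal (f s \<omega>) * indicator {0..t} s \<partial>M) \<partial>lborel)"
    using Fubini[OF ms] by simp
  also have "\<dots> = (\<integral>\<^sup>+s. ennreal (k s) * indicator {0..t} s \<partial>lborel)"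
  proof (rule nn_integral_cong)
    fix s
    show "(\<integral>\<^sup>+\<omega>. ennreal (f s \<omega>) * indicator {0..t} s \<partial>M) = ennreal (k s) * indicator {0..t} s"
    proof (cases "s \<in> {0..t}")
      case True
      then show ?thesis using nn_integral_eq_integral[of M "f s"] k[OF True] nn by (simp add: has_bochner_integral_iff)
    qed simp
  qed
  also have "\<dots> = ennreal (LINT s:{0..t}|lborel. k s)" using kc k0 by (intro eqn[symmetric])
  finally have main: "(\<integral>\<^sup>+\<omega>. ennreal (LINT s:{0..t}|lborel. f s \<omega>) \<partial>M) = ennreal (LINT s:{0..t}|lborel. k s)" .
  have Jm: "(\<lambda>\<omega>. LINT s:{0..t}|lborel. f s \<omega>) \<in> borel_measurable M"
    unfolding set_lebesgue_integral_def by (rule lborel.borel_measurable_lebesgue_integral[OF ms2])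
  have J0: "0 \<le> (LINT s:{0..t}|lborel. h s)" if "\<And>s. s \<in> {0..t} \<Longrightarrow> 0 \<le> h s" for h :: "real \<Rightarrow> real"
    unfolding set_lebesgue_integral_def using that by (intro integral_nonneg_AE) (auto simp: indicator_def)
  show ?thesis
    by (rule has_bochner_integral_nn_integral[OF Jm _ _ main]) (use J0 nn k0 in auto)
qed

lemma E_ratio_time_integrals:
  assumes t: "0 \<le> t" and \<sigma>: "0 < \<sigma>"
  shows "has_bochner_integral M (\<lambda>\<omega>. LINT s:{0..t}|lborel. E \<sigma> s \<omega> / E \<sigma> t \<omega>) t"
    and "\<exists>r. has_bochner_integral M (\<lambda>\<omega>. LINT s:{0..t}|lborel. (E \<sigma> s \<omega> / E \<sigma> t \<omega>)\<^sup>2) r \<and> r \<le> exp (\<sigma>\<^sup>2 * t) / \<sigma>\<^sup>2"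
proof -
  \<comment> \<open>Agrees with the ratio on \<open>{0..t}\<close>; cutting negative times makes it
    jointly measurable on the whole line.\<close>
  define f where "f s \<omega> = E \<sigma> (max 0 s) \<omega> / E \<sigma> t \<omega>" for s \<omega>
  have "(\<lambda>p. E \<sigma> (max 0 (fst p)) (snd p)) \<in> borel_measurable ((borel :: real measure) \<Otimes>\<^sub>M M)"
    unfolding E_def using W_jointly_measurable by measurable
  moreover have "(\<lambda>p. E \<sigma> t (snd p)) \<in> borel_measurable ((borel :: real measure) \<Otimes>\<^sub>M M)"
  proof (rule measurable_compose[OF measurable_snd])
    have [measurable]: "W t \<in> borel_measurable M" using t by (rule W_measurable)
    show "E \<sigma> t \<in> borel_measurable M" unfolding E_def[abs_def] by measurable
  qed
  ultimately have fm: "(\<lambda>p. f (fst p) (snd p)) \<in> borel_measurable ((borel :: real measure) \<Otimes>\<^sub>M M)"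
    unfolding f_def by (rule borel_measurable_divide)
  then have fm2: "(\<lambda>p. (f (fst p) (snd p))\<^sup>2) \<in> borel_measurable ((borel :: real measure) \<Otimes>\<^sub>M M)"
    by (rule borel_measurable_power)
  have f0: "0 \<le> f s \<omega>" for s \<omega> using E_pos by (simp add: f_def less_imp_le)
  have feq: "f s \<omega> = E \<sigma> s \<omega> / E \<sigma> t \<omega>" if "s \<in> {0..t}" for s \<omega> using that by (simp add: f_def max_def)
  have fc: "continuous_on {0..t} (\<lambda>s. f s \<omega>)" if "\<omega> \<in> space P" for \<omega>
  proof -
    have "continuous_on {0..t} (\<lambda>s. E \<sigma> s \<omega> / E \<sigma> t \<omega>)"
      using continuous_on_subset[OF E_continuous[OF that], of "{0..t}"] less_imp_neq[OF E_pos, of \<sigma> t \<omega>]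
      by (intro continuous_intros) auto
    then show ?thesis by (rule continuous_on_eq) (simp add: feq)
  qed
  have "has_bochner_integral M (\<lambda>\<omega>. LINT s:{0..t}|lborel. f s \<omega>) (LINT s:{0..t}|lborel. 1)"
  proof (rule time_integral_expectation[OF fm fc f0])
    fix s assume "s \<in> {0..t}"
    then show "has_bochner_integral M (f s) 1" using E_ratio_moments(1)[of s t \<sigma>] feq[of s] by (simp cong: has_bochner_integral_cong)
  qed auto
  moreover have "(LINT s:{0..t}|lborel. f s \<omega>) = (LINT s:{0..t}|lborel. E \<sigma> s \<omega> / E \<sigma> t \<omega>)" for \<omega>
    by (rule set_lebesgue_integral_cong) (auto simp: feq)
  moreover have "(LINT s:{0..t}|lborel. 1) = t" using t by (simp add: set_lebesgue_integral_def)
  ultimately show "has_bochner_integral M (\<lambda>\<omega>. LINT s:{0..t}|lborel. E \<sigma> s \<omega> / E \<sigma> t \<omega>) t" by simp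
  have ec: "continuous_on {0..t} (\<lambda>s. exp (\<sigma>\<^sup>2 * (t - s)))" by (intro continuous_intros)
  have "has_bochner_integral M (\<lambda>\<omega>. LINT s:{0..t}|lborel. (f s \<omega>)\<^sup>2) (LINT s:{0..t}|lborel. exp (\<sigma>\<^sup>2 * (t - s)))"
  proof (rule time_integral_expectation[OF fm2 _ _ _ ec])
    fix s assume "s \<in> {0..t}"
    then show "has_bochner_integral M (\<lambda>\<omega>. (f s \<omega>)\<^sup>2) (exp (\<sigma>\<^sup>2 * (t - s)))"
      using E_ratio_moments(2)[of s t \<sigma>] feq[of s] by (simp cong: has_bochner_integral_cong)
  qed (auto intro: continuous_on_power fc)
  moreover have "(LINT s:{0..t}|lborel. (f s \<omega>)\<^sup>2) = (LINT s:{0..t}|lborel. (E \<sigma> s \<omega> / E \<sigma> t \<omega>)\<^sup>2)" for \<omega>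
    by (rule set_lebesgue_integral_cong) (auto simp: feq)
  moreover have "(LINT s:{0..t}|lborel. exp (\<sigma>\<^sup>2 * (t - s))) \<le> exp (\<sigma>\<^sup>2 * t) / \<sigma>\<^sup>2"
  proof -
    \<comment> \<open>The exact value is
      \<open>(exp (\<sigma>\<^sup>2 * t) - 1) / \<sigma>\<^sup>2\<close>, and the subtracted term is
      dropped in the bound.\<close>
    have "((\<lambda>s. exp (\<sigma>\<^sup>2 * (t - s))) has_integral (- exp (\<sigma>\<^sup>2 * (t - t)) / \<sigma>\<^sup>2) - (- exp (\<sigma>\<^sup>2 * (t - 0)) / \<sigma>\<^sup>2)) {0..t}"
    proof (rule fundamental_theorem_of_calculus[OF t])
      fix s
      have "((\<lambda>s. - exp (\<sigma>\<^sup>2 * (t - s)) / \<sigma>\<^sup>2) has_real_derivative exp (\<sigma>\<^sup>2 * (t - s))) (at s within {0..t})"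
        using \<sigma> by (auto intro!: derivative_eq_intros simp: field_simps power2_eq_square power4_eq_xxxx)
      then show "((\<lambda>s. - exp (\<sigma>\<^sup>2 * (t - s)) / \<sigma>\<^sup>2) has_vector_derivative exp (\<sigma>\<^sup>2 * (t - s))) (at s within {0..t})"
        by (simp add: has_real_derivative_iff_has_vector_derivative)
    qed
    then have "integral {0..t} (\<lambda>s. exp (\<sigma>\<^sup>2 * (t - s))) = exp (\<sigma>\<^sup>2 * t) / \<sigma>\<^sup>2 - 1 / \<sigma>\<^sup>2"
      by (simp add: integral_unique)
    moreover have "(LINT s:{0..t}|lborel. exp (\<sigma>\<^sup>2 * (t - s))) = integral {0..t} (\<lambda>s. exp (\<sigma>\<^sup>2 * (t - s)))"
      by (rule set_borel_integral_eq_integral(2)[OF set_integrable_continuous[OF ec]])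
    moreover have "0 \<le> 1 / \<sigma>\<^sup>2" by simp
    ultimately show ?thesis by linarith
  qed
  ultimately show "\<exists>r. has_bochner_integral M (\<lambda>\<omega>. LINT s:{0..t}|lborel. (E \<sigma> s \<omega> / E \<sigma> t \<omega>)\<^sup>2) r \<and> r \<le> exp (\<sigma>\<^sup>2 * t) / \<sigma>\<^sup>2"
    by (intro exI[of _ "LINT s:{0..t}|lborel. exp (\<sigma>\<^sup>2 * (t - s))"]) simp
qed

section \<open>The explicit formula for strong solutions\<close>

lemma consumption_integrable:
  assumes "c \<in> consumption_processes P"
  shows "AE \<omega> in M. \<forall>t\<ge>0. set_integrable lborel {0..t} (\<lambda>s. c s \<omega>)"
proof -
  have prog: "progressively_measurable F c" and nn: "\<And>t \<omega>. 0 \<le> t \<Longrightarrow> \<omega> \<in> space P \<Longrightarrow> 0 \<le> c t \<omega>"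
    and fin: "AE \<omega> in M. \<forall>t>0. (\<integral>\<^sup>+s\<in>{0..t}. ennreal (c s \<omega>) \<partial>lborel) < \<infinity>"
    using assms by (auto simp: consumption_processes_def)
  show ?thesis
    using fin AE_space
  proof eventually_elim
    case (elim \<omega>)
    then have \<omega>: "\<omega> \<in> space P" by simp
    have pos: "set_integrable lborel {0..t} (\<lambda>s. c s \<omega>)" if t: "0 < t" for t
    proof -
      have "(\<lambda>(s, \<omega>). c s \<omega>) \<in> borel_measurable (restrict_space borel {0..t} \<Otimes>\<^sub>M F t)"
        using prog t by (simp add: progressively_measurable_def)
      then have "(\<lambda>s. c s \<omega>) \<in> borel_measurable (restrict_space borel {0..t})"
        using measurable_compose[OF measurable_Pair2'[of \<omega> "F t"]] \<omega> by fastforce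
      then have m: "(\<lambda>s. indicator {0..t} s *\<^sub>R c s \<omega>) \<in> borel_measurable borel"
        by (subst (asm) borel_measurable_restrict_space_iff) auto
      have "(\<integral>\<^sup>+s. ennreal (norm (indicator {0..t} s *\<^sub>R c s \<omega>)) \<partial>lborel) = (\<integral>\<^sup>+s\<in>{0..t}. ennreal (c s \<omega>) \<partial>lborel)"
        using nn[OF _ \<omega>] by (intro nn_integral_cong) (auto simp: indicator_def)
      also have "\<dots> < \<infinity>" using elim t by simp
      finally show ?thesis
        using m unfolding set_integrable_def by (intro integrableI_bounded) auto
    qed
    show ?case
    proof (intro allI impI)
      fix t :: real assume "0 \<le> t"
      then show "set_integrable lborel {0..t} (\<lambda>s. c s \<omega>)"
        \<comment> \<open>Finiteness is known for positive times; the larger interval also covers t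
          = 0.\<close>
        using set_integrable_subset[OF pos[of "t + 1"], of "{0..t}"] by auto
    qed
  qed
qed

lemma strong_solution_explicit:
  assumes \<alpha>: "0 < \<alpha>" "\<alpha> < 1" and \<sigma>: "0 < \<sigma>" and \<mu>: "0 < \<mu>" and x: "0 < x"
    and c: "c \<in> consumption_processes P" and X: "strong_solution P \<alpha> \<sigma> \<mu> c x X"
  shows "AE \<omega> in M. \<forall>t\<ge>0. X t \<omega> * E \<sigma> t \<omega> * exp (LINT s:{0..t}|lborel. \<mu> + c s \<omega>) =
    (x powr (1 - \<alpha>) + (1 - \<alpha>) * (LINT s:{0..t}|lborel.
       (E \<sigma> s \<omega> * exp (LINT r:{0..s}|lborel. \<mu> + c r \<omega>)) powr (1 - \<alpha>))) powr (1 / (1 - \<alpha>))"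
proof -
  obtain I where adX: "adapted F X" and cX: "continuous_process M X" and nn: "AE \<omega> in M. \<forall>t\<ge>0. 0 \<le> X t \<omega>"
    and ito: "is_ito_integral M F W (\<lambda>t \<omega>. \<sigma> * X t \<omega>) I"
    and eq: "AE \<omega> in M. \<forall>t\<ge>0.
          set_integrable lborel {0..t} (\<lambda>s. X s \<omega> powr \<alpha> - \<mu> * X s \<omega> - c s \<omega> * X s \<omega>) \<and>
          X t \<omega> = x + (LINT s:{0..t}|lborel. X s \<omega> powr \<alpha> - \<mu> * X s \<omega> - c s \<omega> * X s \<omega>) - I t \<omega>"
    using X unfolding strong_solution_def by blast
  have cn: "0 \<le> c t \<omega>" if "0 \<le> t" "\<omega> \<in> space P" for t \<omega>
    using c that by (simp add: consumption_processes_def)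
  show ?thesis
    using integrating_factor[OF \<sigma> adX cX ito eq] nn cX[unfolded continuous_process_def]
      consumption_integrable[OF c] AE_space
  proof eventually_elim
    case (elim \<omega>)
    then have \<omega>: "\<omega> \<in> space P" by simp
    show ?case
    proof (intro allI impI)
      fix t :: real assume "0 \<le> t"
      then show "X t \<omega> * E \<sigma> t \<omega> * exp (LINT s:{0..t}|lborel. \<mu> + c s \<omega>) =
        (x powr (1 - \<alpha>) + (1 - \<alpha>) * (LINT s:{0..t}|lborel.
          (E \<sigma> s \<omega> * exp (LINT r:{0..s}|lborel. \<mu> + c r \<omega>)) powr (1 - \<alpha>))) powr (1 / (1 - \<alpha>))"
        using elim cn[OF _ \<omega>] E_continuous[OF \<omega>] E_pos
        by (intro explicit_solution[OF \<alpha> \<mu> x, where e="\<lambda>t. E \<sigma> t \<omega>" and X="\<lambda>t. X t \<omega>" and c="\<lambda>t. c t \<omega>"]) auto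
    qed
  qed
qed

end

theorem proposition3p2:
  fixes \<alpha> \<sigma> \<mu> \<eta> :: real
    and P :: "(real \<Rightarrow> real) measure"
    and c :: "real \<Rightarrow> (real \<Rightarrow> real) \<Rightarrow> real"
    and X :: "real \<Rightarrow> real \<Rightarrow> (real \<Rightarrow> real) \<Rightarrow> real"
  assumes "0 < \<alpha>" "\<alpha> < 1" "0 < \<sigma>" "0 < \<mu>"
    and "\<eta> = 1 / (1 - \<alpha>)"
    and "wiener_measure P"
    and "c \<in> consumption_processes P"
    and "\<And>x. 0 < x \<Longrightarrow> strong_solution P \<alpha> \<sigma> \<mu> c x (X x)"
  shows "(\<forall>x>0. \<forall>t\<ge>0.
            integrable (completion P) (X x t) \<and>
            (\<integral>\<omega>. X x t \<omega> \<partial>completion P) \<le> 2 powr (\<eta> - 1) * (x + t powr \<eta>)) \<and>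
         (\<forall>x>0. \<forall>t\<ge>0.
            integrable (completion P) (\<lambda>\<omega>. (X x t \<omega>)\<^sup>2) \<and>
            (\<integral>\<omega>. (X x t \<omega>)\<^sup>2 \<partial>completion P)
              \<le> 2 powr (2 * \<eta> - 1) * exp (\<sigma>\<^sup>2 * t) * (x\<^sup>2 + t powr (2 * \<eta> - 1) / \<sigma>\<^sup>2)) \<and>
         (\<forall>\<epsilon>>0. \<exists>C>0. \<forall>x>0. \<forall>y>0. \<forall>t\<ge>0.
            integrable (completion P) (\<lambda>\<omega>. \<bar>X x t \<omega> - X y t \<omega>\<bar>) \<and>
            (\<integral>\<omega>. \<bar>X x t \<omega> - X y t \<omega>\<bar> \<partial>completion P) \<le> C * \<bar>x - y\<bar> + \<epsilon> * (x + y + t powr \<eta>))"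
proof -
  note \<alpha> = assms(1,2) and \<sigma> = assms(3) and \<mu> = assms(4) and \<eta> = assms(5) and c = assms(7)
  interpret wiener P by (rule wiener.intro) fact
  have \<eta>1: "1 < \<eta>" using \<alpha> by (simp add: \<eta>)
  \<comment> \<open>Because the path starts at 0, this is the ratio of \<open>E\<close> at times 0
    and t, whose moments are known.\<close>
  define N where "N t \<omega> = 1 / E \<sigma> t \<omega>" for t \<omega>
  define J where "J t \<omega> = (LINT s:{0..t}|lborel. E \<sigma> s \<omega> / E \<sigma> t \<omega>)" for t \<omega>
  define J2 where "J2 t \<omega> = (LINT s:{0..t}|lborel. (E \<sigma> s \<omega> / E \<sigma> t \<omega>)\<^sup>2)" for t \<omega>
  have Neq: "E \<sigma> 0 \<omega> / E \<sigma> t \<omega> = N t \<omega>" if "\<omega> \<in> space M" for t \<omega>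
    using path_zero[of \<omega>] that by (simp add: N_def E_def)
  have EN: "has_bochner_integral M (N t) 1" "has_bochner_integral M (\<lambda>\<omega>. (N t \<omega>)\<^sup>2) (exp (\<sigma>\<^sup>2 * t))" if "0 \<le> t" for t
  proof -
    note r = E_ratio_moments[OF order_refl that, of \<sigma>, unfolded diff_0_right]
    show "has_bochner_integral M (N t) 1"
      by (rule has_bochner_integral_cong[THEN iffD1, OF refl _ refl r(1)]) (rule Neq)
    show "has_bochner_integral M (\<lambda>\<omega>. (N t \<omega>)\<^sup>2) (exp (\<sigma>\<^sup>2 * t))"
      by (rule has_bochner_integral_cong[THEN iffD1, OF refl _ refl r(2)]) (simp only: Neq)
  qed
  have EJ: "has_bochner_integral M (J t) t" if "0 \<le> t" for t
    unfolding J_def[abs_def] by (rule E_ratio_time_integrals(1)[OF that \<sigma>])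
  have tt: "t powr (\<eta> - 1) * t = t powr \<eta>" if "0 \<le> t" for t
    using powr_mult_base[OF that, of "\<eta> - 1"] by (simp add: mult.commute)
  have Xm: "X x t \<in> borel_measurable M" if "0 < x" "0 \<le> t" for x t
    using assms(8)[OF that(1)] that(2) by (auto simp: strong_solution_def adapted_def intro: F_measurable_M)
  have Xnn: "AE \<omega> in M. 0 \<le> X x t \<omega>" if "0 < x" "0 \<le> t" for x t
  proof -
    have "AE \<omega> in M. \<forall>t\<ge>0. 0 \<le> X x t \<omega>" using assms(8)[OF that(1)] by (simp add: strong_solution_def)
    then show ?thesis by eventually_elim (use that in simp)
  qed
  define G where "G t \<omega> = exp (LINT s:{0..t}|lborel. \<mu> + c s \<omega>)" for t \<omega>
  \<comment> \<open>The same for every initial value x, which is what makes solutions under a common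
    control comparable.\<close>
  define A where "A t \<omega> = (1 - \<alpha>) * (LINT s:{0..t}|lborel. (E \<sigma> s \<omega> * G s \<omega>) powr (1 - \<alpha>))" for t \<omega>
  have formula: "AE \<omega> in M. X x t \<omega> * E \<sigma> t \<omega> * G t \<omega> = (x powr (1 - \<alpha>) + A t \<omega>) powr \<eta>" if "0 < x" "0 \<le> t" for x t
    using strong_solution_explicit[OF \<alpha> \<sigma> \<mu> that(1) c assms(8)[OF that(1)]]
    by eventually_elim (use that(2) in \<open>simp add: A_def G_def \<eta>\<close>)
  have A: "AE \<omega> in M. 1 \<le> G t \<omega> \<and> 0 \<le> A t \<omega> \<and> A t \<omega> powr \<eta> \<le> E \<sigma> t \<omega> * G t \<omega> * (t powr (\<eta> - 1) * J t \<omega>)" if t: "0 \<le> t" for t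
    using consumption_integrable[OF c] AE_space
  proof eventually_elim
    case (elim \<omega>)
    then have \<omega>: "\<omega> \<in> space P" by simp
    have cn: "0 \<le> c t \<omega>" if "0 \<le> t" for t using c that \<omega> by (simp add: consumption_processes_def)
    have ci: "set_integrable lborel {0..t} (\<lambda>s. c s \<omega>)" if "0 \<le> t" for t using elim that by simp
    note G = consumption_factor[where c="\<lambda>t. c t \<omega>", OF cn ci \<mu>, folded G_def]
    have sub: "{0..t} \<subseteq> {0..}" by auto
    have G0: "0 < G s \<omega>" for s by (simp add: G_def)
    note bounds = explicit_integral_bound[OF \<alpha> t \<eta> continuous_on_subset[OF E_continuous[OF \<omega>] sub] E_pos
        continuous_on_subset[OF G(1) sub] G0 G(3)]
    show ?case
      unfolding A_def J_def using G(2) bounds by blast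
  qed
  have bound: "AE \<omega> in M. X x t \<omega> \<le> 2 powr (\<eta> - 1) * (x * N t \<omega> + t powr (\<eta> - 1) * J t \<omega>)" if "0 < x" "0 \<le> t" for x t
    using formula[OF that] A[OF that(2)]
    by eventually_elim (simp add: N_def, rule explicit_bound[OF \<eta> \<alpha> that(1) E_pos, simplified], auto)
  have first: "integrable M (X x t) \<and> M.expectation (X x t) \<le> 2 powr (\<eta> - 1) * (x + t powr \<eta>)" if "0 < x" "0 \<le> t" for x t
  proof -
    have hb: "has_bochner_integral M (\<lambda>\<omega>. 2 powr (\<eta> - 1) * (x * N t \<omega> + t powr (\<eta> - 1) * J t \<omega>))
        (2 powr (\<eta> - 1) * (x * 1 + t powr (\<eta> - 1) * t))"
      by (intro has_bochner_integral_mult_right has_bochner_integral_add EN EJ that)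
    note hb' = hb[unfolded has_bochner_integral_iff]
    have i: "integrable M (X x t)"
    proof (rule Bochner_Integration.integrable_bound[OF hb'[THEN conjunct1] Xm[OF that]])
      show "AE \<omega> in M. norm (X x t \<omega>) \<le> norm (2 powr (\<eta> - 1) * (x * N t \<omega> + t powr (\<eta> - 1) * J t \<omega>))"
        using bound[OF that] Xnn[OF that] by eventually_elim (metis abs_ge_self abs_of_nonneg order_trans real_norm_def)
    qed
    have "M.expectation (X x t) \<le> 2 powr (\<eta> - 1) * (x * 1 + t powr (\<eta> - 1) * t)"
      using integral_mono_AE[OF i hb'[THEN conjunct1] bound[OF that]] hb' by simp
    then show ?thesis using i by (simp add: tt that)
  qed
  have second: "integrable M (\<lambda>\<omega>. (X x t \<omega>)\<^sup>2) \<and>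
      M.expectation (\<lambda>\<omega>. (X x t \<omega>)\<^sup>2) \<le> 2 powr (2 * \<eta> - 1) * exp (\<sigma>\<^sup>2 * t) * (x\<^sup>2 + t powr (2 * \<eta> - 1) / \<sigma>\<^sup>2)"
    if "0 < x" "0 \<le> t" for x t
  proof -
    obtain r where r: "has_bochner_integral M (J2 t) r" "r \<le> exp (\<sigma>\<^sup>2 * t) / \<sigma>\<^sup>2"
      using E_ratio_time_integrals(2)[OF \<open>0 \<le> t\<close> \<sigma>] unfolding J2_def[abs_def] by blast
    have hb: "has_bochner_integral M (\<lambda>\<omega>. 2 powr (2 * \<eta> - 1) * (x\<^sup>2 * (N t \<omega>)\<^sup>2 + t powr (2 * \<eta> - 1) * J2 t \<omega>))
        (2 powr (2 * \<eta> - 1) * (x\<^sup>2 * exp (\<sigma>\<^sup>2 * t) + t powr (2 * \<eta> - 1) * r))"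
      by (intro has_bochner_integral_mult_right has_bochner_integral_add EN r that)
    note hb' = hb[unfolded has_bochner_integral_iff]
    \<comment> \<open>Jensen with exponent 2 gives
      \<open>(J t \<omega>)\<^sup>2 \<le> t * J2 t \<omega>\<close>, whence the power
      \<open>2 * (\<eta> - 1) + 1\<close> of t.\<close>
    have J2: "(t powr (\<eta> - 1) * J t \<omega>)\<^sup>2 \<le> t powr (2 * \<eta> - 1) * J2 t \<omega>" if "\<omega> \<in> space P" for \<omega>
    proof -
      have cont: "continuous_on {0..t} (\<lambda>s. E \<sigma> s \<omega> / E \<sigma> t \<omega>)"
        using continuous_on_subset[OF E_continuous[OF that], of "{0..t}"] less_imp_neq[OF E_pos, of \<sigma> t \<omega>]
        by (intro continuous_intros) auto
      have r0: "0 \<le> E \<sigma> s \<omega> / E \<sigma> t \<omega>" for s using E_pos by (simp add: less_imp_le)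
      have J0: "0 \<le> J t \<omega>"
        unfolding J_def set_lebesgue_integral_def using r0 by (intro integral_nonneg_AE) (auto simp: indicator_def)
      have "J t \<omega> powr 2 \<le> t powr (2 - 1) * (LINT s:{0..t}|lborel. (E \<sigma> s \<omega> / E \<sigma> t \<omega>) powr 2)"
        unfolding J_def using \<open>0 \<le> t\<close> r0 by (intro set_integral_powr_le[OF cont]) auto
      then have "(J t \<omega>)\<^sup>2 \<le> t * J2 t \<omega>"
        using J0 r0 \<open>0 \<le> t\<close> by (simp add: J2_def)
      then have "(t powr (\<eta> - 1))\<^sup>2 * (J t \<omega>)\<^sup>2 \<le> (t powr (\<eta> - 1))\<^sup>2 * (t * J2 t \<omega>)"
        by (intro mult_left_mono) auto
      moreover have "(t powr (\<eta> - 1))\<^sup>2 * t = t powr (2 * \<eta> - 1)"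
        using powr_mult_base[OF \<open>0 \<le> t\<close>, of "2 * \<eta> - 2"]
        by (simp add: power2_eq_square powr_add[symmetric] mult.commute algebra_simps)
      ultimately show ?thesis by (simp add: power_mult_distrib mult.assoc[symmetric])
    qed
    have bd: "AE \<omega> in M. (X x t \<omega>)\<^sup>2 \<le> 2 powr (2 * \<eta> - 1) * (x\<^sup>2 * (N t \<omega>)\<^sup>2 + t powr (2 * \<eta> - 1) * J2 t \<omega>)"
      using bound[OF that] Xnn[OF that] AE_space
    proof eventually_elim
      case (elim \<omega>)
      let ?a = "x * N t \<omega>" and ?b = "t powr (\<eta> - 1) * J t \<omega>"
      have "(X x t \<omega>)\<^sup>2 \<le> (2 powr (\<eta> - 1) * (?a + ?b))\<^sup>2" using elim by (intro power_mono) auto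
      also have "\<dots> = (2 powr (\<eta> - 1))\<^sup>2 * (?a + ?b)\<^sup>2" by (rule power_mult_distrib)
      \<comment> \<open>The factor 2 from squaring a sum raises the exponent of 2 from
        \<open>2 * \<eta> - 2\<close> to \<open>2 * \<eta> - 1\<close>.\<close>
      also have "\<dots> \<le> (2 powr (\<eta> - 1))\<^sup>2 * (2 * (?a\<^sup>2 + ?b\<^sup>2))"
        using zero_le_power2[of "?a - ?b"] by (intro mult_left_mono) (auto simp: power2_eq_square algebra_simps)
      also have "\<dots> = 2 powr (2 * \<eta> - 1) * (?a\<^sup>2 + ?b\<^sup>2)"
      proof -
        have "(2 powr (\<eta> - 1))\<^sup>2 * 2 = 2 powr (2 * \<eta> - 1)"
          using powr_mult_base[of 2 "2 * \<eta> - 2"] by (simp add: power2_eq_square powr_add[symmetric] mult.commute algebra_simps)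
        then show ?thesis by (metis mult.assoc)
      qed
      also have "\<dots> \<le> 2 powr (2 * \<eta> - 1) * (x\<^sup>2 * (N t \<omega>)\<^sup>2 + t powr (2 * \<eta> - 1) * J2 t \<omega>)"
        using J2[of \<omega>] elim(3) by (intro mult_left_mono add_mono) (auto simp: power_mult_distrib)
      finally show ?case .
    qed
    have i: "integrable M (\<lambda>\<omega>. (X x t \<omega>)\<^sup>2)"
    proof (rule Bochner_Integration.integrable_bound[OF hb'[THEN conjunct1]])
      show "(\<lambda>\<omega>. (X x t \<omega>)\<^sup>2) \<in> borel_measurable M" using Xm[OF that] by (intro borel_measurable_power)
      show "AE \<omega> in M. norm ((X x t \<omega>)\<^sup>2) \<le> norm (2 powr (2 * \<eta> - 1) * (x\<^sup>2 * (N t \<omega>)\<^sup>2 + t powr (2 * \<eta> - 1) * J2 t \<omega>))"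
        using bd by eventually_elim (simp only: real_norm_def, smt (verit) zero_le_power2)
    qed
    have "M.expectation (\<lambda>\<omega>. (X x t \<omega>)\<^sup>2) \<le> 2 powr (2 * \<eta> - 1) * (x\<^sup>2 * exp (\<sigma>\<^sup>2 * t) + t powr (2 * \<eta> - 1) * r)"
      using integral_mono_AE[OF i hb'[THEN conjunct1] bd] hb' by simp
    also have "\<dots> \<le> 2 powr (2 * \<eta> - 1) * (x\<^sup>2 * exp (\<sigma>\<^sup>2 * t) + t powr (2 * \<eta> - 1) * (exp (\<sigma>\<^sup>2 * t) / \<sigma>\<^sup>2))"
      using r(2) by (intro mult_left_mono add_left_mono) auto
    also have "\<dots> = 2 powr (2 * \<eta> - 1) * exp (\<sigma>\<^sup>2 * t) * (x\<^sup>2 + t powr (2 * \<eta> - 1) / \<sigma>\<^sup>2)"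
      by (simp add: algebra_simps)
    finally show ?thesis using i by blast
  qed
  have third: "\<exists>C>0. \<forall>x>0. \<forall>y>0. \<forall>t\<ge>0.
      integrable M (\<lambda>\<omega>. \<bar>X x t \<omega> - X y t \<omega>\<bar>) \<and>
      M.expectation (\<lambda>\<omega>. \<bar>X x t \<omega> - X y t \<omega>\<bar>) \<le> C * \<bar>x - y\<bar> + \<epsilon> * (x + y + t powr \<eta>)" if \<epsilon>: "0 < \<epsilon>" for \<epsilon>
  proof -
    \<comment> \<open>The constant of \<open>explicit_difference_bound\<close>. It is free of x, y
      and t, as the order of the quantifiers demands.\<close>
    define C where "C = \<eta> * (\<epsilon> / (\<eta> * 2 powr (\<eta> - 1))) powr (1 - \<eta>)"
    have C0: "0 < C" using \<eta>1 \<epsilon> by (auto simp: C_def)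
    have "integrable M (\<lambda>\<omega>. \<bar>X x t \<omega> - X y t \<omega>\<bar>) \<and>
      M.expectation (\<lambda>\<omega>. \<bar>X x t \<omega> - X y t \<omega>\<bar>) \<le> C * \<bar>x - y\<bar> + \<epsilon> * (x + y + t powr \<eta>)" if xyt: "0 < x" "0 < y" "0 \<le> t" for x y t
    proof -
      have i: "integrable M (\<lambda>\<omega>. \<bar>X x t \<omega> - X y t \<omega>\<bar>)"
        using first[OF xyt(1,3)] first[OF xyt(2,3)] by simp
      have hb: "has_bochner_integral M (\<lambda>\<omega>. C * \<bar>x - y\<bar> * N t \<omega> + \<epsilon> * ((x + y) * N t \<omega> + t powr (\<eta> - 1) * J t \<omega>))
          (C * \<bar>x - y\<bar> * 1 + \<epsilon> * ((x + y) * 1 + t powr (\<eta> - 1) * t))"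
        by (intro has_bochner_integral_mult_right has_bochner_integral_add EN EJ xyt)
      note hb' = hb[unfolded has_bochner_integral_iff]
      have bd: "AE \<omega> in M. \<bar>X x t \<omega> - X y t \<omega>\<bar> \<le> C * \<bar>x - y\<bar> * N t \<omega> + \<epsilon> * ((x + y) * N t \<omega> + t powr (\<eta> - 1) * J t \<omega>)"
        using formula[OF xyt(1,3)] formula[OF xyt(2,3)] A[OF xyt(3)]
      proof eventually_elim
        case (elim \<omega>)
        then show ?case
          unfolding C_def N_def by (intro explicit_difference_bound[OF \<eta> \<alpha> xyt(1,2) E_pos _ _ _ _ _ \<epsilon>]) auto
      qed
      have "M.expectation (\<lambda>\<omega>. \<bar>X x t \<omega> - X y t \<omega>\<bar>) \<le> C * \<bar>x - y\<bar> * 1 + \<epsilon> * ((x + y) * 1 + t powr (\<eta> - 1) * t)"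
        using integral_mono_AE[OF i hb'[THEN conjunct1] bd] hb' by simp
      then show ?thesis using i by (simp add: tt xyt)
    qed
    then show ?thesis using C0 by blast
  qed
  show ?thesis using first second third by blast
qed

end
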